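(* Let $K$ be a scattered, locally compact Hausdorff space and consider the Calkin algebra $\mathscr{B}(C_0(K))/\mathscr{K}(C_0(K))$. Then the dual essential norm $T+\mathscr{K}(C_0(K))\mapsto\|T^*\|_e$ has Bonsall's minimality property: if $|||\cdot|||$ is any algebra norm on $\mathscr{B}(C_0(K))/\mathscr{K}(C_0(K))$ satisfying $|||T+\mathscr{K}(C_0(K))|||\le\|T^*\|_e$ for all $T\in\mathscr{B}(C_0(K))$, then $|||T+\mathscr{K}(C_0(K))|||=\|T^*\|_e$ for all $T\in\mathscr{B}(C_0(K))$.
   Context: All spaces and algebras are over a scalar field $\mathbb{K}$ which is either $\mathbb{R}$ or $\mathbb{C}$. $C_0(K)$ is the Banach space of continuous functions $f:K\to\mathbb{K}$ vanishing at infinity, with the supremum norm. $\mathscr{B}(X)$ is the algebra of bounded linear operators on a Banach space $X$ and $\mathscr{K}(X)$ is the ideal of compact operators. For $T\in\mathscr{B}(C_0(K))$, $T^*\in\mathscr{B}(C_0(K)^* )$ is the adjoint operator and $\|T^*\|_e=\inf\{\|T^*-S\|:S\in\mathscr{K}(C_0(K)^* )\}$ is its essential norm. An algebra norm on an algebra is a submultiplicative vector space norm (not assumed complete). An algebra norm $\|\cdot\|$ on $\mathcal{A}$ has Bonsall's minimality property if $\|\cdot\|=|||\cdot|||$ whenever $|||\cdot|||$ is any other algebra norm on $\mathcal{A}$ satisfying $|||\cdot|||\le\|\cdot\|$. *)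

theory Defs
  imports "HOL-Analysis.Analysis"
begin

definition scattered :: "'a::topological_space set \<Rightarrow> bool"
  where "scattered S \<longleftrightarrow> (\<forall>A\<subseteq>S. A \<noteq> {} \<longrightarrow> (\<exists>x. x isolated_in A))"


section \<open>Compact operators, essential norm, algebra norms\<close>

definition compact_operator :: "('a::real_normed_vector \<Rightarrow>\<^sub>L 'b::real_normed_vector) \<Rightarrow> bool"
  where "compact_operator T \<longleftrightarrow> compact (closure (blinfun_apply T ` cball 0 1))"

text \<open>
  Elements of \<open>'a \<Rightarrow>\<^sub>L 'b\<close> are only real-linear. The scalar field \<open>'s\<close> is meant to be \<open>real\<close> or
  \<open>complex\<close>, acting by \<open>smul\<close>, and linearity over \<open>'s\<close> is imposed separately (it is automatic
  for \<open>'s = real\<close>). The infimum below is thus over all compact \<open>'s\<close>-linear operators.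
\<close>

definition essential_norm ::
    "('s \<Rightarrow> 'a \<Rightarrow> 'a) \<Rightarrow> ('a::real_normed_vector \<Rightarrow>\<^sub>L 'a) \<Rightarrow> real"
  where "essential_norm smul T =
    (INF S\<in>{S. compact_operator S \<and> (\<forall>c x. S (smul c x) = smul c (S x))}. norm (T - S))"

definition algebra_norm ::
    "('s::real_normed_field \<Rightarrow> 'a::ring \<Rightarrow> 'a) \<Rightarrow> ('a \<Rightarrow> real) \<Rightarrow> bool"
  where "algebra_norm smul N \<longleftrightarrow>
    (\<forall>a. 0 \<le> N a) \<and>
    (\<forall>a. N a = 0 \<longleftrightarrow> a = 0) \<and>
    (\<forall>c a. N (smul c a) = norm c * N a) \<and>
    (\<forall>a b. N (a + b) \<le> N a + N b) \<and>
    (\<forall>a b. N (a * b) \<le> N a * N b)"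

definition bonsall_minimal ::
    "('s::real_normed_field \<Rightarrow> 'a::ring \<Rightarrow> 'a) \<Rightarrow> ('a \<Rightarrow> real) \<Rightarrow> bool"
  where "bonsall_minimal smul N \<longleftrightarrow>
    algebra_norm smul N \<and>
    (\<forall>M. algebra_norm smul M \<and> (\<forall>a. M a \<le> N a) \<longrightarrow> (\<forall>a. M a = N a))"

lemma compact_operator_iff:
  "compact_operator T \<longleftrightarrow> (\<exists>C. compact C \<and> (\<forall>x. norm x \<le> 1 \<longrightarrow> blinfun_apply T x \<in> C))"
proof
  assume "compact_operator T"
  then show "\<exists>C. compact C \<and> (\<forall>x. norm x \<le> 1 \<longrightarrow> blinfun_apply T x \<in> C)"
    unfolding compact_operator_def
    by (intro exI[of _ "closure (blinfun_apply T ` cball 0 1)"])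
       (auto intro!: closure_subset[THEN subsetD])
next
  assume "\<exists>C. compact C \<and> (\<forall>x. norm x \<le> 1 \<longrightarrow> blinfun_apply T x \<in> C)"
  then obtain C where C: "compact C" "\<forall>x. norm x \<le> 1 \<longrightarrow> blinfun_apply T x \<in> C"
    by blast
  then have "closure (blinfun_apply T ` cball 0 1) \<subseteq> C"
    by (intro closure_minimal compact_imp_closed) auto
  then show "compact_operator T"
    unfolding compact_operator_def
    using compact_Int_closed[OF C(1) closed_closure, of "blinfun_apply T ` cball 0 1"]
    by (simp add: Int_absorb1)
qed

lemma compact_operator_0 [simp]: "compact_operator 0"
  unfolding compact_operator_iff by (intro exI[of _ "{0}"]) auto

lemma compact_operator_uminus:
  assumes "compact_operator T" shows "compact_operator (- T)"
proof -
  obtain C where "compact C" "\<forall>x. norm x \<le> 1 \<longrightarrow> blinfun_apply T x \<in> C"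
    using assms unfolding compact_operator_iff by blast
  then show ?thesis
    unfolding compact_operator_iff
    by (intro exI[of _ "uminus ` C"]) (auto simp: compact_negations blinfun.minus_left)
qed

lemma compact_operator_add:
  assumes "compact_operator S" "compact_operator T" shows "compact_operator (S + T)"
proof -
  obtain C D where "compact C" "\<forall>x. norm x \<le> 1 \<longrightarrow> blinfun_apply S x \<in> C"
    "compact D" "\<forall>x. norm x \<le> 1 \<longrightarrow> blinfun_apply T x \<in> D"
    using assms unfolding compact_operator_iff by blast
  then show ?thesis
    unfolding compact_operator_iff
    by (intro exI[of _ "{x + y |x y. x \<in> C \<and> y \<in> D}"])
       (auto simp: compact_sums blinfun.add_left)
qed

lemma compact_operator_diff:
  "compact_operator S \<Longrightarrow> compact_operator T \<Longrightarrow> compact_operator (S - T)"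
  using compact_operator_add[OF _ compact_operator_uminus] by fastforce

lemma compact_operator_compose_left:
  fixes S :: "'b::real_normed_vector \<Rightarrow>\<^sub>L 'c::real_normed_vector"
    and T :: "'a::real_normed_vector \<Rightarrow>\<^sub>L 'b"
  assumes "compact_operator T" shows "compact_operator (S o\<^sub>L T)"
proof -
  obtain C where C: "compact C" "\<forall>x. norm x \<le> 1 \<longrightarrow> blinfun_apply T x \<in> C"
    using assms unfolding compact_operator_iff by blast
  have "compact (blinfun_apply S ` C)"
    by (rule compact_continuous_image[OF linear_continuous_on[OF blinfun.bounded_linear_right] C(1)])
  with C(2) show ?thesis
    unfolding compact_operator_iff
    by (intro exI[of _ "blinfun_apply S ` C"]) auto
qed

lemma compact_operator_compose_right:
  fixes S :: "'a::real_normed_vector \<Rightarrow>\<^sub>L 'b::real_normed_vector"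
    and T :: "'b \<Rightarrow>\<^sub>L 'c::real_normed_vector"
  assumes "compact_operator T" shows "compact_operator (T o\<^sub>L S)"
proof -
  obtain C where C: "compact C" "\<forall>x. norm x \<le> 1 \<longrightarrow> blinfun_apply T x \<in> C"
    using assms unfolding compact_operator_iff by blast
  define r where "r = norm S + 1"
  have r: "r > 0" unfolding r_def by (simp add: add_nonneg_pos)
  show ?thesis
    unfolding compact_operator_iff
  proof (intro exI[of _ "(*\<^sub>R) r ` C"] conjI allI impI)
    show "compact ((*\<^sub>R) r ` C)" by (rule compact_scaling[OF C(1)])
    fix x :: 'a assume x: "norm x \<le> 1"
    have "norm (blinfun_apply S x) \<le> norm S * norm x" by (rule norm_blinfun)
    also have "\<dots> \<le> norm S" using x by (simp add: mult_left_le)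
    also have "\<dots> \<le> r" by (simp add: r_def)
    finally have "norm ((1/r) *\<^sub>R blinfun_apply S x) \<le> 1"
      using r by (simp add: divide_simps)
    then have "blinfun_apply T ((1/r) *\<^sub>R blinfun_apply S x) \<in> C" using C(2) by blast
    then have "r *\<^sub>R blinfun_apply T ((1/r) *\<^sub>R blinfun_apply S x) \<in> (*\<^sub>R) r ` C" by blast
    then show "blinfun_apply (T o\<^sub>L S) x \<in> (*\<^sub>R) r ` C"
      using r by (simp add: blinfun.scaleR_right)
  qed
qed

lemma essential_norm_cong:
  assumes "compact_operator (A - B)"
    and "\<And>c x. blinfun_apply (A - B) (smul c x) = smul c (blinfun_apply (A - B) x)"
    and "\<And>c x y. smul c (x + y) = smul c x + smul c y"
  shows "essential_norm smul A = essential_norm smul B"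
proof -
  define L where "L = {S. compact_operator S \<and> (\<forall>c x. blinfun_apply S (smul c x) = smul c (blinfun_apply S x))}"
  have scale_diff: "smul c (x - y) = smul c x - smul c y" for c x y
    using assms(3)[of c "x - y" y] by simp
  have "(\<lambda>S. norm (A - S)) ` L = (\<lambda>S. norm (B - S)) ` L"
  proof safe
    fix S assume "S \<in> L"
    then have "S - (A - B) \<in> L"
      using assms(1,2) unfolding L_def
      by (simp add: compact_operator_diff blinfun.diff_left[of S] scale_diff)
    then show "norm (A - S) \<in> (\<lambda>S. norm (B - S)) ` L"
      by (rule rev_image_eqI) simp
  next
    fix S assume "S \<in> L"
    then have "S + (A - B) \<in> L"
      using assms unfolding L_def
      by (simp add: compact_operator_add blinfun.add_left[of S])
    then show "norm (B - S) \<in> (\<lambda>S. norm (A - S)) ` L"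
      by (rule rev_image_eqI) simp
  qed
  then show ?thesis
    unfolding essential_norm_def L_def by simp
qed


section \<open>The space $C_0(K)$\<close>

definition vanishes_at_infinity :: "('k::topological_space \<Rightarrow> 's::real_normed_vector) \<Rightarrow> bool"
  where "vanishes_at_infinity f \<longleftrightarrow> (\<forall>e>0. \<exists>C. compact C \<and> (\<forall>x. x \<notin> C \<longrightarrow> norm (f x) < e))"

lemma vanishes_at_infinity_0: "vanishes_at_infinity (\<lambda>_. 0)"
  by (auto simp: vanishes_at_infinity_def)

lemma vanishes_at_infinity_uminus:
  "vanishes_at_infinity f \<Longrightarrow> vanishes_at_infinity (\<lambda>x. - f x)"
  by (simp add: vanishes_at_infinity_def)

lemma vanishes_at_infinity_add:
  assumes "vanishes_at_infinity f" "vanishes_at_infinity g"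
  shows "vanishes_at_infinity (\<lambda>x. f x + g x)"
  unfolding vanishes_at_infinity_def
proof (intro allI impI)
  fix e :: real assume e: "e > 0"
  from assms(1) e obtain C where C: "compact C" "\<forall>x. x \<notin> C \<longrightarrow> norm (f x) < e/2"
    unfolding vanishes_at_infinity_def by (meson half_gt_zero)
  from assms(2) e obtain D where D: "compact D" "\<forall>x. x \<notin> D \<longrightarrow> norm (g x) < e/2"
    unfolding vanishes_at_infinity_def by (meson half_gt_zero)
  have "norm (f x + g x) < e" if "x \<notin> C \<union> D" for x
  proof -
    have "norm (f x + g x) \<le> norm (f x) + norm (g x)" by (rule norm_triangle_ineq)
    also have "\<dots> < e/2 + e/2" using C(2) D(2) that by (intro add_strict_mono) auto
    finally show ?thesis by simp
  qed
  then show "\<exists>C. compact C \<and> (\<forall>x. x \<notin> C \<longrightarrow> norm (f x + g x) < e)"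
    using compact_Un[OF C(1) D(1)] by blast
qed

lemma vanishes_at_infinity_diff:
  "vanishes_at_infinity f \<Longrightarrow> vanishes_at_infinity g \<Longrightarrow> vanishes_at_infinity (\<lambda>x. f x - g x)"
  using vanishes_at_infinity_add[OF _ vanishes_at_infinity_uminus, of f g] by simp

lemma vanishes_at_infinity_bound:
  assumes "vanishes_at_infinity f" and le: "\<And>x. norm (g x) \<le> r * norm (f x)" and "r \<ge> 0"
  shows "vanishes_at_infinity g"
  unfolding vanishes_at_infinity_def
proof (intro allI impI)
  fix e :: real assume e: "e > 0"
  have "e / (r + 1) > 0" using e \<open>r \<ge> 0\<close> by simp
  then obtain C where C: "compact C" "\<forall>x. x \<notin> C \<longrightarrow> norm (f x) < e / (r + 1)"
    using assms(1) unfolding vanishes_at_infinity_def by blast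
  have "norm (g x) < e" if "x \<notin> C" for x
  proof -
    have "norm (g x) \<le> (r + 1) * norm (f x)"
      using le[of x] norm_ge_zero[of "f x"] unfolding distrib_right by linarith
    also have "\<dots> < e" using C(2) that \<open>r \<ge> 0\<close> by (simp add: field_simps)
    finally show ?thesis .
  qed
  with C(1) show "\<exists>C. compact C \<and> (\<forall>x. x \<notin> C \<longrightarrow> norm (g x) < e)" by blast
qed

typedef (overloaded) ('k, 's) c0 =
    "{f :: 'k::topological_space \<Rightarrow>\<^sub>C 's::real_normed_vector. vanishes_at_infinity f}"
  morphisms bcontfun_of_c0 Abs_c0
  by (intro exI[of _ 0]) (simp add: vanishes_at_infinity_0)

setup_lifting type_definition_c0

instantiation c0 :: (topological_space, real_normed_vector) real_normed_vector
begin

lift_definition zero_c0 :: "('a, 'b) c0" is 0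
  by (simp add: vanishes_at_infinity_0)

lift_definition plus_c0 :: "('a, 'b) c0 \<Rightarrow> ('a, 'b) c0 \<Rightarrow> ('a, 'b) c0" is "(+)"
  by (simp add: vanishes_at_infinity_add)

lift_definition uminus_c0 :: "('a, 'b) c0 \<Rightarrow> ('a, 'b) c0" is uminus
  by (simp add: vanishes_at_infinity_uminus)

lift_definition minus_c0 :: "('a, 'b) c0 \<Rightarrow> ('a, 'b) c0 \<Rightarrow> ('a, 'b) c0" is "(-)"
  by (simp add: vanishes_at_infinity_diff)

lift_definition scaleR_c0 :: "real \<Rightarrow> ('a, 'b) c0 \<Rightarrow> ('a, 'b) c0" is scaleR
proof -
  fix r :: real and f :: "'a \<Rightarrow>\<^sub>C 'b"
  assume "vanishes_at_infinity f"
  then show "vanishes_at_infinity (r *\<^sub>R f)"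
    by (rule vanishes_at_infinity_bound[where r = "\<bar>r\<bar>"]) simp_all
qed

lift_definition norm_c0 :: "('a, 'b) c0 \<Rightarrow> real" is norm .

definition dist_c0 :: "('a, 'b) c0 \<Rightarrow> ('a, 'b) c0 \<Rightarrow> real"
  where "dist_c0 f g = norm (f - g)"

definition sgn_c0 :: "('a, 'b) c0 \<Rightarrow> ('a, 'b) c0"
  where "sgn_c0 f = scaleR (inverse (norm f)) f"

definition uniformity_c0 :: "(('a, 'b) c0 \<times> ('a, 'b) c0) filter"
  where "uniformity_c0 = (INF e\<in>{0 <..}. principal {(x, y). dist x y < e})"

definition open_c0 :: "('a, 'b) c0 set \<Rightarrow> bool"
  where "open_c0 S = (\<forall>x\<in>S. \<forall>\<^sub>F (x', y) in uniformity. x' = x \<longrightarrow> y \<in> S)"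

instance
proof
  fix f g h :: "('a, 'b) c0" and r s :: real
  show "f + g + h = f + (g + h)" by transfer (rule add.assoc)
  show "f + g = g + f" by transfer (rule add.commute)
  show "0 + f = f" by transfer (rule add_0_left)
  show "- f + f = 0" by transfer (rule left_minus)
  show "f - g = f + - g" by transfer (rule diff_conv_add_uminus)
  show "r *\<^sub>R (f + g) = r *\<^sub>R f + r *\<^sub>R g" by transfer (rule scaleR_add_right)
  show "(r + s) *\<^sub>R f = r *\<^sub>R f + s *\<^sub>R f" by transfer (rule scaleR_add_left)
  show "r *\<^sub>R s *\<^sub>R f = (r * s) *\<^sub>R f" by transfer (rule scaleR_scaleR)
  show "1 *\<^sub>R f = f" by transfer (rule scaleR_one)
  show "norm f = 0 \<longleftrightarrow> f = 0" by transfer (rule norm_eq_zero)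
  show "norm (f + g) \<le> norm f + norm g" by transfer (rule norm_triangle_ineq)
  show "norm (r *\<^sub>R f) = \<bar>r\<bar> * norm f" by transfer (rule norm_scaleR)
qed (rule dist_c0_def sgn_c0_def uniformity_c0_def open_c0_def)+

end

abbreviation c0_apply :: "('k::topological_space, 's::real_normed_vector) c0 \<Rightarrow> 'k \<Rightarrow> 's"
  where "c0_apply f \<equiv> apply_bcontfun (bcontfun_of_c0 f)"

instance c0 :: (topological_space, banach) banach
proof
  fix X :: "nat \<Rightarrow> ('a, 'b) c0"
  assume X: "Cauchy X"
  have d: "dist (X m) (X n) = dist (bcontfun_of_c0 (X m)) (bcontfun_of_c0 (X n))" for m n
    by (simp add: dist_norm norm_c0.rep_eq minus_c0.rep_eq)
  have "\<exists>N. \<forall>m n x. N \<le> m \<and> N \<le> n \<and> True \<longrightarrow> dist (c0_apply (X m) x) (c0_apply (X n) x) < e"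
    if e: "e > 0" for e
  proof -
    obtain N where "\<forall>m\<ge>N. \<forall>n\<ge>N. dist (bcontfun_of_c0 (X m)) (bcontfun_of_c0 (X n)) < e"
      using X e unfolding Cauchy_def d by meson
    then show ?thesis by (intro exI[of _ N]) (auto intro: dist_fun_lt_imp_dist_val_lt)
  qed
  then obtain g where "uniform_limit UNIV (\<lambda>n. c0_apply (X n)) g sequentially"
    using uniformly_convergent_eq_cauchy[of "\<lambda>_. True" "\<lambda>n. c0_apply (X n)"]
    unfolding uniform_limit_sequentially_iff by auto
  then obtain l where l: "(\<lambda>n. bcontfun_of_c0 (X n)) \<longlonglongrightarrow> l"
    by (rule uniform_limit_bcontfunE) auto
  have "vanishes_at_infinity l"
    unfolding vanishes_at_infinity_def
  proof (intro allI impI)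
    fix e :: real assume e: "e > 0"
    then have "\<forall>\<^sub>F n in sequentially. dist (bcontfun_of_c0 (X n)) l < e/2"
      using tendstoD[OF l, of "e/2"] by simp
    then obtain n where n: "dist (bcontfun_of_c0 (X n)) l < e/2"
      by (meson eventually_happens' sequentially_bot)
    obtain C where C: "compact C" "\<forall>x. x \<notin> C \<longrightarrow> norm (c0_apply (X n) x) < e/2"
      using bcontfun_of_c0[of "X n"] e unfolding vanishes_at_infinity_def mem_Collect_eq
      by (meson half_gt_zero)
    have "norm (l x) < e" if "x \<notin> C" for x
    proof -
      have "norm (l x) \<le> norm (c0_apply (X n) x) + dist (c0_apply (X n) x) (l x)"
        using norm_triangle_sub[of "l x" "c0_apply (X n) x"] by (simp add: dist_norm norm_minus_commute)
      also have "\<dots> < e/2 + e/2"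
        using C(2) that dist_fun_lt_imp_dist_val_lt[OF n, of x] by (intro add_strict_mono) auto
      finally show ?thesis by simp
    qed
    with C(1) show "\<exists>C. compact C \<and> (\<forall>x. x \<notin> C \<longrightarrow> norm (l x) < e)" by blast
  qed
  then have "bcontfun_of_c0 (Abs_c0 l) = l" by (intro Abs_c0_inverse) simp
  then have "X \<longlonglongrightarrow> Abs_c0 l"
    using l by (simp add: tendsto_iff dist_norm norm_c0.rep_eq minus_c0.rep_eq)
  then show "convergent X" by (rule convergentI)
qed

lemma scale_bcontfun:
  fixes f :: "'k::topological_space \<Rightarrow>\<^sub>C 's::real_normed_field"
  shows "(\<lambda>x. c * f x) \<in> bcontfun"
proof (rule bcontfun_normI)
  show "continuous_on UNIV (\<lambda>x. c * f x)" by (intro continuous_intros) auto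
  show "norm (c * f x) \<le> norm c * norm f" for x
    by (simp add: norm_mult mult_left_mono norm_bounded)
qed

lift_definition c0_scale :: "'s::real_normed_field \<Rightarrow> ('k::topological_space, 's) c0 \<Rightarrow> ('k, 's) c0"
  is "\<lambda>c f. Bcontfun (\<lambda>x. c * apply_bcontfun f x)"
proof -
  fix c :: 's and f :: "'k \<Rightarrow>\<^sub>C 's"
  assume "vanishes_at_infinity f"
  then show "vanishes_at_infinity (Bcontfun (\<lambda>x. c * f x))"
    by (rule vanishes_at_infinity_bound[where r = "norm c"])
       (simp_all add: Bcontfun_inverse scale_bcontfun norm_mult)
qed

lemma c0_apply_scale: "c0_apply (c0_scale c f) x = c * c0_apply f x"
  by (simp add: c0_scale.rep_eq Bcontfun_inverse scale_bcontfun)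

lemma c0_eqI: "(\<And>x. c0_apply f x = c0_apply g x) \<Longrightarrow> f = g"
  by (metis bcontfun_eqI bcontfun_of_c0_inject)

lemma c0_scale_add: "c0_scale c (f + g) = c0_scale c f + c0_scale c g"
  by (rule c0_eqI) (simp add: c0_apply_scale plus_c0.rep_eq algebra_simps)

lemma c0_scale_minus: "c0_scale c (- f) = - c0_scale c f"
  by (rule c0_eqI) (simp add: c0_apply_scale uminus_c0.rep_eq)

lemma c0_scale_0: "c0_scale c 0 = 0"
  by (rule c0_eqI) (simp add: c0_apply_scale zero_c0.rep_eq)

lemma c0_scale_scaleR: "c0_scale c (r *\<^sub>R f) = r *\<^sub>R c0_scale c f"
  by (rule c0_eqI) (simp add: c0_apply_scale scaleR_c0.rep_eq)

lemma c0_scale_scale: "c0_scale c (c0_scale d f) = c0_scale (c * d) f"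
  by (rule c0_eqI) (simp add: c0_apply_scale)

lemma norm_c0_scale_le: "norm (c0_scale c f) \<le> norm c * norm f"
  unfolding norm_c0.rep_eq
  by (rule norm_bound)
     (simp add: c0_apply_scale norm_mult mult_left_mono norm_bounded)

lemma bounded_linear_c0_scale: "bounded_linear (c0_scale c)"
  by (rule bounded_linear_intro[where K = "norm c"])
     (auto simp: c0_scale_add c0_scale_scaleR norm_c0_scale_le mult.commute)


section \<open>The dual space $C_0(K)^*$\<close>

typedef (overloaded) ('k, 's) c0_dual =
    "{\<phi> :: ('k::topological_space, 's::real_normed_field) c0 \<Rightarrow>\<^sub>L 's.
        \<forall>c f. \<phi> (c0_scale c f) = c * \<phi> f}"
  morphisms blinfun_of_c0_dual Abs_c0_dual
  by (intro exI[of _ 0]) auto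

setup_lifting type_definition_c0_dual

instantiation c0_dual :: (topological_space, real_normed_field) real_normed_vector
begin

lift_definition zero_c0_dual :: "('a, 'b) c0_dual" is 0
  by auto

lift_definition plus_c0_dual :: "('a, 'b) c0_dual \<Rightarrow> ('a, 'b) c0_dual \<Rightarrow> ('a, 'b) c0_dual" is "(+)"
  by (auto simp: blinfun.add_left algebra_simps)

lift_definition uminus_c0_dual :: "('a, 'b) c0_dual \<Rightarrow> ('a, 'b) c0_dual" is uminus
  by (auto simp: blinfun.minus_left)

lift_definition minus_c0_dual :: "('a, 'b) c0_dual \<Rightarrow> ('a, 'b) c0_dual \<Rightarrow> ('a, 'b) c0_dual" is "(-)"
  by (auto simp: blinfun.diff_left algebra_simps)

lift_definition scaleR_c0_dual :: "real \<Rightarrow> ('a, 'b) c0_dual \<Rightarrow> ('a, 'b) c0_dual" is scaleR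
  by (auto simp: blinfun.scaleR_left)

lift_definition norm_c0_dual :: "('a, 'b) c0_dual \<Rightarrow> real" is norm .

definition dist_c0_dual :: "('a, 'b) c0_dual \<Rightarrow> ('a, 'b) c0_dual \<Rightarrow> real"
  where "dist_c0_dual f g = norm (f - g)"

definition sgn_c0_dual :: "('a, 'b) c0_dual \<Rightarrow> ('a, 'b) c0_dual"
  where "sgn_c0_dual f = scaleR (inverse (norm f)) f"

definition uniformity_c0_dual :: "(('a, 'b) c0_dual \<times> ('a, 'b) c0_dual) filter"
  where "uniformity_c0_dual = (INF e\<in>{0 <..}. principal {(x, y). dist x y < e})"

definition open_c0_dual :: "('a, 'b) c0_dual set \<Rightarrow> bool"
  where "open_c0_dual S = (\<forall>x\<in>S. \<forall>\<^sub>F (x', y) in uniformity. x' = x \<longrightarrow> y \<in> S)"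

instance
proof
  fix f g h :: "('a, 'b) c0_dual" and r s :: real
  show "f + g + h = f + (g + h)" by transfer (rule add.assoc)
  show "f + g = g + f" by transfer (rule add.commute)
  show "0 + f = f" by transfer (rule add_0_left)
  show "- f + f = 0" by transfer (rule left_minus)
  show "f - g = f + - g" by transfer (rule diff_conv_add_uminus)
  show "r *\<^sub>R (f + g) = r *\<^sub>R f + r *\<^sub>R g" by transfer (rule scaleR_add_right)
  show "(r + s) *\<^sub>R f = r *\<^sub>R f + s *\<^sub>R f" by transfer (rule scaleR_add_left)
  show "r *\<^sub>R s *\<^sub>R f = (r * s) *\<^sub>R f" by transfer (rule scaleR_scaleR)
  show "1 *\<^sub>R f = f" by transfer (rule scaleR_one)
  show "norm f = 0 \<longleftrightarrow> f = 0" by transfer (rule norm_eq_zero)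
  show "norm (f + g) \<le> norm f + norm g" by transfer (rule norm_triangle_ineq)
  show "norm (r *\<^sub>R f) = \<bar>r\<bar> * norm f" by transfer (rule norm_scaleR)
qed (rule dist_c0_dual_def sgn_c0_dual_def uniformity_c0_dual_def open_c0_dual_def)+

end

abbreviation c0_dual_apply ::
    "('k::topological_space, 's::real_normed_field) c0_dual \<Rightarrow> ('k, 's) c0 \<Rightarrow> 's"
  where "c0_dual_apply \<phi> \<equiv> blinfun_apply (blinfun_of_c0_dual \<phi>)"

instance c0_dual :: (topological_space, "{real_normed_field, banach}") banach
proof
  fix X :: "nat \<Rightarrow> ('a, 'b) c0_dual"
  assume "Cauchy X"
  then have "Cauchy (\<lambda>n. blinfun_of_c0_dual (X n))"
    unfolding Cauchy_def dist_norm norm_c0_dual.rep_eq minus_c0_dual.rep_eq .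
  then obtain l where l: "(\<lambda>n. blinfun_of_c0_dual (X n)) \<longlonglongrightarrow> l"
    by (auto simp: Cauchy_convergent_iff convergent_def)
  have "blinfun_apply l (c0_scale c f) = c * blinfun_apply l f" for c f
  proof (rule LIMSEQ_unique)
    show "(\<lambda>n. c0_dual_apply (X n) (c0_scale c f)) \<longlonglongrightarrow> blinfun_apply l (c0_scale c f)"
      by (intro tendsto_intros l)
    have "(\<lambda>n. c * c0_dual_apply (X n) f) \<longlonglongrightarrow> c * blinfun_apply l f"
      by (intro tendsto_intros l)
    moreover have "c0_dual_apply (X n) (c0_scale c f) = c * c0_dual_apply (X n) f" for n
      using blinfun_of_c0_dual[of "X n"] by simp
    ultimately show "(\<lambda>n. c0_dual_apply (X n) (c0_scale c f)) \<longlonglongrightarrow> c * blinfun_apply l f"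
      by simp
  qed
  then have "blinfun_of_c0_dual (Abs_c0_dual l) = l" by (intro Abs_c0_dual_inverse) simp
  then have "X \<longlonglongrightarrow> Abs_c0_dual l"
    using l by (simp add: tendsto_iff dist_norm norm_c0_dual.rep_eq minus_c0_dual.rep_eq)
  then show "convergent X" by (rule convergentI)
qed

lift_definition c0_dual_scale ::
    "'s::real_normed_field \<Rightarrow> ('k::topological_space, 's) c0_dual \<Rightarrow> ('k, 's) c0_dual"
  is "\<lambda>c \<phi>. blinfun_mult_right c o\<^sub>L \<phi>"
  by (simp add: mult.left_commute)

lemma c0_dual_apply_scale: "c0_dual_apply (c0_dual_scale c \<phi>) f = c * c0_dual_apply \<phi> f"
  by (simp add: c0_dual_scale.rep_eq)

lemma c0_dual_eqI: "(\<And>f. c0_dual_apply \<phi> f = c0_dual_apply \<psi> f) \<Longrightarrow> \<phi> = \<psi>"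
  by (metis blinfun_eqI blinfun_of_c0_dual_inject)

lemma c0_dual_scale_add: "c0_dual_scale c (\<phi> + \<psi>) = c0_dual_scale c \<phi> + c0_dual_scale c \<psi>"
  by (rule c0_dual_eqI)
     (simp add: c0_dual_apply_scale plus_c0_dual.rep_eq blinfun.add_left algebra_simps)


section \<open>The algebra of bounded operators on $C_0(K)$\<close>

typedef (overloaded) ('k, 's) c0_op =
    "{T :: ('k::topological_space, 's::real_normed_field) c0 \<Rightarrow>\<^sub>L ('k, 's) c0.
        \<forall>c f. T (c0_scale c f) = c0_scale c (T f)}"
  morphisms blinfun_of_c0_op Abs_c0_op
  by (intro exI[of _ 0]) (auto simp: c0_scale_0)

setup_lifting type_definition_c0_op

instantiation c0_op :: (topological_space, real_normed_field) real_normed_algebra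
begin

lift_definition zero_c0_op :: "('a, 'b) c0_op" is 0
  by (auto simp: c0_scale_0)

lift_definition plus_c0_op :: "('a, 'b) c0_op \<Rightarrow> ('a, 'b) c0_op \<Rightarrow> ('a, 'b) c0_op" is "(+)"
  by (auto simp: blinfun.add_left c0_scale_add)

lift_definition uminus_c0_op :: "('a, 'b) c0_op \<Rightarrow> ('a, 'b) c0_op" is uminus
  by (auto simp: blinfun.minus_left c0_scale_minus)

lift_definition minus_c0_op :: "('a, 'b) c0_op \<Rightarrow> ('a, 'b) c0_op \<Rightarrow> ('a, 'b) c0_op" is "(-)"
  by (simp add: blinfun.diff_left)
     (metis c0_scale_add c0_scale_minus diff_conv_add_uminus)

lift_definition scaleR_c0_op :: "real \<Rightarrow> ('a, 'b) c0_op \<Rightarrow> ('a, 'b) c0_op" is scaleR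
  by (auto simp: blinfun.scaleR_left c0_scale_scaleR)

lift_definition times_c0_op :: "('a, 'b) c0_op \<Rightarrow> ('a, 'b) c0_op \<Rightarrow> ('a, 'b) c0_op" is "(o\<^sub>L)"
  by auto

lift_definition norm_c0_op :: "('a, 'b) c0_op \<Rightarrow> real" is norm .

definition dist_c0_op :: "('a, 'b) c0_op \<Rightarrow> ('a, 'b) c0_op \<Rightarrow> real"
  where "dist_c0_op f g = norm (f - g)"

definition sgn_c0_op :: "('a, 'b) c0_op \<Rightarrow> ('a, 'b) c0_op"
  where "sgn_c0_op f = scaleR (inverse (norm f)) f"

definition uniformity_c0_op :: "(('a, 'b) c0_op \<times> ('a, 'b) c0_op) filter"
  where "uniformity_c0_op = (INF e\<in>{0 <..}. principal {(x, y). dist x y < e})"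

definition open_c0_op :: "('a, 'b) c0_op set \<Rightarrow> bool"
  where "open_c0_op S = (\<forall>x\<in>S. \<forall>\<^sub>F (x', y) in uniformity. x' = x \<longrightarrow> y \<in> S)"

instance
proof
  fix f g h :: "('a, 'b) c0_op" and r s :: real
  show "f + g + h = f + (g + h)" by transfer (rule add.assoc)
  show "f + g = g + f" by transfer (rule add.commute)
  show "0 + f = f" by transfer (rule add_0_left)
  show "- f + f = 0" by transfer (rule left_minus)
  show "f - g = f + - g" by transfer (rule diff_conv_add_uminus)
  show "r *\<^sub>R (f + g) = r *\<^sub>R f + r *\<^sub>R g" by transfer (rule scaleR_add_right)
  show "(r + s) *\<^sub>R f = r *\<^sub>R f + s *\<^sub>R f" by transfer (rule scaleR_add_left)
  show "r *\<^sub>R s *\<^sub>R f = (r * s) *\<^sub>R f" by transfer (rule scaleR_scaleR)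
  show "1 *\<^sub>R f = f" by transfer (rule scaleR_one)
  show "norm f = 0 \<longleftrightarrow> f = 0" by transfer (rule norm_eq_zero)
  show "norm (f + g) \<le> norm f + norm g" by transfer (rule norm_triangle_ineq)
  show "norm (r *\<^sub>R f) = \<bar>r\<bar> * norm f" by transfer (rule norm_scaleR)
  show "f * g * h = f * (g * h)" by transfer (rule blinfun_eqI, simp)
  show "(f + g) * h = f * h + g * h"
    by transfer (rule blinfun_eqI, simp add: blinfun.add_left)
  show "f * (g + h) = f * g + f * h"
    by transfer (rule blinfun_eqI, simp add: blinfun.add_left blinfun.add_right)
  show "r *\<^sub>R f * g = r *\<^sub>R (f * g)"
    by transfer (rule blinfun_eqI, simp add: blinfun.scaleR_left)
  show "f * r *\<^sub>R g = r *\<^sub>R (f * g)"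
    by transfer (rule blinfun_eqI, simp add: blinfun.scaleR_left blinfun.scaleR_right)
  show "norm (f * g) \<le> norm f * norm g" by transfer (rule norm_blinfun_compose)
qed (rule dist_c0_op_def sgn_c0_op_def uniformity_c0_op_def open_c0_op_def)+

end

abbreviation c0_op_apply ::
    "('k::topological_space, 's::real_normed_field) c0_op \<Rightarrow> ('k, 's) c0 \<Rightarrow> ('k, 's) c0"
  where "c0_op_apply T \<equiv> blinfun_apply (blinfun_of_c0_op T)"

lift_definition c0_op_scale ::
    "'s::real_normed_field \<Rightarrow> ('k::topological_space, 's) c0_op \<Rightarrow> ('k, 's) c0_op"
  is "\<lambda>c T. Blinfun (c0_scale c) o\<^sub>L T"
  by (simp add: bounded_linear_Blinfun_apply bounded_linear_c0_scale c0_scale_scale mult.commute)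

lift_definition c0_op_compact :: "('k::topological_space, 's::real_normed_field) c0_op \<Rightarrow> bool"
  is compact_operator .


section \<open>The adjoint, and its compactness (Schauder)\<close>

lemma adjoint_bounded_linear:
  fixes T :: "('k::topological_space, 's::real_normed_field) c0_op"
  shows "bounded_linear (\<lambda>\<phi>. Abs_c0_dual (blinfun_of_c0_dual \<phi> o\<^sub>L blinfun_of_c0_op T))"
    (is "bounded_linear ?A")
proof -
  have rep: "blinfun_of_c0_dual (?A \<phi>) = blinfun_of_c0_dual \<phi> o\<^sub>L blinfun_of_c0_op T" for \<phi>
    using blinfun_of_c0_dual[of \<phi>] blinfun_of_c0_op[of T]
    by (intro Abs_c0_dual_inverse) simp
  show ?thesis
  proof (rule bounded_linear_intro[where K = "norm T"])
    show "?A (\<phi> + \<psi>) = ?A \<phi> + ?A \<psi>" for \<phi> \<psi>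
      by (rule c0_dual_eqI, simp add: rep, simp add: plus_c0_dual.rep_eq rep blinfun.add_left)
    show "?A (r *\<^sub>R \<phi>) = r *\<^sub>R ?A \<phi>" for r \<phi>
      by (rule c0_dual_eqI, simp add: rep, simp add: scaleR_c0_dual.rep_eq rep blinfun.scaleR_left)
    show "norm (?A \<phi>) \<le> norm \<phi> * norm T" for \<phi>
      by (simp add: norm_c0_dual.rep_eq norm_c0_op.rep_eq rep norm_blinfun_compose)
  qed
qed

definition c0_adjoint ::
    "('k::topological_space, 's::real_normed_field) c0_op \<Rightarrow> ('k, 's) c0_dual \<Rightarrow>\<^sub>L ('k, 's) c0_dual"
  where "c0_adjoint T =
    Blinfun (\<lambda>\<phi>. Abs_c0_dual (blinfun_of_c0_dual \<phi> o\<^sub>L blinfun_of_c0_op T))"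

lemma c0_adjoint_apply: "c0_dual_apply (c0_adjoint T \<phi>) f = c0_dual_apply \<phi> (c0_op_apply T f)"
proof -
  have "c0_adjoint T \<phi> = Abs_c0_dual (blinfun_of_c0_dual \<phi> o\<^sub>L blinfun_of_c0_op T)"
    by (simp add: c0_adjoint_def bounded_linear_Blinfun_apply adjoint_bounded_linear)
  moreover have "blinfun_of_c0_dual (Abs_c0_dual (blinfun_of_c0_dual \<phi> o\<^sub>L blinfun_of_c0_op T)) =
      blinfun_of_c0_dual \<phi> o\<^sub>L blinfun_of_c0_op T"
    using blinfun_of_c0_dual[of \<phi>] blinfun_of_c0_op[of T]
    by (intro Abs_c0_dual_inverse) simp
  ultimately show ?thesis by simp
qed

lemma c0_adjoint_scale: "c0_adjoint T (c0_dual_scale c \<phi>) = c0_dual_scale c (c0_adjoint T \<phi>)"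
  by (rule c0_dual_eqI) (simp add: c0_adjoint_apply c0_dual_apply_scale)

lemma c0_adjoint_diff: "c0_adjoint (S - T) = c0_adjoint S - c0_adjoint T"
  by (intro blinfun_eqI c0_dual_eqI)
     (simp add: c0_adjoint_apply minus_c0_op.rep_eq minus_c0_dual.rep_eq blinfun.diff_left
        blinfun.diff_right)

lemma finite_net_functions:
  fixes P :: "('a \<Rightarrow> 'b::heine_borel) set"
  assumes "finite K" "e > 0" and B: "bounded B" and P: "\<And>p y. p \<in> P \<Longrightarrow> y \<in> K \<Longrightarrow> p y \<in> B"
  shows "\<exists>Q\<subseteq>P. finite Q \<and> (\<forall>p\<in>P. \<exists>q\<in>Q. \<forall>y\<in>K. dist (p y) (q y) < e)"
proof -
  have "compact (closure B)" using B by (simp add: compact_eq_bounded_closed bounded_closure)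
  then obtain F where F: "finite F" "closure B \<subseteq> (\<Union>x\<in>F. ball x (e/2))"
    using \<open>e > 0\<close> unfolding compact_eq_totally_bounded by (meson half_gt_zero)
  have ex: "\<exists>b\<in>F. dist b (p y) < e/2" if "p \<in> P" "y \<in> K" for p y
    using F(2) P[OF that] closure_subset[of B] by fastforce
  define h where "h p = restrict (\<lambda>y. SOME b. b \<in> F \<and> dist b (p y) < e/2) K" for p
  have h: "h p y \<in> F \<and> dist (h p y) (p y) < e/2" if "p \<in> P" "y \<in> K" for p y
    using someI_ex[OF ex[OF that, unfolded Bex_def]] that by (simp add: h_def)
  have "h ` P \<subseteq> PiE K (\<lambda>_. F)"
    using h by (auto simp: h_def)
  then have fin: "finite (h ` P)"
    using F(1) \<open>finite K\<close> by (meson finite_PiE finite_subset)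
  define Q where "Q = inv_into P h ` (h ` P)"
  have "\<exists>q\<in>Q. \<forall>y\<in>K. dist (p y) (q y) < e" if p: "p \<in> P" for p
  proof (intro bexI ballI)
    let ?q = "inv_into P h (h p)"
    show "?q \<in> Q" unfolding Q_def using p by blast
    have q: "?q \<in> P" "h ?q = h p"
      using p inv_into_into[of "h p" h P] f_inv_into_f[of "h p" h P] by blast+
    fix y assume y: "y \<in> K"
    have "dist (p y) (?q y) \<le> dist (h p y) (p y) + dist (h p y) (?q y)"
      by (rule dist_triangle3)
    also have "\<dots> < e/2 + e/2"
      using h[OF p y] h[OF q(1) y] q(2) by (intro add_strict_mono) auto
    finally show "dist (p y) (?q y) < e" by simp
  qed
  moreover have "Q \<subseteq> P" unfolding Q_def by (auto intro: inv_into_into)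
  moreover have "finite Q" unfolding Q_def using fin by simp
  ultimately show ?thesis by blast
qed

lemma compact_closure_if_totally_bounded:
  fixes S :: "'a::complete_space set"
  assumes "\<And>e. e > 0 \<Longrightarrow> \<exists>F. finite F \<and> S \<subseteq> (\<Union>x\<in>F. cball x e)"
  shows "compact (closure S)"
  unfolding compact_eq_totally_bounded
proof (intro conjI allI impI)
  show "complete (closure S)" by (simp add: complete_eq_closed)
  fix e :: real assume e: "e > 0"
  then obtain F where F: "finite F" "S \<subseteq> (\<Union>x\<in>F. cball x (e/2))"
    using assms[of "e/2"] by auto
  have "closure S \<subseteq> (\<Union>x\<in>F. cball x (e/2))"
    using F by (intro closure_minimal closed_UN) auto
  also have "\<dots> \<subseteq> (\<Union>x\<in>F. ball x e)"
    using e by force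
  finally show "\<exists>F. finite F \<and> closure S \<subseteq> (\<Union>x\<in>F. ball x e)"
    using F(1) by blast
qed

lemma norm_blinfun_bound_unit:
  assumes b: "b \<ge> 0" "\<And>x. norm x \<le> 1 \<Longrightarrow> norm (blinfun_apply f x) \<le> b"
  shows "norm f \<le> b"
proof (rule norm_blinfun_bound[OF b(1)])
  fix x
  show "norm (blinfun_apply f x) \<le> b * norm x"
  proof (cases "x = 0")
    case False
    have "norm (blinfun_apply f (x /\<^sub>R norm x)) \<le> b"
      using False by (intro b(2)) simp
    then show ?thesis using False by (simp add: blinfun.scaleR_right field_simps)
  qed simp
qed

theorem c0_adjoint_compact:
  fixes T :: "('k::topological_space, 's::{real_normed_field, banach, heine_borel}) c0_op"
  assumes "c0_op_compact T"
  shows "compact_operator (c0_adjoint T)"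
  unfolding compact_operator_def
proof (rule compact_closure_if_totally_bounded)
  fix e :: real assume e: "e > 0"
  define C where "C = closure (c0_op_apply T ` cball 0 1)"
  have C: "compact C"
    using assms unfolding C_def c0_op_compact.rep_eq compact_operator_def .
  obtain K where K: "finite K" "C \<subseteq> (\<Union>y\<in>K. ball y (e/3))"
    using C e unfolding compact_eq_totally_bounded by (meson zero_less_divide_iff zero_less_numeral)
  define B :: "('k, 's) c0_dual set" where "B = cball 0 1"
  have op_le: "norm (c0_dual_apply \<phi> y) \<le> norm y" if "\<phi> \<in> B" for \<phi> y
  proof -
    have "norm (c0_dual_apply \<phi> y) \<le> norm \<phi> * norm y"
      by (simp add: norm_c0_dual.rep_eq norm_blinfun)
    also have "\<dots> \<le> 1 * norm y" using that by (intro mult_right_mono) (auto simp: B_def)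
    finally show ?thesis by simp
  qed
  have "\<exists>Q\<subseteq>c0_dual_apply ` B. finite Q \<and>
      (\<forall>p\<in>c0_dual_apply ` B. \<exists>q\<in>Q. \<forall>y\<in>K. dist (p y) (q y) < e/3)"
  proof (rule finite_net_functions[OF K(1)])
    show "bounded (\<Union>y\<in>K. cball (0::'s) (norm y))" using K(1) by auto
    show "p y \<in> (\<Union>y\<in>K. cball 0 (norm y))" if "p \<in> c0_dual_apply ` B" "y \<in> K" for p y
      using that op_le by auto
  qed (use e in auto)
  then obtain Q' where Q': "Q' \<subseteq> c0_dual_apply ` B" "finite Q'"
      "\<forall>\<phi>\<in>B. \<exists>q\<in>Q'. \<forall>y\<in>K. dist (c0_dual_apply \<phi> y) (q y) < e/3"
    by blast
  obtain Q where "Q \<subseteq> B" "finite Q" "Q' = c0_dual_apply ` Q"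
    using finite_subset_image[OF Q'(2,1)] by blast
  with Q'(3) have Q: "Q \<subseteq> B" "finite Q"
      "\<forall>\<phi>\<in>B. \<exists>\<psi>\<in>Q. \<forall>y\<in>K. dist (c0_dual_apply \<phi> y) (c0_dual_apply \<psi> y) < e/3"
    by auto
  have "dist (c0_adjoint T \<psi>) (c0_adjoint T \<phi>) \<le> e"
    if \<phi>: "\<phi> \<in> B" and \<psi>: "\<psi> \<in> B"
      and d: "\<forall>y\<in>K. dist (c0_dual_apply \<phi> y) (c0_dual_apply \<psi> y) < e/3" for \<phi> \<psi>
    unfolding dist_norm norm_c0_dual.rep_eq
  proof (rule norm_blinfun_bound_unit)
    fix f :: "('k, 's) c0" assume f: "norm f \<le> 1"
    define z where "z = c0_op_apply T f"
    have "z \<in> C" unfolding C_def z_def using f by (intro closure_subset[THEN subsetD]) auto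
    then obtain y where y: "y \<in> K" "dist y z < e/3" using K(2) by auto
    have "c0_dual_apply (c0_adjoint T \<psi> - c0_adjoint T \<phi>) f =
        c0_dual_apply \<psi> (z - y) + (c0_dual_apply \<psi> y - c0_dual_apply \<phi> y) + c0_dual_apply \<phi> (y - z)"
      by (simp add: minus_c0_dual.rep_eq blinfun.diff_left blinfun.diff_right c0_adjoint_apply z_def)
    also have "norm \<dots> \<le> norm (z - y) + dist (c0_dual_apply \<phi> y) (c0_dual_apply \<psi> y) + norm (y - z)"
      by (intro norm_triangle_mono op_le \<phi> \<psi>) (simp add: dist_norm norm_minus_commute)
    also have "\<dots> \<le> e/3 + e/3 + e/3"
      using y d by (intro add_mono) (auto simp: dist_norm norm_minus_commute less_imp_le)
    finally show "norm (c0_dual_apply (c0_adjoint T \<psi> - c0_adjoint T \<phi>) f) \<le> e" by simp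
  qed (use e in simp)
  then have "c0_adjoint T ` B \<subseteq> (\<Union>x\<in>c0_adjoint T ` Q. cball x e)"
    using Q(1,3) by fastforce
  then show "\<exists>F. finite F \<and> c0_adjoint T ` cball 0 1 \<subseteq> (\<Union>x\<in>F. cball x e)"
    using Q(2) unfolding B_def by blast
qed


section \<open>The Calkin algebra and the dual essential norm\<close>

lemma c0_op_compact_eq_diff: "S = T \<Longrightarrow> c0_op_compact (S - T)"
  by (simp add: c0_op_compact.rep_eq zero_c0_op.rep_eq)

lemma c0_op_compact_add: "c0_op_compact S \<Longrightarrow> c0_op_compact T \<Longrightarrow> c0_op_compact (S + T)"
  by transfer (rule compact_operator_add)

lemma c0_op_compact_minus: "c0_op_compact S \<Longrightarrow> c0_op_compact (- S)"
  by transfer (rule compact_operator_uminus)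

lemma c0_op_compact_times_left: "c0_op_compact T \<Longrightarrow> c0_op_compact (S * T)"
  by transfer (rule compact_operator_compose_left)

lemma c0_op_compact_times_right: "c0_op_compact T \<Longrightarrow> c0_op_compact (T * S)"
  by transfer (rule compact_operator_compose_right)

lemma c0_op_compact_scale: "c0_op_compact T \<Longrightarrow> c0_op_compact (c0_op_scale c T)"
  by transfer (rule compact_operator_compose_left)

text \<open>
  \<open>calkin_of T\<close> is the coset of \<open>T\<close> modulo the compact operators. The quotient is only declared a
  \<open>ring\<close>, as it is the zero algebra when \<open>K\<close> is finite.
\<close>

quotient_type (overloaded) ('k, 's) calkin =
    "('k::topological_space, 's::real_normed_field) c0_op" /
    "\<lambda>S T. c0_op_compact (S - T)"
  morphisms rep_calkin calkin_of
proof (rule equivpI)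
  show "reflp (\<lambda>S T :: ('k, 's) c0_op. c0_op_compact (S - T))"
    by (rule reflpI) (simp add: c0_op_compact.rep_eq zero_c0_op.rep_eq)
  show "symp (\<lambda>S T :: ('k, 's) c0_op. c0_op_compact (S - T))"
  proof (rule sympI)
    fix S T :: "('k, 's) c0_op" assume "c0_op_compact (S - T)"
    then show "c0_op_compact (T - S)"
      using c0_op_compact_minus[of "S - T"] by simp
  qed
  show "transp (\<lambda>S T :: ('k, 's) c0_op. c0_op_compact (S - T))"
  proof (rule transpI)
    fix R S T :: "('k, 's) c0_op" assume "c0_op_compact (R - S)" "c0_op_compact (S - T)"
    then show "c0_op_compact (R - T)"
      using c0_op_compact_add[of "R - S" "S - T"] by simp
  qed
qed

lemma c0_op_scale_diff: "c0_op_scale c (S - T) = c0_op_scale c S - c0_op_scale c T"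
proof -
  have "blinfun_of_c0_op (c0_op_scale c (S - T)) = blinfun_of_c0_op (c0_op_scale c S - c0_op_scale c T)"
    unfolding c0_op_scale.rep_eq minus_c0_op.rep_eq
    by (rule blinfun_eqI)
       (simp only: blinfun_apply_blinfun_compose blinfun.diff_left blinfun.diff_right)
  then show ?thesis by (simp only: blinfun_of_c0_op_inject)
qed

instantiation calkin :: (topological_space, real_normed_field) ring
begin

lift_definition zero_calkin :: "('a, 'b) calkin" is 0 .

lift_definition plus_calkin :: "('a, 'b) calkin \<Rightarrow> ('a, 'b) calkin \<Rightarrow> ('a, 'b) calkin" is "(+)"
  by (subst add_diff_add) (rule c0_op_compact_add)

lift_definition uminus_calkin :: "('a, 'b) calkin \<Rightarrow> ('a, 'b) calkin" is uminus
  by (subst minus_diff_minus) (rule c0_op_compact_minus)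

lift_definition minus_calkin :: "('a, 'b) calkin \<Rightarrow> ('a, 'b) calkin \<Rightarrow> ('a, 'b) calkin" is "(-)"
proof -
  fix S S' T T' :: "('a, 'b) c0_op"
  assume "c0_op_compact (S - S')" "c0_op_compact (T - T')"
  then have "c0_op_compact ((S - S') + - (T - T'))"
    by (intro c0_op_compact_add c0_op_compact_minus)
  then show "c0_op_compact (S - T - (S' - T'))" by (simp add: algebra_simps)
qed

lift_definition times_calkin :: "('a, 'b) calkin \<Rightarrow> ('a, 'b) calkin \<Rightarrow> ('a, 'b) calkin" is "(*)"
proof -
  fix S S' T T' :: "('a, 'b) c0_op"
  assume "c0_op_compact (S - S')" "c0_op_compact (T - T')"
  then have "c0_op_compact ((S - S') * T + S' * (T - T'))"
    by (intro c0_op_compact_add c0_op_compact_times_left c0_op_compact_times_right)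
  then show "c0_op_compact (S * T - S' * T')" by (simp add: algebra_simps)
qed

instance
proof
  fix a b c :: "('a, 'b) calkin"
  show "a + b + c = a + (b + c)" by transfer (rule c0_op_compact_eq_diff, rule add.assoc)
  show "a + b = b + a" by transfer (rule c0_op_compact_eq_diff, rule add.commute)
  show "0 + a = a" by transfer (rule c0_op_compact_eq_diff, rule add_0_left)
  show "- a + a = 0" by transfer (rule c0_op_compact_eq_diff, rule left_minus)
  show "a - b = a + - b" by transfer (rule c0_op_compact_eq_diff, rule diff_conv_add_uminus)
  show "a * b * c = a * (b * c)" by transfer (rule c0_op_compact_eq_diff, rule mult.assoc)
  show "(a + b) * c = a * c + b * c" by transfer (rule c0_op_compact_eq_diff, rule distrib_right)
  show "a * (b + c) = a * b + a * c" by transfer (rule c0_op_compact_eq_diff, rule distrib_left)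
qed

end

lift_definition calkin_scale ::
    "'s::real_normed_field \<Rightarrow> ('k::topological_space, 's) calkin \<Rightarrow> ('k, 's) calkin"
  is c0_op_scale
  by (subst c0_op_scale_diff[symmetric]) (rule c0_op_compact_scale)

text \<open>
  The class constraint \<open>heine_borel\<close> on the scalars is what Schauder's theorem needs, and thus
  what makes the following well defined on cosets.
\<close>

lift_definition dual_essential_norm ::
    "('k::topological_space, 's::{real_normed_field, banach, heine_borel}) calkin \<Rightarrow> real"
  is "\<lambda>T. essential_norm c0_dual_scale (c0_adjoint T)"
proof (rule essential_norm_cong)
  fix S T :: "('k, 's) c0_op"
  assume "c0_op_compact (S - T)"
  then show "compact_operator (c0_adjoint S - c0_adjoint T)"
    using c0_adjoint_compact[of "S - T"] by (simp add: c0_adjoint_diff)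
  show "(c0_adjoint S - c0_adjoint T) (c0_dual_scale c \<phi>) =
      c0_dual_scale c ((c0_adjoint S - c0_adjoint T) \<phi>)" for c \<phi>
    by (metis c0_adjoint_diff c0_adjoint_scale)
qed (rule c0_dual_scale_add)

lemma dual_essential_norm_calkin_of:
  "dual_essential_norm (calkin_of T) = essential_norm c0_dual_scale (c0_adjoint T)"
  by (rule dual_essential_norm.abs_eq)

end

theory Submission
  imports Defs
begin

text \<open>
  Write \<open>ess\<close> for the essential norm on the dual. By a theorem of Rudin, every functional on \<open>C\<^sub>0(K)\<close>
  is a sum of atoms, \<open>\<phi> f = (\<Sum>y. a y * f y)\<close> with \<open>(\<Sum>y. norm (a y)) \<le> norm \<phi>\<close>, since \<open>K\<close> is
  scattered (\<open>has_sum_atom\<close>). So an operator \<open>T\<close> is a matrix whose rows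
  \<open>T\<^sup>* \<delta>\<^sub>x\<close> are absolutely summable functions on \<open>K\<close>. Subtracting the finitely many columns over a finite
  set \<open>F\<close> changes \<open>T\<^sup>*\<close> by a finite-rank operator; hence \<open>ess T\<^sup>* \<le> b\<close> as soon as
  \<open>norm (T f) \<le> b * norm f\<close> for the \<open>f\<close> that vanish on \<open>F\<close> (\<open>ess_adjoint_le_if_vanishing\<close>).

  Let \<open>M\<close> be an algebra norm below the dual essential norm and let \<open>c < ess T\<^sup>*\<close>. Outside every finite set some
  row of \<open>T\<close> has mass greater than \<open>c\<close>. This gives points \<open>x\<^sub>n\<close> whose rows have mass at least \<open>c\<close>, up to a
  small error, on pairwise disjoint finite sets. Passing to a subsequence, \<open>x\<^sub>n\<close> converges to a point \<open>l\<close> or leaves all compact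
  sets. The rows minus their limit then tend to \<open>0\<close> weak-*, and a gliding hump argument provides disjointly
  supported functions \<open>g\<^sub>n\<close> of norm at most \<open>1\<close> that are almost biorthogonal to a subsequence: the matrix of
  the numbers \<open>(T g\<^sub>n)(x\<^sub>m) - (T g\<^sub>n)(l)\<close>, or \<open>(T g\<^sub>n)(x\<^sub>m)\<close>, is close to \<open>c\<close> times the
  identity (\<open>ex_gliding_hump\<close>, \<open>ex_biorthogonal\<close>).

  An infinite scattered space has isolated points \<open>z\<^sub>n\<close> that converge or escape likewise, say to \<open>l'\<close>. The operators
  \<open>A h = (\<Sum>n. (h(x\<^sub>n) - h(l)) 1\<^bsub>{z\<^sub>n}\<^esub>)\<close>, \<open>B h = (\<Sum>n. (h(z\<^sub>n) - h(l')) g\<^sub>n)\<close> and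
  \<open>P h = (\<Sum>n. (h(z\<^sub>n) - h(l')) 1\<^bsub>{z\<^sub>n}\<^esub>)\<close>, where \<open>h(l)\<close> or \<open>h(l')\<close> is dropped
  in the escaping case, may have norm \<open>2\<close>, but their adjoints have essential norm at most \<open>1\<close>, because the
  correction terms only involve the single column over \<open>l\<close> or \<open>l'\<close>. Moreover \<open>P\<close> is a non-compact projection, so
  \<open>M P \<ge> 1\<close>, and \<open>A T B\<close> is close to \<open>c P\<close> in norm. So \<open>M T \<ge> M A * M T * M B \<ge> M (A T B)\<close> is at
  least \<open>c\<close> up to an arbitrarily small error (\<open>lower_bound_from_biorthogonal\<close>). Thus \<open>M T \<ge> ess T\<^sup>*\<close>.
  The scalars enter only as a complete normed field in which bounded closed sets are compact.
\<close>

section \<open>The dual essential norm is an algebra norm\<close>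

lemma c0_dual_scale_scaleR: "c0_dual_scale c (r *\<^sub>R \<phi>) = r *\<^sub>R c0_dual_scale c \<phi>"
  by (rule c0_dual_eqI) (simp add: c0_dual_apply_scale scaleR_c0_dual.rep_eq blinfun.scaleR_left)

lemma c0_dual_scale_diff: "c0_dual_scale c (\<phi> - \<psi>) = c0_dual_scale c \<phi> - c0_dual_scale c \<psi>"
  using c0_dual_scale_add[of c "\<phi> - \<psi>" \<psi>] by (simp add: algebra_simps)

lemma c0_dual_scale_scale: "c0_dual_scale c (c0_dual_scale d \<phi>) = c0_dual_scale (c * d) \<phi>"
  by (rule c0_dual_eqI) (simp add: c0_dual_apply_scale)

lemma c0_dual_scale_one [simp]: "c0_dual_scale 1 \<phi> = \<phi>"
  by (rule c0_dual_eqI) (simp add: c0_dual_apply_scale)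

lemma norm_c0_dual_scale_le: "norm (c0_dual_scale c \<phi>) \<le> norm c * norm \<phi>"
  unfolding norm_c0_dual.rep_eq
proof (rule norm_blinfun_bound)
  fix f
  show "norm (c0_dual_apply (c0_dual_scale c \<phi>) f) \<le> norm c * norm (blinfun_of_c0_dual \<phi>) * norm f"
    using mult_left_mono[OF norm_blinfun[of "blinfun_of_c0_dual \<phi>" f], of "norm c"]
    by (simp add: c0_dual_apply_scale norm_mult mult.assoc)
qed simp

text \<open>
  Scalar multiplication by \<open>c\<close> as a bounded operator on the dual.
\<close>

definition dual_scaling ::
    "'s::real_normed_field \<Rightarrow> ('k::topological_space, 's) c0_dual \<Rightarrow>\<^sub>L ('k, 's) c0_dual"
  where "dual_scaling c = Blinfun (c0_dual_scale c)"

lemma bounded_linear_c0_dual_scale: "bounded_linear (c0_dual_scale c)"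
  by (rule bounded_linear_intro[where K = "norm c"])
     (auto simp: c0_dual_scale_add c0_dual_scale_scaleR norm_c0_dual_scale_le mult.commute)

lemma dual_scaling_apply [simp]: "dual_scaling c \<phi> = c0_dual_scale c \<phi>"
  by (simp add: dual_scaling_def bounded_linear_Blinfun_apply bounded_linear_c0_dual_scale)

lemma norm_dual_scaling_le: "norm (dual_scaling c) \<le> norm c"
  by (rule norm_blinfun_bound) (auto simp: norm_c0_dual_scale_le)

lemma c0_adjoint_add: "c0_adjoint (S + T) = c0_adjoint S + c0_adjoint T"
  by (intro blinfun_eqI c0_dual_eqI)
     (simp add: c0_adjoint_apply plus_c0_op.rep_eq plus_c0_dual.rep_eq blinfun.add_left
        blinfun.add_right)

lemma c0_adjoint_0 [simp]: "c0_adjoint 0 = 0"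
  using c0_adjoint_diff[of 0 0] by simp

lemma c0_adjoint_times: "c0_adjoint (S * T) = c0_adjoint T o\<^sub>L c0_adjoint S"
  by (intro blinfun_eqI c0_dual_eqI) (simp add: c0_adjoint_apply times_c0_op.rep_eq)

lemma c0_dual_apply_c0_scale: "c0_dual_apply \<phi> (c0_scale c f) = c * c0_dual_apply \<phi> f"
  using blinfun_of_c0_dual[of \<phi>] by simp

lemma c0_op_apply_c0_scale: "c0_op_apply T (c0_scale c f) = c0_scale c (c0_op_apply T f)"
  using blinfun_of_c0_op[of T] by simp

lemma c0_op_apply_scale: "c0_op_apply (c0_op_scale c T) f = c0_scale c (c0_op_apply T f)"
  by (simp add: c0_op_scale.rep_eq bounded_linear_Blinfun_apply bounded_linear_c0_scale)

lemma c0_adjoint_op_scale: "c0_adjoint (c0_op_scale c T) = dual_scaling c o\<^sub>L c0_adjoint T"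
  by (intro blinfun_eqI c0_dual_eqI)
     (simp add: c0_adjoint_apply c0_op_apply_scale c0_dual_apply_c0_scale c0_dual_apply_scale)

lemma norm_c0_adjoint_le: "norm (c0_adjoint T) \<le> norm T"
proof (rule norm_blinfun_bound)
  fix \<phi>
  have "blinfun_of_c0_dual (c0_adjoint T \<phi>) = blinfun_of_c0_dual \<phi> o\<^sub>L blinfun_of_c0_op T"
    by (intro blinfun_eqI) (simp add: c0_adjoint_apply)
  then show "norm (c0_adjoint T \<phi>) \<le> norm T * norm \<phi>"
    using norm_blinfun_compose[of "blinfun_of_c0_dual \<phi>" "blinfun_of_c0_op T"]
    by (simp add: norm_c0_dual.rep_eq norm_c0_op.rep_eq mult.commute)
qed simp

text \<open>
  The compact operators on the dual that are linear over the scalar field, over which \<open>essential_norm\<close> takes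
  the infimum.
\<close>

definition compact_dual_ops ::
    "(('k::topological_space, 's::real_normed_field) c0_dual \<Rightarrow>\<^sub>L ('k, 's) c0_dual) set"
  where "compact_dual_ops =
    {S. compact_operator S \<and> (\<forall>c \<phi>. S (c0_dual_scale c \<phi>) = c0_dual_scale c (S \<phi>))}"

text \<open>
  The essential norm of an operator on the dual.
\<close>

abbreviation ess :: "(('k::topological_space, 's::real_normed_field) c0_dual \<Rightarrow>\<^sub>L ('k, 's) c0_dual) \<Rightarrow> real"
  where "ess \<equiv> essential_norm c0_dual_scale"

lemma ess_eq: "ess X = (INF S\<in>compact_dual_ops. norm (X - S))"
  by (simp add: essential_norm_def compact_dual_ops_def)

lemma zero_compact_dual_ops: "0 \<in> compact_dual_ops"
  by (simp add: compact_dual_ops_def) (metis c0_dual_scale_diff diff_self)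

lemma bdd_ess: "bdd_below ((\<lambda>S. norm (X - S)) ` compact_dual_ops)"
  by (rule bdd_belowI2[of _ 0]) simp

lemma ess_le: "S \<in> compact_dual_ops \<Longrightarrow> norm (X - S) \<le> b \<Longrightarrow> ess X \<le> b"
  unfolding ess_eq by (rule cINF_lower2[OF bdd_ess])

lemma ess_lessE:
  assumes "ess X < b"
  obtains S where "S \<in> compact_dual_ops" "norm (X - S) < b"
  using assms zero_compact_dual_ops unfolding ess_eq
  by (subst (asm) cINF_less_iff[OF _ bdd_ess]) auto

lemma ess_le_norm: "ess X \<le> norm X"
  using ess_le[OF zero_compact_dual_ops] by fastforce

lemma ess_nonneg: "0 \<le> ess X"
  unfolding ess_eq using zero_compact_dual_ops by (intro cINF_greatest) auto

lemma ess_add: "ess (X + Y) \<le> ess X + ess Y"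
proof (rule field_le_epsilon)
  fix e :: real assume e: "e > 0"
  obtain S where S: "S \<in> compact_dual_ops" "norm (X - S) < ess X + e/2"
    using ess_lessE[of X "ess X + e/2"] e by auto
  obtain T where T: "T \<in> compact_dual_ops" "norm (Y - T) < ess Y + e/2"
    using ess_lessE[of Y "ess Y + e/2"] e by auto
  have "S + T \<in> compact_dual_ops"
    using S T by (auto simp: compact_dual_ops_def compact_operator_add blinfun.add_left c0_dual_scale_add)
  moreover have "norm (X + Y - (S + T)) \<le> ess X + ess Y + e"
    using norm_triangle_ineq[of "X - S" "Y - T"] S T by (simp add: algebra_simps)
  ultimately show "ess (X + Y) \<le> ess X + ess Y + e" by (rule ess_le)
qed

lemma ess_compose:
  assumes X: "\<And>c \<phi>. blinfun_apply X (c0_dual_scale c \<phi>) = c0_dual_scale c (blinfun_apply X \<phi>)"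
    and Y: "\<And>c \<phi>. blinfun_apply Y (c0_dual_scale c \<phi>) = c0_dual_scale c (blinfun_apply Y \<phi>)"
  shows "ess (X o\<^sub>L Y) \<le> ess X * ess Y"
proof -
  have *: "ess (X o\<^sub>L Y) \<le> (ess X + e) * (ess Y + e)" if e: "e > 0" for e
  proof -
    obtain S where S: "S \<in> compact_dual_ops" "norm (X - S) < ess X + e"
      using ess_lessE[of X "ess X + e"] e by auto
    obtain T where T: "T \<in> compact_dual_ops" "norm (Y - T) < ess Y + e"
      using ess_lessE[of Y "ess Y + e"] e by auto
    define R where "R = (S o\<^sub>L (Y - T)) + (X o\<^sub>L T)"
    have "compact_operator R"
      using S T unfolding R_def compact_dual_ops_def
      by (intro compact_operator_add compact_operator_compose_left[of T]
          compact_operator_compose_right[of S]) auto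
    then have "R \<in> compact_dual_ops"
      using S(1) T(1) X Y
      by (simp add: R_def compact_dual_ops_def blinfun.add_left blinfun.diff_left
          c0_dual_scale_add c0_dual_scale_diff flip: c0_dual_scale_diff)
    moreover have "(X o\<^sub>L Y) - R = (X - S) o\<^sub>L (Y - T)"
      by (rule blinfun_eqI)
         (simp add: R_def blinfun.add_left blinfun.diff_left blinfun.diff_right algebra_simps)
    then have "norm ((X o\<^sub>L Y) - R) \<le> (ess X + e) * (ess Y + e)"
      using norm_blinfun_compose[of "X - S" "Y - T"] S(2) T(2)
        mult_mono[of "norm (X - S)" "ess X + e" "norm (Y - T)" "ess Y + e"] ess_nonneg[of X] e
      by simp
    ultimately show ?thesis by (rule ess_le)
  qed
  have "((\<lambda>e. (ess X + e) * (ess Y + e)) \<longlongrightarrow> (ess X + 0) * (ess Y + 0)) (at_right 0)"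
    by (intro tendsto_intros)
  moreover have "eventually (\<lambda>e. ess (X o\<^sub>L Y) \<le> (ess X + e) * (ess Y + e)) (at_right 0)"
    using * by (simp add: eventually_at_right_less eventually_mono[OF eventually_at_right_less])
  ultimately show ?thesis
    by (intro tendsto_lowerbound[where F = "at_right (0::real)"]) auto
qed

lemma ess_scaling_le:
  fixes X :: "('k::topological_space, 's::real_normed_field) c0_dual \<Rightarrow>\<^sub>L ('k, 's) c0_dual"
  shows "ess (dual_scaling c o\<^sub>L X) \<le> norm c * ess X"
proof (rule field_le_epsilon)
  fix e :: real assume e: "e > 0"
  define d where "d = e / (norm c + 1)"
  have pos: "norm c + 1 > 0" using norm_ge_zero[of c] by linarith
  then have d0: "d > 0" using e by (simp add: d_def)
  have "norm c * d \<le> (norm c + 1) * d" using d0 by simp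
  also have "\<dots> = e" using pos by (simp add: d_def)
  finally have d: "d > 0" "norm c * d \<le> e" using d0 by auto
  obtain S where S: "S \<in> compact_dual_ops" "norm (X - S) < ess X + d"
    using ess_lessE[of X "ess X + d"] d by auto
  have "dual_scaling c o\<^sub>L S \<in> compact_dual_ops"
    using S(1) by (auto simp: compact_dual_ops_def compact_operator_compose_left c0_dual_scale_scale mult.commute)
  moreover have "norm ((dual_scaling c o\<^sub>L X) - (dual_scaling c o\<^sub>L S)) \<le> norm c * ess X + e"
  proof -
    have "(dual_scaling c o\<^sub>L X) - (dual_scaling c o\<^sub>L S) = dual_scaling c o\<^sub>L (X - S)"
      by (rule blinfun_eqI) (simp add: blinfun.diff_left c0_dual_scale_diff)
    then have "norm ((dual_scaling c o\<^sub>L X) - (dual_scaling c o\<^sub>L S)) \<le> norm (dual_scaling c :: ('k, 's) c0_dual \<Rightarrow>\<^sub>L _) * norm (X - S)"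
      by (simp add: norm_blinfun_compose)
    also have "\<dots> \<le> norm c * (ess X + d)"
      using S(2) by (intro mult_mono norm_dual_scaling_le) auto
    finally show ?thesis using d(2) by (simp add: algebra_simps)
  qed
  ultimately show "ess (dual_scaling c o\<^sub>L X) \<le> norm c * ess X + e" by (rule ess_le)
qed

lemma ess_scaling: "ess (dual_scaling c o\<^sub>L X) = norm c * ess X"
proof (cases "c = 0")
  case True
  then show ?thesis using ess_scaling_le[of c X] ess_nonneg[of "dual_scaling c o\<^sub>L X"] by simp
next
  case False
  have "dual_scaling (inverse c) o\<^sub>L (dual_scaling c o\<^sub>L X) = X"
    using False by (intro blinfun_eqI) (simp add: c0_dual_scale_scale)
  then have "ess X \<le> norm (inverse c) * ess (dual_scaling c o\<^sub>L X)"
    using ess_scaling_le[of "inverse c" "dual_scaling c o\<^sub>L X"] by simp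
  from mult_left_mono[OF this, of "norm c"]
  have "norm c * ess X \<le> (norm c * norm (inverse c)) * ess (dual_scaling c o\<^sub>L X)"
    by (simp only: mult.assoc norm_ge_zero)
  then have "norm c * ess X \<le> ess (dual_scaling c o\<^sub>L X)"
    using False by (simp flip: norm_mult)
  then show ?thesis using ess_scaling_le[of c X] by simp
qed

lemma norm_c0_apply_le: "norm (c0_apply f x) \<le> norm f"
  by (simp add: norm_c0.rep_eq norm_bounded)

lemma norm_c0_le: "(\<And>x. norm (c0_apply f x) \<le> b) \<Longrightarrow> norm f \<le> b"
  by (simp add: norm_c0.rep_eq norm_bound)

lemma norm_c0_dual_apply_le: "norm (c0_dual_apply \<phi> f) \<le> norm \<phi> * norm f"
  by (simp add: norm_c0_dual.rep_eq norm_blinfun)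

lemma norm_c0_dual_leI:
  assumes "b \<ge> 0" "\<And>f. norm (c0_dual_apply \<phi> f) \<le> b * norm f" shows "norm \<phi> \<le> b"
  unfolding norm_c0_dual.rep_eq by (rule norm_blinfun_bound) (use assms in auto)

text \<open>
  The point evaluation \<open>f \<mapsto> f x\<close>, an element of the dual.
\<close>

definition c0_delta :: "'k::topological_space \<Rightarrow> ('k, 's::real_normed_field) c0_dual"
  where "c0_delta x = Abs_c0_dual (Blinfun (\<lambda>f. c0_apply f x))"

lemma c0_delta_apply [simp]:
  fixes f :: "('k::topological_space, 's::real_normed_field) c0"
  shows "c0_dual_apply (c0_delta x) f = c0_apply f x"
proof -
  have "bounded_linear (\<lambda>f :: ('k, 's) c0. c0_apply f x)"
    by (rule bounded_linear_intro[where K = 1])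
       (auto simp: plus_c0.rep_eq scaleR_c0.rep_eq norm_c0_apply_le)
  then show ?thesis
    unfolding c0_delta_def
    by (subst Abs_c0_dual_inverse) (auto simp: bounded_linear_Blinfun_apply c0_apply_scale)
qed

lemma norm_c0_delta_le: "norm (c0_delta x) \<le> 1"
  by (rule norm_c0_dual_leI) (auto simp: norm_c0_apply_le)

text \<open>
  The converse direction of Schauder's theorem, in the form needed here. Since point evaluations are norming on
  \<open>C\<^sub>0(K)\<close>, it suffices that the functionals \<open>T\<^sup>* \<delta>\<^sub>x\<close> are totally bounded, which they are if \<open>T\<^sup>*\<close> is
  approximated by compact operators.
\<close>

lemma compact_if_ess_adjoint_0:
  fixes T :: "('k::topological_space, 's::{real_normed_field, banach, heine_borel}) c0_op"
  assumes "ess (c0_adjoint T) = 0"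
  shows "c0_op_compact T"
  unfolding c0_op_compact.rep_eq compact_operator_def
proof (rule compact_closure_if_totally_bounded)
  fix e :: real assume e: "e > 0"
  define d where "d = e / 9"
  have d: "d > 0" using e by (simp add: d_def)
  obtain S where S: "S \<in> compact_dual_ops" "norm (c0_adjoint T - S) < d"
    using ess_lessE[of "c0_adjoint T" d] d assms by auto
  have "compact (closure (S ` cball 0 1))"
    using S(1) by (simp add: compact_dual_ops_def compact_operator_def)
  then obtain N where N: "finite N" "closure (S ` cball 0 1) \<subseteq> (\<Union>\<psi>\<in>N. ball \<psi> d)"
    using d unfolding compact_eq_totally_bounded by blast
  have near: "\<exists>\<psi>\<in>N. norm (c0_adjoint T (c0_delta x) - \<psi>) \<le> 2 * d" for x
  proof -
    have "S (c0_delta x) \<in> closure (S ` cball 0 1)"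
      using closure_subset norm_c0_delta_le by (metis image_eqI mem_cball_0 subset_iff)
    then obtain \<psi> where \<psi>: "\<psi> \<in> N" "norm (\<psi> - S (c0_delta x)) < d"
      using N(2) by (auto simp: dist_norm)
    have "norm (c0_adjoint T (c0_delta x) - S (c0_delta x)) \<le> norm (c0_adjoint T - S) * norm (c0_delta x :: ('k,'s) c0_dual)"
      using norm_blinfun[of "c0_adjoint T - S" "c0_delta x"] by (simp add: blinfun.diff_left)
    also have "\<dots> \<le> d * 1"
      using S(2) d norm_c0_delta_le by (intro mult_mono) auto
    finally show ?thesis
      using \<psi> norm_triangle_ineq4[of "c0_adjoint T (c0_delta x) - S (c0_delta x)" "\<psi> - S (c0_delta x)"]
      by (intro bexI[of _ \<psi>]) (auto simp: algebra_simps)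
  qed
  define ev where "ev f = (\<lambda>\<psi>. c0_dual_apply \<psi> f)" for f :: "('k, 's) c0"
  have "\<exists>Q\<subseteq>ev ` cball 0 1. finite Q \<and> (\<forall>p\<in>ev ` cball 0 1. \<exists>q\<in>Q. \<forall>y\<in>N. dist (p y) (q y) < d)"
  proof (rule finite_net_functions[OF N(1) d])
    show "bounded (\<Union>\<psi>\<in>N. cball (0::'s) (norm \<psi>))" using N(1) by auto
    fix p \<psi> assume "p \<in> ev ` cball 0 1" and \<psi>: "\<psi> \<in> N"
    then obtain f where f: "p = ev f" "norm f \<le> 1" by auto
    have "norm (ev f \<psi>) \<le> norm \<psi>"
      using norm_c0_dual_apply_le[of \<psi> f] mult_left_mono[OF f(2), of "norm \<psi>"]
      by (simp add: ev_def)
    then show "p \<psi> \<in> (\<Union>\<psi>\<in>N. cball 0 (norm \<psi>))" using f \<psi> by auto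
  qed
  then obtain Q' where Q': "Q' \<subseteq> ev ` cball 0 1" "finite Q'"
    "\<forall>p\<in>ev ` cball 0 1. \<exists>q\<in>Q'. \<forall>y\<in>N. dist (p y) (q y) < d" by blast
  obtain Q where Q: "Q \<subseteq> cball 0 1" "finite Q" "Q' = ev ` Q"
    using finite_subset_image[OF Q'(2,1)] by blast
  have "c0_op_apply T ` cball 0 1 \<subseteq> (\<Union>g\<in>c0_op_apply T ` Q. cball g e)"
  proof
    fix h assume "h \<in> c0_op_apply T ` cball 0 1"
    then obtain f where f: "norm f \<le> 1" "h = c0_op_apply T f" by auto
    have "ev f \<in> ev ` cball 0 1" using f(1) by simp
    then obtain q where "q \<in> Q'" "\<forall>y\<in>N. dist (ev f y) (q y) < d"
      using Q'(3) by blast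
    then obtain g where g: "g \<in> Q" "\<forall>y\<in>N. dist (ev f y) (ev g y) < d"
      using Q(3) by blast
    have g1: "norm g \<le> 1" using g(1) Q(1) by auto
    have "norm (c0_apply (c0_op_apply T g - c0_op_apply T f) x) \<le> e" for x
    proof -
      obtain \<psi> where \<psi>: "\<psi> \<in> N" "norm (c0_adjoint T (c0_delta x) - \<psi>) \<le> 2 * d"
        using near by blast
      have "c0_apply (c0_op_apply T g - c0_op_apply T f) x
          = c0_dual_apply (c0_adjoint T (c0_delta x) - \<psi>) (g - f) + (ev g \<psi> - ev f \<psi>)"
        by (simp add: c0_adjoint_apply minus_c0_dual.rep_eq minus_c0.rep_eq blinfun.diff_left
            blinfun.diff_right ev_def)
      also have "norm \<dots> \<le> 2 * d * norm (g - f) + d"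
      proof (rule norm_triangle_mono)
        show "norm (c0_dual_apply (c0_adjoint T (c0_delta x) - \<psi>) (g - f)) \<le> 2 * d * norm (g - f)"
          by (rule order.trans[OF norm_c0_dual_apply_le mult_right_mono[OF \<psi>(2)]]) simp
        show "norm (ev g \<psi> - ev f \<psi>) \<le> d"
          using g(2) \<psi>(1) by (simp add: dist_norm norm_minus_commute less_imp_le)
      qed
      also have "\<dots> \<le> 2 * d * 2 + d"
        using norm_triangle_ineq4[of g f] f(1) g1 d by (intro add_mono mult_left_mono) auto
      also have "\<dots> \<le> e" using d e by (simp add: d_def)
      finally show ?thesis .
    qed
    then have "h \<in> cball (c0_op_apply T g) e"
      by (simp add: dist_norm f(2) norm_c0_le)
    then show "h \<in> (\<Union>g\<in>c0_op_apply T ` Q. cball g e)" using g(1) by blast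
  qed
  then show "\<exists>F. finite F \<and> c0_op_apply T ` cball 0 1 \<subseteq> (\<Union>x\<in>F. cball x e)"
    using Q(2) by blast
qed

lemma calkin_cases: obtains T where "a = calkin_of T"
  by (metis Quotient3_abs_rep Quotient3_calkin)

lemma calkin_of_eq_iff: "calkin_of S = calkin_of T \<longleftrightarrow> c0_op_compact (S - T)"
  by (rule calkin.abs_eq_iff)

lemma dual_essential_norm_algebra_norm:
  "algebra_norm calkin_scale
    (dual_essential_norm :: ('k::topological_space, 's::{real_normed_field, banach, heine_borel}) calkin \<Rightarrow> real)"
  unfolding algebra_norm_def
proof (intro conjI allI)
  fix a b :: "('k, 's) calkin" and c :: 's
  obtain S where a: "a = calkin_of S" by (rule calkin_cases)
  obtain T where b: "b = calkin_of T" by (rule calkin_cases)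
  show "0 \<le> dual_essential_norm a"
    by (simp add: a dual_essential_norm_calkin_of ess_nonneg)
  show "dual_essential_norm a = 0 \<longleftrightarrow> a = 0"
  proof
    assume "dual_essential_norm a = 0"
    then have "c0_op_compact (S - 0)"
      using compact_if_ess_adjoint_0[of S] by (simp add: a dual_essential_norm_calkin_of)
    then show "a = 0" unfolding a zero_calkin_def calkin_of_eq_iff .
  next
    assume "a = 0"
    then show "dual_essential_norm a = 0"
      using ess_le_norm[of "0 :: ('k, 's) c0_dual \<Rightarrow>\<^sub>L _"] ess_nonneg[of "0 :: ('k, 's) c0_dual \<Rightarrow>\<^sub>L _"]
      by (simp add: zero_calkin_def dual_essential_norm_calkin_of)
  qed
  show "dual_essential_norm (calkin_scale c a) = norm c * dual_essential_norm a"
    by (simp add: a calkin_scale.abs_eq dual_essential_norm_calkin_of c0_adjoint_op_scale ess_scaling)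
  show "dual_essential_norm (a + b) \<le> dual_essential_norm a + dual_essential_norm b"
    by (simp add: a b plus_calkin.abs_eq dual_essential_norm_calkin_of c0_adjoint_add ess_add)
  show "dual_essential_norm (a * b) \<le> dual_essential_norm a * dual_essential_norm b"
    using ess_compose[of "c0_adjoint T" "c0_adjoint S"]
    by (simp add: a b times_calkin.abs_eq dual_essential_norm_calkin_of c0_adjoint_times
        c0_adjoint_scale mult.commute)
qed

section \<open>Compact open sets in scattered locally compact spaces\<close>

text \<open>
  A scattered locally compact Hausdorff space, consisting of all points of a type; the parameter \<open>K\<close> only names
  this type.
\<close>

locale scattered_lc =
  fixes K :: "'k::t2_space itself"
  assumes lc: "locally_compact_space (euclidean :: 'k topology)"
    and sc: "scattered (UNIV :: 'k set)"
begin

lemma ex_isolated: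
  fixes A :: "'k set"
  assumes "A \<noteq> {}"
  obtains x U where "open U" "U \<inter> A = {x}"
proof -
  have "\<exists>x. x isolated_in A" using sc assms unfolding scattered_def by simp
  then show ?thesis using that unfolding isolated_in_def by blast
qed

lemma ex_compact_nhd:
  fixes x :: 'k
  assumes "open W" "x \<in> W"
  obtains U C where "open U" "compact C" "x \<in> U" "U \<subseteq> C" "C \<subseteq> W"
proof -
  have H: "Hausdorff_space (euclidean :: 'k topology)"
    unfolding Hausdorff_space_def by (metis disjnt_def hausdorff open_openin)
  have "neighbourhood_base_of (compactin euclidean) (euclidean :: 'k topology)"
    using lc H by (simp add: locally_compact_space_neighbourhood_base)
  then show ?thesis
    using assms that unfolding neighbourhood_base_of by (metis compactin_euclidean_iff open_openin)
qed

text \<open>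
  A scattered locally compact Hausdorff space has a base of compact open sets.
\<close>

theorem ex_compact_open:
  fixes x :: 'k
  assumes "open W" "x \<in> W"
  shows "\<exists>V. compact V \<and> open V \<and> x \<in> V \<and> V \<subseteq> W"
proof -
  define Z where "Z = {x :: 'k. \<forall>W. open W \<and> x \<in> W \<longrightarrow> (\<exists>V. compact V \<and> open V \<and> x \<in> V \<and> V \<subseteq> W)}"
  have "- Z = {}"
  proof (rule ccontr)
    assume "- Z \<noteq> {}"
    then obtain p D where D: "open D" "D \<inter> - Z = {p}" by (rule ex_isolated)
    have "\<exists>V. compact V \<and> open V \<and> p \<in> V \<and> V \<subseteq> W" if W: "open W" "p \<in> W" for W
    proof -
      obtain U C where UC: "open U" "compact C" "p \<in> U" "U \<subseteq> C" "C \<subseteq> W \<inter> D"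
        using ex_compact_nhd[of "W \<inter> D" p] W D by blast
      \<comment> \<open>The boundary of \<open>U\<close> is compact and consists of points that have small compact open
        neighbourhoods; removing finitely many of these from \<open>closure U\<close> leaves a clopen set.\<close>
      have cl: "closure U \<subseteq> C" using UC by (simp add: closure_minimal compact_imp_closed)
      have cC: "compact (closure U)"
        using compact_Int_closed[OF UC(2), of "closure U"] cl by (simp add: Int_absorb1)
      define B where "B = closure U - U"
      have cB: "compact B" unfolding B_def using cC UC(1) by (rule compact_diff)
      have "\<exists>V. compact V \<and> open V \<and> y \<in> V \<and> V \<subseteq> D - {p}" if "y \<in> B" for y
      proof -
        have "y \<in> D - {p}" using that cl UC by (auto simp: B_def)
        moreover then have "y \<in> Z" using D by blast
        moreover have "open (D - {p})" using D by (simp add: open_delete)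
        ultimately show ?thesis unfolding Z_def by blast
      qed
      then obtain V where V: "\<And>y. y \<in> B \<Longrightarrow> compact (V y) \<and> open (V y) \<and> y \<in> V y \<and> V y \<subseteq> D - {p}"
        by metis
      obtain F where F: "F \<subseteq> B" "finite F" "B \<subseteq> (\<Union>y\<in>F. V y)"
        using compactE_image[OF cB, of B V] V by blast
      define Q where "Q = (\<Union>y\<in>F. V y)"
      have Q: "compact Q" "open Q" "p \<notin> Q" "B \<subseteq> Q"
        using F V unfolding Q_def by (auto intro!: compact_UN)
      have "U - Q = closure U - Q" using Q(4) closure_subset by (auto simp: B_def)
      moreover have "compact (closure U - Q)" using cC Q(2) by (rule compact_diff)
      moreover have "open (U - Q)" using UC(1) Q(1) by (simp add: open_Diff compact_imp_closed)
      ultimately show ?thesis using UC Q by (intro exI[of _ "U - Q"]) auto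
    qed
    then have "p \<in> Z" unfolding Z_def by blast
    then show False using D by blast
  qed
  then have "x \<in> Z" by blast
  then show ?thesis using assms by (simp add: Z_def)
qed

lemma ex_compact_open_superset:
  fixes C :: "'k set"
  assumes "compact C"
  shows "\<exists>V. compact V \<and> open V \<and> C \<subseteq> V"
proof -
  have "\<exists>V. compact V \<and> open V \<and> y \<in> V" for y :: 'k
    using ex_compact_open[OF open_UNIV, of y] by auto
  then obtain V :: "'k \<Rightarrow> 'k set" where V: "\<And>y. compact (V y) \<and> open (V y) \<and> y \<in> V y"
    by metis
  obtain F where F: "F \<subseteq> C" "finite F" "C \<subseteq> (\<Union>y\<in>F. V y)"
  proof (rule compactE_image[OF assms])
    show "open (V y)" for y using V by blast
    show "C \<subseteq> (\<Union>y\<in>C. V y)" using V by blast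
  qed
  show ?thesis
    by (rule exI[of _ "\<Union>y\<in>F. V y"]) (use F V in \<open>auto intro!: compact_UN\<close>)
qed

lemma ex_disjoint_compact_open:
  fixes F :: "'k set"
  assumes "finite F" "\<And>y. y \<in> F \<Longrightarrow> open (U y) \<and> y \<in> U y"
  obtains W where "\<And>y. y \<in> F \<Longrightarrow> compact (W y) \<and> open (W y) \<and> y \<in> W y \<and> W y \<subseteq> U y"
    "\<And>y z. y \<in> F \<Longrightarrow> z \<in> F \<Longrightarrow> y \<noteq> z \<Longrightarrow> W y \<inter> W z = {}"
proof -
  have "\<exists>W. (\<forall>y\<in>F. compact (W y) \<and> open (W y) \<and> y \<in> W y \<and> W y \<subseteq> U y) \<and>
      (\<forall>y\<in>F. \<forall>z\<in>F. y \<noteq> z \<longrightarrow> W y \<inter> W z = {})"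
    using assms
  proof (induction F rule: finite_induct)
    case (insert p F)
    then obtain W where W: "\<forall>y\<in>F. compact (W y) \<and> open (W y) \<and> y \<in> W y \<and> W y \<subseteq> U y"
      "\<forall>y\<in>F. \<forall>z\<in>F. y \<noteq> z \<longrightarrow> W y \<inter> W z = {}" by (metis insertCI)
    have "open (U p - F)" using insert.prems insert.hyps(1) by (intro open_Diff finite_imp_closed) auto
    then obtain V where V: "compact V" "open V" "p \<in> V" "V \<subseteq> U p - F"
      using ex_compact_open[of "U p - F" p] insert.prems[of p] insert.hyps(2) by blast
    define W' where "W' = (\<lambda>y. if y = p then V else W y - V)"
    have "\<forall>y\<in>insert p F. compact (W' y) \<and> open (W' y) \<and> y \<in> W' y \<and> W' y \<subseteq> U y"
      using V W(1) insert.hyps(2) by (auto simp: W'_def intro!: compact_diff open_Diff compact_imp_closed)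
    moreover have "\<forall>y\<in>insert p F. \<forall>z\<in>insert p F. y \<noteq> z \<longrightarrow> W' y \<inter> W' z = {}"
      using W(2) unfolding W'_def by auto
    ultimately show ?case by blast
  qed simp
  then show ?thesis using that by metis
qed

text \<open>
  Scattered spaces are sequentially compact up to escape to infinity. Let \<open>L\<close> be the set of cluster points; if it
  is empty, the sequence leaves every compact set. Otherwise \<open>L\<close> has an isolated point \<open>p\<close>, and the terms in a
  compact open neighbourhood of \<open>p\<close> without other cluster points form a subsequence that converges to \<open>p\<close>.
\<close>

lemma subsequence_dichotomy:
  fixes x :: "nat \<Rightarrow> 'k"
  obtains r :: "nat \<Rightarrow> nat" and l where "strict_mono r" "(x \<circ> r) \<longlonglongrightarrow> l"
  | "\<And>C. compact C \<Longrightarrow> finite {n. x n \<in> C}"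
proof (cases "\<forall>C. compact C \<longrightarrow> finite {n. x n \<in> C}")
  case True
  then show ?thesis using that(2) by blast
next
  case False
  then obtain C where C: "compact C" "infinite {n. x n \<in> C}" by blast
  define L where "L = {p. \<forall>W. open W \<and> p \<in> W \<longrightarrow> infinite {n. x n \<in> W}}"
  have cover: "\<exists>p\<in>D. p \<in> L" if "compact D" "infinite {n. x n \<in> D}" for D
  proof (rule ccontr)
    assume "\<not> ?thesis"
    then have "\<exists>W. open W \<and> p \<in> W \<and> finite {n. x n \<in> W}" if "p \<in> D" for p
      using that unfolding L_def by blast
    then obtain W where W: "\<And>p. p \<in> D \<Longrightarrow> open (W p) \<and> p \<in> W p \<and> finite {n. x n \<in> W p}"
      by metis
    obtain F where F: "F \<subseteq> D" "finite F" "D \<subseteq> (\<Union>y\<in>F. W y)"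
      using compactE_image[OF \<open>compact D\<close>, of D W] W by blast
    have "{n. x n \<in> D} \<subseteq> (\<Union>y\<in>F. {n. x n \<in> W y})" using F by auto
    moreover have "finite (\<Union>y\<in>F. {n. x n \<in> W y})" using F W by auto
    ultimately show False using that(2) finite_subset by blast
  qed
  have "L \<noteq> {}" using cover[OF C] by blast
  then obtain p U where U: "open U" "U \<inter> L = {p}" by (rule ex_isolated)
  obtain V where V: "compact V" "open V" "p \<in> V" "V \<subseteq> U"
    using ex_compact_open[of U p] U by blast
  have inf: "infinite {n. x n \<in> V}" using U V unfolding L_def by blast
  have fin: "finite {n. x n \<in> V - W}" if W: "open W" "p \<in> W" for W
  proof (rule ccontr)
    assume "infinite {n. x n \<in> V - W}"
    then obtain q where "q \<in> V - W" "q \<in> L" using cover[OF compact_diff[OF V(1) W(1)]] by blast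
    then have "q \<in> U \<inter> L" using V(4) by blast
    then have "q = p" unfolding U(2) by simp
    then show False using \<open>q \<in> V - W\<close> W(2) by blast
  qed
  define r where "r = enumerate {n. x n \<in> V}"
  have r: "strict_mono r" "\<And>n. x (r n) \<in> V"
    using strict_mono_enumerate[OF inf] enumerate_in_set[OF inf] by (auto simp: r_def)
  have "(x \<circ> r) \<longlonglongrightarrow> p"
  proof (rule topological_tendstoI)
    fix W assume W: "open W" "p \<in> W"
    have "{n. (x \<circ> r) n \<notin> W} \<subseteq> r -` {n. x n \<in> V - W}" using r(2) by auto
    moreover have "finite (r -` {n. x n \<in> V - W})"
      using fin[OF W] r(1) by (intro finite_vimageI strict_mono_imp_inj_on)
    ultimately have "finite {n. (x \<circ> r) n \<notin> W}" by (rule finite_subset)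
    then show "\<forall>\<^sub>F n in sequentially. (x \<circ> r) n \<in> W"
      by (simp add: eventually_cofinite cofinite_eq_sequentially[symmetric])
  qed
  then show ?thesis using that(1) r(1) by blast
qed

text \<open>
  If there were only finitely many isolated points, the remaining points would form an open set, whose own
  isolated points are isolated in the whole space.
\<close>

lemma infinite_isolated_points:
  assumes "infinite (UNIV :: 'k set)"
  shows "infinite {z :: 'k. open {z}}"
proof
  assume fin: "finite {z :: 'k. open {z}}"
  then have "- {z :: 'k. open {z}} \<noteq> {}"
    using assms by (metis Compl_empty_eq double_compl finite_subset subset_UNIV)
  then obtain x U where U: "open U" "U \<inter> - {z :: 'k. open {z}} = {x}" by (rule ex_isolated)
  have "open (U - {z. open {z}})"
    using U(1) fin by (intro open_Diff finite_imp_closed)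
  moreover have "U - {z. open {z}} = {x}" using U(2) by blast
  ultimately show False using U(2) by auto
qed

end

section \<open>Cutting and gluing functions in $C_0(K)$\<close>

text \<open>
  The element of \<open>C\<^sub>0(K)\<close> with underlying function \<open>f\<close>; meaningful if \<open>f\<close> is continuous and vanishes at infinity.
\<close>

definition c0_of :: "('k::topological_space \<Rightarrow> 's::real_normed_vector) \<Rightarrow> ('k, 's) c0"
  where "c0_of f = Abs_c0 (Bcontfun f)"

lemma c0_apply_c0_of:
  assumes "continuous_on UNIV f" "vanishes_at_infinity f"
  shows "c0_apply (c0_of f) = f"
proof -
  obtain C where C: "compact C" "\<forall>x. x \<notin> C \<longrightarrow> norm (f x) < 1"
    using assms(2) zero_less_one unfolding vanishes_at_infinity_def by blast
  have "bounded (f ` C)"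
    using C(1) assms(1) by (intro compact_imp_bounded compact_continuous_image) (auto intro: continuous_on_subset)
  then obtain b where b: "\<And>x. x \<in> C \<Longrightarrow> norm (f x) \<le> b" by (auto simp: bounded_iff)
  have "f \<in> bcontfun"
  proof (rule bcontfun_normI[OF assms(1)])
    show "norm (f x) \<le> max b 1" for x
      using b[of x] C(2) by (cases "x \<in> C") (auto simp: less_imp_le le_max_iff_disj)
  qed
  then have *: "apply_bcontfun (Bcontfun f) = f" by (rule Bcontfun_inverse)
  then show ?thesis using assms(2) unfolding c0_of_def by (subst Abs_c0_inverse) auto
qed

lemma continuous_c0: "continuous_on A (c0_apply f)"
  using apply_bcontfun[of "bcontfun_of_c0 f"] by (auto simp: bcontfun_def intro: continuous_on_subset)

lemma vanishes_c0: "vanishes_at_infinity (c0_apply f)"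
  using bcontfun_of_c0[of f] by simp

lemma continuous_on_clopen_cases:
  fixes f g :: "'k::topological_space \<Rightarrow> 'b::topological_space"
  assumes "open W" "closed W" "continuous_on UNIV f" "continuous_on UNIV g"
  shows "continuous_on UNIV (\<lambda>x. if x \<in> W then f x else g x)"
proof -
  have "continuous_on (W \<union> - W) (\<lambda>x. if x \<in> W then f x else g x)"
    using assms by (intro continuous_on_cases) (auto simp: closed_Compl intro: continuous_on_subset)
  then show ?thesis by simp
qed

text \<open>
  The product of \<open>f\<close> with the indicator function of a clopen set \<open>W\<close>.
\<close>

definition c0_cut :: "'k set \<Rightarrow> ('k::topological_space, 's::real_normed_vector) c0 \<Rightarrow> ('k, 's) c0"
  where "c0_cut W f = c0_of (\<lambda>x. if x \<in> W then c0_apply f x else 0)"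

lemma c0_cut_apply:
  assumes "open W" "closed W"
  shows "c0_apply (c0_cut W f) x = (if x \<in> W then c0_apply f x else 0)"
  unfolding c0_cut_def
proof (subst c0_apply_c0_of)
  show "vanishes_at_infinity (\<lambda>x. if x \<in> W then c0_apply f x else 0)"
    by (rule vanishes_at_infinity_bound[OF vanishes_c0[of f], where r = 1]) auto
qed (auto intro!: continuous_on_clopen_cases assms continuous_c0)

lemma c0_cut_split:
  assumes "open W" "closed W"
  shows "f = c0_cut W f + c0_cut (- W) f"
  using assms by (intro c0_eqI) (simp add: plus_c0.rep_eq c0_cut_apply open_Compl closed_Compl)

lemma norm_c0_cut_le: "open W \<Longrightarrow> closed W \<Longrightarrow> norm (c0_cut W f) \<le> norm f"
  by (rule norm_c0_le) (simp add: c0_cut_apply norm_c0_apply_le)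

text \<open>
  The indicator function of a compact open set.
\<close>

definition c0_ind :: "'k set \<Rightarrow> ('k::topological_space, 's::real_normed_field) c0"
  where "c0_ind W = c0_of (\<lambda>x. if x \<in> W then 1 else 0)"

lemma c0_ind_apply:
  assumes "compact W" "open W" "closed W"
  shows "c0_apply (c0_ind W) x = (if x \<in> W then 1 else 0)"
  unfolding c0_ind_def
proof (subst c0_apply_c0_of)
  show "vanishes_at_infinity (\<lambda>x. if x \<in> W then 1 else 0 :: 'b)"
    unfolding vanishes_at_infinity_def using assms(1) by auto
qed (auto intro!: continuous_on_clopen_cases assms)

lemma c0_apply_sum: "c0_apply (sum f A) x = (\<Sum>a\<in>A. c0_apply (f a) x)"
  by (induction A rule: infinite_finite_induct) (auto simp: zero_c0.rep_eq plus_c0.rep_eq)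

text \<open>
  The step function with value \<open>u y\<close> on \<open>W y\<close> for \<open>y \<in> F\<close>, where the sets \<open>W y\<close> are disjoint, compact and open.
\<close>

definition c0_step ::
    "'k set \<Rightarrow> ('k \<Rightarrow> 'k set) \<Rightarrow> ('k \<Rightarrow> 's) \<Rightarrow> ('k::topological_space, 's::real_normed_field) c0"
  where "c0_step F W u = (\<Sum>y\<in>F. c0_scale (u y) (c0_ind (W y)))"

context
  fixes F :: "'k::t2_space set" and W :: "'k \<Rightarrow> 'k set"
  assumes fin: "finite F"
    and W: "\<And>y. y \<in> F \<Longrightarrow> compact (W y) \<and> open (W y)"
    and disj: "\<And>y z. y \<in> F \<Longrightarrow> z \<in> F \<Longrightarrow> y \<noteq> z \<Longrightarrow> W y \<inter> W z = {}"
begin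

lemma c0_step_out:
  assumes "\<And>y. y \<in> F \<Longrightarrow> x \<notin> W y" shows "c0_apply (c0_step F W u) x = 0"
  unfolding c0_step_def c0_apply_sum
  using assms W by (intro sum.neutral) (simp add: c0_apply_scale c0_ind_apply compact_imp_closed)

lemma c0_step_in:
  assumes "y \<in> F" "x \<in> W y" shows "c0_apply (c0_step F W u) x = u y"
proof -
  have "c0_apply (c0_step F W u) x = (\<Sum>z\<in>F. if z = y then u y else 0)"
    unfolding c0_step_def c0_apply_sum
    using assms W disj[OF assms(1)] by (intro sum.cong) (auto simp: c0_apply_scale c0_ind_apply compact_imp_closed)
  then show ?thesis using assms fin by simp
qed

lemma norm_c0_step_le:
  assumes "\<And>y. y \<in> F \<Longrightarrow> norm (u y) \<le> b" "b \<ge> 0"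
  shows "norm (c0_step F W u) \<le> b"
proof (rule norm_c0_le)
  show "norm (c0_apply (c0_step F W u) x) \<le> b" for x
    using c0_step_out[of x u] c0_step_in[of _ x u] assms
    by (cases "\<exists>y\<in>F. x \<in> W y") auto
qed

end

text \<open>
  A scalar of norm \<open>1\<close>, or \<open>0\<close> if \<open>a = 0\<close>, that turns \<open>a\<close> into its norm.
\<close>

definition phase :: "'s::real_normed_field \<Rightarrow> 's"
  where "phase a = (if a = 0 then 0 else of_real (norm a) / a)"

lemma norm_phase_le: "norm (phase a) \<le> 1"
  by (simp add: phase_def norm_divide)

lemma phase_mult: "phase a * a = of_real (norm a)"
  by (simp add: phase_def)

section \<open>Functionals on a scattered space are atomic\<close>

lemma ex_pos_mult_le:
  fixes B e :: real
  assumes "e > 0"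
  shows "\<exists>d>0. B * d \<le> e"
proof (intro exI conjI)
  have "B * (e / (\<bar>B\<bar> + 1)) \<le> (\<bar>B\<bar> + 1) * (e / (\<bar>B\<bar> + 1))"
    using assms by (intro mult_right_mono) auto
  then show "B * (e / (\<bar>B\<bar> + 1)) \<le> e" by simp
  show "0 < e / (\<bar>B\<bar> + 1)" using assms by simp
qed

text \<open>
  The function \<open>f\<close> vanishes off \<open>W\<close>; no closure is taken.
\<close>

definition c0_supported :: "'k set \<Rightarrow> ('k::topological_space, 's::real_normed_vector) c0 \<Rightarrow> bool"
  where "c0_supported W f \<longleftrightarrow> (\<forall>x. x \<notin> W \<longrightarrow> c0_apply f x = 0)"

text \<open>
  The functional \<open>\<phi>\<close> has mass \<open>a\<close> at the point \<open>y\<close>: on functions supported in a small neighbourhood of \<open>y\<close>, it is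
  close to \<open>a\<close> times the evaluation at \<open>y\<close>. Such an \<open>a\<close> exists and is unique on a scattered locally compact
  space.
\<close>

definition has_atom ::
    "('k::topological_space, 's::real_normed_field) c0_dual \<Rightarrow> 'k \<Rightarrow> 's \<Rightarrow> bool"
  where "has_atom \<phi> y a \<longleftrightarrow> (\<forall>e>0. \<exists>W. compact W \<and> open W \<and> y \<in> W \<and>
    (\<forall>f. c0_supported W f \<longrightarrow> norm (c0_dual_apply \<phi> f - a * c0_apply f y) \<le> e * norm f))"

text \<open>
  The mass of \<open>\<phi>\<close> at \<open>y\<close>.
\<close>

definition atom :: "('k::topological_space, 's::real_normed_field) c0_dual \<Rightarrow> 'k \<Rightarrow> 's"
  where "atom \<phi> y = (SOME a. has_atom \<phi> y a)"

lemma c0_supported_mono: "c0_supported V f \<Longrightarrow> V \<subseteq> W \<Longrightarrow> c0_supported W f"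
  unfolding c0_supported_def by blast

lemma c0_supported_cut: "open W \<Longrightarrow> closed W \<Longrightarrow> c0_supported W (c0_cut W f)"
  by (simp add: c0_supported_def c0_cut_apply)

lemma norm_c0_apply_phases_le:
  assumes "c0_supported A f" "c0_supported B g" "A \<inter> B = {}" "norm f \<le> b" "norm g \<le> b"
    "norm u \<le> 1" "norm v \<le> 1"
  shows "norm (c0_scale u f + c0_scale v g) \<le> b"
proof (rule norm_c0_le)
  fix x
  have "norm (u * c0_apply f x) \<le> 1 * b" "norm (v * c0_apply g x) \<le> 1 * b"
    unfolding norm_mult
    by (intro mult_mono order.trans[OF norm_c0_apply_le] assms norm_ge_zero zero_le_one)+
  moreover have "c0_apply f x = 0 \<or> c0_apply g x = 0"
    using assms(1-3) unfolding c0_supported_def by blast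
  ultimately show "norm (c0_apply (c0_scale u f + c0_scale v g) x) \<le> b"
    by (auto simp: plus_c0.rep_eq c0_apply_scale)
qed

lemma norm_c0_diff_cut_le:
  fixes f :: "('k::t2_space, 's::real_normed_field) c0"
  assumes "open W" "closed W" "\<And>x. x \<notin> W \<Longrightarrow> norm (c0_apply f x) \<le> d" "0 \<le> d"
  shows "norm (f - c0_cut W f) \<le> d"
  by (rule norm_c0_le) (use assms in \<open>auto simp: minus_c0.rep_eq c0_cut_apply\<close>)

context scattered_lc
begin

text \<open>
  The variation of \<open>\<phi>\<close> on small punctured neighbourhoods of \<open>y\<close> is small.
\<close>

lemma small_on_nhd_if_vanishing:
  fixes \<phi> :: "('k, 's::real_normed_field) c0_dual"
  assumes e: "e > 0"
  shows "\<exists>W. compact W \<and> open W \<and> y \<in> W \<and>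
    (\<forall>f. c0_supported W f \<and> c0_apply f y = 0 \<longrightarrow> norm (c0_dual_apply \<phi> f) \<le> e * norm f)"
proof (rule ccontr)
  assume neg: "\<not> ?thesis"
  \<comment> \<open>Cutting off near \<open>y\<close> yields disjointly supported functions on which \<open>\<phi>\<close> is at least \<open>e/2\<close>;
    adding up sufficiently many contradicts the boundedness of \<open>\<phi>\<close>.\<close>
  have step: "\<exists>f V. compact V \<and> open V \<and> y \<in> V \<and> V \<subseteq> W \<and> c0_supported (W - V) f \<and>
      norm f \<le> 1 \<and> e/2 \<le> norm (c0_dual_apply \<phi> f)" if W: "compact W" "open W" "y \<in> W" for W
  proof -
    obtain f where f: "c0_supported W f" "c0_apply f y = 0" "e * norm f < norm (c0_dual_apply \<phi> f)"
      using neg W by (auto simp: not_le)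
    have "f \<noteq> 0" using f(3) by auto
    define g where "g = (1 / norm f) *\<^sub>R f"
    have g: "c0_supported W g" "c0_apply g y = 0" "norm g = 1" "e < norm (c0_dual_apply \<phi> g)"
      using f \<open>f \<noteq> 0\<close> by (auto simp: g_def c0_supported_def scaleR_c0.rep_eq blinfun.scaleR_right field_simps)
    obtain d where d: "d > 0" and d2: "norm \<phi> * d \<le> e/2"
      using ex_pos_mult_le[of "e/2"] e by auto
    have "open {x. norm (c0_apply g x) < d}"
      by (intro open_Collect_less continuous_intros continuous_c0)
    then obtain V where V: "compact V" "open V" "y \<in> V" "V \<subseteq> W \<inter> {x. norm (c0_apply g x) < d}"
      using ex_compact_open[of "W \<inter> {x. norm (c0_apply g x) < d}" y] W g d by auto
    have cV: "open (- V)" "closed (- V)" using V by (auto simp: open_Compl compact_imp_closed closed_Compl)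
    define h where "h = c0_cut (- V) g"
    have "norm (g - h) \<le> d"
      unfolding h_def using V d by (intro norm_c0_diff_cut_le cV) auto
    then have "norm (c0_dual_apply \<phi> (g - h)) \<le> e/2"
      using norm_c0_dual_apply_le[of \<phi> "g - h"] mult_left_mono[of "norm (g - h)" d "norm \<phi>"] d2
      by simp
    then have "e/2 \<le> norm (c0_dual_apply \<phi> h)"
      using g(4) norm_triangle_ineq2[of "c0_dual_apply \<phi> g" "c0_dual_apply \<phi> h"]
      by (simp add: blinfun.diff_right)
    moreover have "norm h \<le> 1" using norm_c0_cut_le[OF cV, of g] g(3) by (simp add: h_def)
    moreover have "c0_supported (W - V) h"
      using g(1) cV by (auto simp: c0_supported_def h_def c0_cut_apply)
    ultimately show ?thesis using V by blast
  qed
  have many: "\<exists>f V. compact V \<and> open V \<and> y \<in> V \<and> V \<subseteq> W \<and> c0_supported (W - V) f \<and>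
      norm f \<le> 1 \<and> real k * (e/2) \<le> norm (c0_dual_apply \<phi> f)"
    if W: "compact W" "open W" "y \<in> W" for W k
  proof (induction k)
    case 0
    show ?case using W by (intro exI[of _ 0] exI[of _ W]) (auto simp: c0_supported_def zero_c0.rep_eq)
  next
    case (Suc k)
    then obtain f V where f: "compact V" "open V" "y \<in> V" "V \<subseteq> W" "c0_supported (W - V) f"
      "norm f \<le> 1" "real k * (e/2) \<le> norm (c0_dual_apply \<phi> f)" by blast
    obtain g V' where g: "compact V'" "open V'" "y \<in> V'" "V' \<subseteq> V" "c0_supported (V - V') g"
      "norm g \<le> 1" "e/2 \<le> norm (c0_dual_apply \<phi> g)" using step[OF f(1-3)] by blast
    define h where "h = c0_scale (phase (c0_dual_apply \<phi> f)) f + c0_scale (phase (c0_dual_apply \<phi> g)) g"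
    have "c0_dual_apply \<phi> h = of_real (norm (c0_dual_apply \<phi> f) + norm (c0_dual_apply \<phi> g))"
      by (simp add: h_def blinfun.add_right c0_dual_apply_c0_scale phase_mult)
    then have "norm (c0_dual_apply \<phi> h) = norm (c0_dual_apply \<phi> f) + norm (c0_dual_apply \<phi> g)"
      by (simp only: norm_of_real abs_of_nonneg add_nonneg_nonneg norm_ge_zero)
    then have "real (Suc k) * (e/2) \<le> norm (c0_dual_apply \<phi> h)"
      using f(7) g(7) by (simp add: algebra_simps)
    moreover have "norm h \<le> 1"
      unfolding h_def by (rule norm_c0_apply_phases_le[OF f(5) g(5)]) (use f g norm_phase_le in auto)
    moreover have "c0_supported (W - V') h"
      using f(4,5) g(4,5) by (auto simp: c0_supported_def h_def plus_c0.rep_eq c0_apply_scale)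
    ultimately show ?case using g f(4) by blast
  qed
  obtain W where W: "compact W" "open W" "y \<in> W" using ex_compact_open[of UNIV y] by auto
  obtain k where k: "norm \<phi> < real k * (e/2)"
    using reals_Archimedean3[of "e/2"] e by auto
  obtain f where "norm f \<le> 1" "real k * (e/2) \<le> norm (c0_dual_apply \<phi> f)"
    using many[OF W, of k] by blast
  then show False
    using k norm_c0_dual_apply_le[of \<phi> f] mult_left_mono[of "norm f" 1 "norm \<phi>"] by simp
qed

lemma c0_ind_co: "compact W \<Longrightarrow> open W \<Longrightarrow> c0_apply (c0_ind W :: ('k, 's::real_normed_field) c0) x = (if x \<in> W then 1 else 0)"
  for W :: "'k set"
  by (simp add: c0_ind_apply compact_imp_closed)

lemma norm_c0_ind_le: "compact W \<Longrightarrow> open W \<Longrightarrow> norm (c0_ind W :: ('k, 's::real_normed_field) c0) \<le> 1"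
  for W :: "'k set"
  by (rule norm_c0_le) (simp add: c0_ind_co)

lemma c0_supported_ind: "compact W \<Longrightarrow> open W \<Longrightarrow> c0_supported W (c0_ind W :: ('k, 's::real_normed_field) c0)"
  for W :: "'k set"
  by (simp add: c0_supported_def c0_ind_co)

text \<open>
  The mass at \<open>y\<close> is the limit of \<open>\<phi>\<close> on the indicator functions of shrinking neighbourhoods of \<open>y\<close>.
\<close>

theorem has_atom_exists:
  fixes \<phi> :: "('k, 's::{real_normed_field, banach}) c0_dual"
  shows "\<exists>a. has_atom \<phi> y a"
proof -
  define e where "e n = inverse (real (Suc n))" for n
  have e: "e n > 0" for n by (simp add: e_def)
  have "\<forall>n. \<exists>W. compact W \<and> open W \<and> y \<in> W \<and>
      (\<forall>f. c0_supported W f \<and> c0_apply f y = 0 \<longrightarrow> norm (c0_dual_apply \<phi> f) \<le> e n * norm f)"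
    using small_on_nhd_if_vanishing[OF e] by blast
  then obtain W where W: "\<And>n. compact (W n)" "\<And>n. open (W n)" "\<And>n. y \<in> W n"
    "\<And>n f. c0_supported (W n) f \<Longrightarrow> c0_apply f y = 0 \<Longrightarrow> norm (c0_dual_apply \<phi> f) \<le> e n * norm f"
    by metis
  define a where "a n = c0_dual_apply \<phi> (c0_ind (W n))" for n
  have half: "norm (a n - c0_dual_apply \<phi> (c0_ind (W n \<inter> W m))) \<le> e n" for n m
  proof -
    have co: "compact (W n \<inter> W m)" "open (W n \<inter> W m)" using W by (auto simp: compact_Int)
    define f :: "('k, 's) c0" where "f = c0_ind (W n) - c0_ind (W n \<inter> W m)"
    have f: "c0_apply f x = (if x \<in> W n - W m then 1 else 0)" for x
      using W(1,2) co by (auto simp: f_def minus_c0.rep_eq c0_ind_co)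
    have "norm f \<le> 1" by (rule norm_c0_le) (simp add: f)
    then have "e n * norm f \<le> e n" using e[of n] by simp
    moreover have "norm (c0_dual_apply \<phi> f) \<le> e n * norm f"
      using W(3) by (intro W(4)) (auto simp: c0_supported_def f)
    ultimately show ?thesis by (simp add: a_def f_def blinfun.diff_right)
  qed
  have close: "norm (a n - a m) \<le> e n + e m" for n m
    using half[of n m] half[of m n] unfolding Int_commute[of "W m"]
    using norm_triangle_ineq4[of "a n - c0_dual_apply \<phi> (c0_ind (W n \<inter> W m))" "a m - c0_dual_apply \<phi> (c0_ind (W n \<inter> W m))"]
    by simp
  have e_lim: "e \<longlonglongrightarrow> 0" unfolding e_def by (rule LIMSEQ_inverse_real_of_nat)
  have "Cauchy a"
  proof (rule metric_CauchyI)
    fix d :: real assume "d > 0"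
    then obtain N where N: "\<And>n. n \<ge> N \<Longrightarrow> e n < d/2"
      using order_tendstoD(2)[OF e_lim, of "d/2"] unfolding eventually_sequentially by auto
    have "dist (a m) (a n) < d" if "m \<ge> N" "n \<ge> N" for m n
      using close[of m n] N[OF that(1)] N[OF that(2)] by (simp add: dist_norm)
    then show "\<exists>M. \<forall>m\<ge>M. \<forall>n\<ge>M. dist (a m) (a n) < d" by blast
  qed
  then obtain l where l: "a \<longlonglongrightarrow> l" by (auto simp: Cauchy_convergent_iff convergent_def)
  have al: "norm (a n - l) \<le> e n" for n
  proof (rule LIMSEQ_le)
    show "(\<lambda>m. norm (a n - a m)) \<longlonglongrightarrow> norm (a n - l)" by (intro tendsto_intros l)
    show "(\<lambda>m. e n + e m) \<longlonglongrightarrow> e n" using tendsto_add[OF tendsto_const[of "e n"] e_lim] by simp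
  qed (use close in auto)
  have "\<exists>W. compact W \<and> open W \<and> y \<in> W \<and>
    (\<forall>f. c0_supported W f \<longrightarrow> norm (c0_dual_apply \<phi> f - l * c0_apply f y) \<le> d * norm f)"
    if d: "d > 0" for d
  proof -
    obtain n where n: "e n < d/3" using reals_Archimedean[of "d/3"] d by (auto simp: e_def)
    have "norm (c0_dual_apply \<phi> f - l * c0_apply f y) \<le> d * norm f" if f: "c0_supported (W n) f" for f
    proof -
      define g where "g = f - c0_scale (c0_apply f y) (c0_ind (W n))"
      have gx: "c0_apply g x = (if x \<in> W n then c0_apply f x - c0_apply f y else 0)" for x
        using f W(1,2)[of n] by (auto simp: g_def minus_c0.rep_eq c0_apply_scale c0_ind_co c0_supported_def)
      have "norm g \<le> 2 * norm f"
      proof (rule norm_c0_le)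
        fix x
        show "norm (c0_apply g x) \<le> 2 * norm f"
          using norm_triangle_ineq4[of "c0_apply f x" "c0_apply f y"] norm_c0_apply_le[of f x]
            norm_c0_apply_le[of f y] by (auto simp: gx)
      qed
      then have "e n * norm g \<le> e n * (2 * norm f)" using e[of n] by (intro mult_left_mono) auto
      moreover have "norm (c0_dual_apply \<phi> g) \<le> e n * norm g"
        using W(3) by (intro W(4)) (auto simp: c0_supported_def gx)
      moreover have "c0_dual_apply \<phi> f - l * c0_apply f y = c0_dual_apply \<phi> g + c0_apply f y * (a n - l)"
        by (simp add: g_def blinfun.diff_right c0_dual_apply_c0_scale a_def algebra_simps)
      moreover have "norm (c0_apply f y * (a n - l)) \<le> norm f * e n"
        unfolding norm_mult by (intro mult_mono norm_c0_apply_le al) auto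
      ultimately have "norm (c0_dual_apply \<phi> f - l * c0_apply f y) \<le> 3 * e n * norm f"
        using norm_triangle_ineq[of "c0_dual_apply \<phi> g" "c0_apply f y * (a n - l)"]
        by (simp add: algebra_simps)
      also have "\<dots> \<le> d * norm f" using n by (intro mult_right_mono) auto
      finally show ?thesis .
    qed
    then show ?thesis using W by blast
  qed
  then show ?thesis unfolding has_atom_def by blast
qed

lemma has_atomE:
  fixes y :: 'k and \<phi> :: "('k, 's::real_normed_field) c0_dual"
  assumes "has_atom \<phi> y a" "e > 0" "open U" "y \<in> U"
  shows "\<exists>W. compact W \<and> open W \<and> y \<in> W \<and> W \<subseteq> U \<and>
    (\<forall>f. c0_supported W f \<longrightarrow> norm (c0_dual_apply \<phi> f - a * c0_apply f y) \<le> e * norm f)"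
proof -
  obtain W where W: "open W" "y \<in> W"
    "\<forall>f. c0_supported W f \<longrightarrow> norm (c0_dual_apply \<phi> f - a * c0_apply f y) \<le> e * norm f"
    using assms(1,2) unfolding has_atom_def by blast
  obtain V where V: "compact V" "open V" "y \<in> V" "V \<subseteq> U \<inter> W"
    using ex_compact_open[of "U \<inter> W" y] W assms by auto
  then show ?thesis using W(3) c0_supported_mono[of V _ W] by (intro exI[of _ V]) auto
qed

lemma has_atom_ind:
  fixes y :: 'k and \<phi> :: "('k, 's::real_normed_field) c0_dual"
  assumes "has_atom \<phi> y a" "e > 0" "open U" "y \<in> U"
  shows "\<exists>W. compact W \<and> open W \<and> y \<in> W \<and> W \<subseteq> U \<and>
    (\<forall>V. compact V \<longrightarrow> open V \<longrightarrow> y \<in> V \<longrightarrow> V \<subseteq> W \<longrightarrow> norm (c0_dual_apply \<phi> (c0_ind V) - a) \<le> e)"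
proof -
  obtain W where W: "compact W" "open W" "y \<in> W" "W \<subseteq> U"
    "\<forall>f. c0_supported W f \<longrightarrow> norm (c0_dual_apply \<phi> f - a * c0_apply f y) \<le> e * norm f"
    using has_atomE[OF assms] by blast
  have "norm (c0_dual_apply \<phi> (c0_ind V) - a) \<le> e" if "compact V" "open V" "y \<in> V" "V \<subseteq> W" for V
  proof -
    have "norm (c0_dual_apply \<phi> (c0_ind V) - a * c0_apply (c0_ind V) y) \<le> e * norm (c0_ind V :: ('k, 's) c0)"
      using W(5) c0_supported_mono[OF c0_supported_ind] that by blast
    also have "\<dots> \<le> e * 1" using norm_c0_ind_le[of V] that assms(2) by (intro mult_left_mono) auto
    finally show ?thesis using that by (simp add: c0_ind_co)
  qed
  then show ?thesis using W by blast
qed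

lemma has_atom_unique:
  fixes \<phi> :: "('k, 's::real_normed_field) c0_dual"
  assumes "has_atom \<phi> y a" "has_atom \<phi> y b"
  shows "a = b"
proof (rule ccontr)
  assume "a \<noteq> b"
  define e where "e = norm (a - b) / 3"
  have e: "e > 0" using \<open>a \<noteq> b\<close> by (simp add: e_def)
  obtain W where W: "open W" "y \<in> W"
    "\<forall>V. compact V \<longrightarrow> open V \<longrightarrow> y \<in> V \<longrightarrow> V \<subseteq> W \<longrightarrow> norm (c0_dual_apply \<phi> (c0_ind V) - a) \<le> e"
    using has_atom_ind[OF assms(1) e, of UNIV] by auto
  obtain V where V: "compact V" "open V" "y \<in> V" "V \<subseteq> W"
    "\<forall>V'. compact V' \<longrightarrow> open V' \<longrightarrow> y \<in> V' \<longrightarrow> V' \<subseteq> V \<longrightarrow> norm (c0_dual_apply \<phi> (c0_ind V') - b) \<le> e"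
    using has_atom_ind[OF assms(2) e W(1,2)] by blast
  have "norm (a - b) \<le> e + e"
    using W(3) V norm_triangle_ineq4[of "c0_dual_apply \<phi> (c0_ind V) - b" "c0_dual_apply \<phi> (c0_ind V) - a"]
    by (smt (verit) add_diff_cancel_left diff_add_cancel diff_diff_eq2 order_refl minus_diff_eq add_diff_eq)
  then show False using e by (simp add: e_def)
qed

lemma has_atom_atom: "has_atom \<phi> y (atom \<phi> y)"
  for \<phi> :: "('k, 's::{real_normed_field, banach}) c0_dual"
  unfolding atom_def using has_atom_exists by (rule someI_ex)

lemma atom_eqI: "has_atom \<phi> y a \<Longrightarrow> atom \<phi> y = a"
  for \<phi> :: "('k, 's::{real_normed_field, banach}) c0_dual"
  using has_atom_unique has_atom_atom by blast

lemma atom_add: "atom (\<phi> + \<psi>) y = atom \<phi> y + atom \<psi> y"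
  for \<phi> :: "('k, 's::{real_normed_field, banach}) c0_dual"
proof (rule atom_eqI, unfold has_atom_def, intro allI impI)
  fix e :: real assume e: "e > 0"
  then have e2: "e/2 > 0" by simp
  obtain W where W: "open W" "y \<in> W"
    "\<forall>f. c0_supported W f \<longrightarrow> norm (c0_dual_apply \<phi> f - atom \<phi> y * c0_apply f y) \<le> e/2 * norm f"
    using has_atomE[OF has_atom_atom e2, of UNIV y \<phi>] by auto
  obtain V where V: "compact V" "open V" "y \<in> V" "V \<subseteq> W"
    "\<forall>f. c0_supported V f \<longrightarrow> norm (c0_dual_apply \<psi> f - atom \<psi> y * c0_apply f y) \<le> e/2 * norm f"
    using has_atomE[OF has_atom_atom e2 W(1,2), of \<psi>] by auto
  have "norm (c0_dual_apply (\<phi> + \<psi>) f - (atom \<phi> y + atom \<psi> y) * c0_apply f y) \<le> e * norm f"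
    if f: "c0_supported V f" for f
  proof -
    have "norm (c0_dual_apply \<phi> f - atom \<phi> y * c0_apply f y) \<le> e/2 * norm f"
      using W(3) c0_supported_mono[OF f V(4)] by blast
    moreover have "norm (c0_dual_apply \<psi> f - atom \<psi> y * c0_apply f y) \<le> e/2 * norm f"
      using V(5) f by blast
    ultimately have "norm ((c0_dual_apply \<phi> f - atom \<phi> y * c0_apply f y) + (c0_dual_apply \<psi> f - atom \<psi> y * c0_apply f y)) \<le> e * norm f"
      by (intro order.trans[OF norm_triangle_ineq]) simp
    then show ?thesis by (simp add: plus_c0_dual.rep_eq blinfun.add_left algebra_simps)
  qed
  then show "\<exists>W. compact W \<and> open W \<and> y \<in> W \<and> (\<forall>f. c0_supported W f \<longrightarrow>
      norm (c0_dual_apply (\<phi> + \<psi>) f - (atom \<phi> y + atom \<psi> y) * c0_apply f y) \<le> e * norm f)"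
    using V by blast
qed

lemma atom_scale: "atom (c0_dual_scale c \<phi>) y = c * atom \<phi> y"
  for \<phi> :: "('k, 's::{real_normed_field, banach}) c0_dual"
proof (rule atom_eqI, unfold has_atom_def, intro allI impI)
  fix e :: real assume e: "e > 0"
  obtain d where d: "d > 0" and d2: "norm c * d \<le> e"
    using ex_pos_mult_le[OF e] by blast
  obtain W where W: "compact W" "open W" "y \<in> W"
    "\<forall>f. c0_supported W f \<longrightarrow> norm (c0_dual_apply \<phi> f - atom \<phi> y * c0_apply f y) \<le> d * norm f"
    using has_atomE[OF has_atom_atom d, of UNIV y \<phi>] by auto
  have "norm (c0_dual_apply (c0_dual_scale c \<phi>) f - c * atom \<phi> y * c0_apply f y) \<le> e * norm f"
    if "c0_supported W f" for f
  proof -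
    have "norm (c0_dual_apply (c0_dual_scale c \<phi>) f - c * atom \<phi> y * c0_apply f y)
        = norm c * norm (c0_dual_apply \<phi> f - atom \<phi> y * c0_apply f y)"
      by (simp add: c0_dual_apply_scale mult.assoc flip: norm_mult right_diff_distrib)
    also have "\<dots> \<le> norm c * (d * norm f)" using W(4) that by (intro mult_left_mono) auto
    also have "\<dots> \<le> e * norm f" using mult_right_mono[OF d2, of "norm f"] by (simp add: mult.assoc)
    finally show ?thesis .
  qed
  then show "\<exists>W. compact W \<and> open W \<and> y \<in> W \<and> (\<forall>f. c0_supported W f \<longrightarrow>
      norm (c0_dual_apply (c0_dual_scale c \<phi>) f - c * atom \<phi> y * c0_apply f y) \<le> e * norm f)"
    using W by blast
qed

text \<open>
  Test \<open>\<phi>\<close> on a step function that has the phases of the atoms as values near the points of \<open>F\<close>.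
\<close>

lemma sum_norm_atom_le:
  fixes \<phi> :: "('k, 's::{real_normed_field, banach}) c0_dual"
  assumes F: "finite F"
  shows "(\<Sum>y\<in>F. norm (atom \<phi> y)) \<le> norm \<phi>"
proof (rule field_le_epsilon)
  fix d :: real assume d: "d > 0"
  obtain e where e: "e > 0" and ce: "real (card F) * e \<le> d"
    using ex_pos_mult_le[OF d] by blast
  have "\<forall>y. \<exists>U. open U \<and> y \<in> U \<and> (\<forall>V. compact V \<longrightarrow> open V \<longrightarrow> y \<in> V \<longrightarrow> V \<subseteq> U \<longrightarrow>
      norm (c0_dual_apply \<phi> (c0_ind V) - atom \<phi> y) \<le> e)"
    using has_atom_ind[OF has_atom_atom e, of UNIV _ \<phi>] by (metis UNIV_I open_UNIV)
  then obtain U where U: "\<And>y. open (U y) \<and> y \<in> U y"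
    "\<And>y V. compact V \<Longrightarrow> open V \<Longrightarrow> y \<in> V \<Longrightarrow> V \<subseteq> U y \<Longrightarrow> norm (c0_dual_apply \<phi> (c0_ind V) - atom \<phi> y) \<le> e"
    by metis
  obtain W where W: "\<And>y. y \<in> F \<Longrightarrow> compact (W y) \<and> open (W y) \<and> y \<in> W y \<and> W y \<subseteq> U y"
    "\<And>y z. y \<in> F \<Longrightarrow> z \<in> F \<Longrightarrow> y \<noteq> z \<Longrightarrow> W y \<inter> W z = {}"
    using ex_disjoint_compact_open[OF F U(1)] by metis
  define f where "f = c0_step F W (\<lambda>y. phase (atom \<phi> y))"
  have "norm f \<le> 1"
    unfolding f_def by (rule norm_c0_step_le) (use F W norm_phase_le in auto)
  then have "norm (c0_dual_apply \<phi> f) \<le> norm \<phi>"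
    using norm_c0_dual_apply_le[of \<phi> f] mult_left_mono[of "norm f" 1 "norm \<phi>"] by simp
  moreover have "c0_dual_apply \<phi> f - of_real (\<Sum>y\<in>F. norm (atom \<phi> y)) =
      (\<Sum>y\<in>F. phase (atom \<phi> y) * (c0_dual_apply \<phi> (c0_ind (W y)) - atom \<phi> y))"
    by (simp add: f_def c0_step_def blinfun.sum_right c0_dual_apply_c0_scale right_diff_distrib
        phase_mult sum_subtractf)
  moreover have "norm (\<Sum>y\<in>F. phase (atom \<phi> y) * (c0_dual_apply \<phi> (c0_ind (W y)) - atom \<phi> y)) \<le> (\<Sum>y\<in>F. 1 * e)"
    unfolding norm_mult[symmetric]
  proof (rule order.trans[OF norm_sum], rule sum_mono)
    fix y assume "y \<in> F"
    then show "norm (phase (atom \<phi> y) * (c0_dual_apply \<phi> (c0_ind (W y)) - atom \<phi> y)) \<le> 1 * e"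
      unfolding norm_mult using W by (intro mult_mono norm_phase_le U(2)) auto
  qed
  ultimately have "norm (of_real (\<Sum>y\<in>F. norm (atom \<phi> y)) :: 's) \<le> norm \<phi> + d"
    using norm_triangle_ineq2[of "of_real (\<Sum>y\<in>F. norm (atom \<phi> y))" "c0_dual_apply \<phi> f"] ce
    by (simp add: norm_minus_commute)
  then show "(\<Sum>y\<in>F. norm (atom \<phi> y)) \<le> norm \<phi> + d"
    by (simp only: norm_of_real abs_of_nonneg sum_nonneg norm_ge_zero)
qed

lemma norm_atom_le: "norm (atom \<phi> y) \<le> norm \<phi>"
  for \<phi> :: "('k, 's::{real_normed_field, banach}) c0_dual"
  using sum_norm_atom_le[of "{y}" \<phi>] by simp

lemma atom_abs_summable: "(\<lambda>y. norm (atom \<phi> y)) summable_on A"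
  for \<phi> :: "('k, 's::{real_normed_field, banach}) c0_dual"
  by (rule nonneg_bdd_above_summable_on) (auto intro!: bdd_aboveI2 sum_norm_atom_le)

lemma infsum_norm_atom_le: "(\<Sum>\<^sub>\<infinity>y\<in>A. norm (atom \<phi> y)) \<le> norm \<phi>"
  for \<phi> :: "('k, 's::{real_normed_field, banach}) c0_dual"
  by (rule infsum_le_finite_sums[OF atom_abs_summable sum_norm_atom_le])

end

text \<open>
  Absolute summability of a family of scalars, that is, membership in \<open>\<ell>\<^sup>1(K)\<close>.
\<close>

abbreviation summable_mass :: "('k \<Rightarrow> 's::real_normed_vector) \<Rightarrow> bool"
  where "summable_mass a \<equiv> (\<lambda>y. norm (a y)) summable_on UNIV"

text \<open>
  The total variation, on the set \<open>A\<close>, of the atomic measure with point masses \<open>a\<close>.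
\<close>

definition mass :: "('k \<Rightarrow> 's::real_normed_vector) \<Rightarrow> 'k set \<Rightarrow> real"
  where "mass a A = (\<Sum>\<^sub>\<infinity>y\<in>A. norm (a y))"

lemma summable_mass_on: "summable_mass a \<Longrightarrow> (\<lambda>y. norm (a y)) summable_on A"
  by (rule summable_on_subset_banach) auto

lemma mass_nonneg: "0 \<le> mass a A"
  by (simp add: mass_def infsum_nonneg)

lemma mass_mono: "summable_mass a \<Longrightarrow> A \<subseteq> B \<Longrightarrow> mass a A \<le> mass a B"
  unfolding mass_def by (rule infsum_mono2[OF summable_mass_on summable_mass_on]) auto

lemma mass_Un_disjoint:
  "summable_mass a \<Longrightarrow> A \<inter> B = {} \<Longrightarrow> mass a (A \<union> B) = mass a A + mass a B"
  unfolding mass_def by (rule infsum_Un_disjoint[OF summable_mass_on summable_mass_on])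

lemma mass_Un_le:
  assumes "summable_mass a" shows "mass a (A \<union> B) \<le> mass a A + mass a B"
  using mass_Un_disjoint[OF assms, of A "B - A"] mass_mono[OF assms, of "B - A" B] by simp

lemma mass_finite: "finite A \<Longrightarrow> mass a A = (\<Sum>y\<in>A. norm (a y))"
  by (simp add: mass_def)

lemma ex_finite_mass_compl_le:
  assumes "summable_mass a" "e > 0"
  shows "\<exists>G. finite G \<and> mass a (- G) \<le> e"
proof -
  obtain G where G: "finite G" "dist (\<Sum>y\<in>G. norm (a y)) (\<Sum>\<^sub>\<infinity>y. norm (a y)) \<le> e"
    using infsum_finite_approximation[OF assms] by blast
  then have "mass a UNIV \<le> mass a G + e" by (simp add: mass_def dist_real_def)
  then have "mass a (- G) \<le> e" using mass_Un_disjoint[OF assms(1), of G "- G"] by simp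
  then show ?thesis using G(1) by blast
qed

lemma summable_mass_pairing:
  fixes a g :: "'k \<Rightarrow> 's::{real_normed_field, banach}"
  assumes "summable_mass a" "\<And>z. norm (g z) \<le> b"
  shows "summable_mass (\<lambda>z. a z * g z)"
proof (rule Infinite_Sum.abs_summable_on_comparison_test')
  show "(\<lambda>z. norm (a z) * b) summable_on UNIV" using assms(1) by (rule summable_on_cmult_left)
  show "norm (a z * g z) \<le> norm (a z) * b" for z
    unfolding norm_mult using assms(2) by (intro mult_left_mono) auto
qed

lemma norm_infsum_pairing_le:
  fixes a g :: "'k \<Rightarrow> 's::{real_normed_field, banach}"
  assumes a: "summable_mass a" and b: "\<And>z. norm (g z) \<le> b" and B: "\<And>z. z \<in> A - B \<Longrightarrow> g z = 0"
  shows "norm (\<Sum>\<^sub>\<infinity>z\<in>A. a z * g z) \<le> b * mass a B"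
proof -
  have b0: "0 \<le> b" using b norm_ge_zero order.trans by blast
  have s: "(\<lambda>z. norm (a z * g z)) summable_on A"
    by (rule summable_mass_on[OF summable_mass_pairing[OF a b]])
  then have "norm (\<Sum>\<^sub>\<infinity>z\<in>A. a z * g z) \<le> (\<Sum>\<^sub>\<infinity>z\<in>A. norm (a z * g z))"
    by (rule norm_infsum_bound)
  also have "\<dots> \<le> (\<Sum>\<^sub>\<infinity>z\<in>B. b * norm (a z))"
  proof (rule infsum_mono_neutral[OF s])
    show "(\<lambda>z. b * norm (a z)) summable_on B"
      using summable_mass_on[OF a] by (rule summable_on_cmult_right)
    show "norm (a z * g z) \<le> b * norm (a z)" for z
      using mult_left_mono[OF b, of "norm (a z)"] by (simp add: norm_mult mult.commute)
    show "norm (a z * g z) \<le> 0" if "z \<in> A - B" for z using B[OF that] by simp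
    show "0 \<le> b * norm (a z)" for z using b0 by simp
  qed
  also have "\<dots> = b * mass a B"
    unfolding mass_def using summable_mass_on[OF a] by (intro infsum_cmult_right)
  finally show ?thesis .
qed

lemma summable_pairing:
  fixes a g :: "'k \<Rightarrow> 's::{real_normed_field, banach}"
  assumes "summable_mass a" "\<And>z. norm (g z) \<le> b"
  shows "(\<lambda>z. a z * g z) summable_on A"
  using abs_summable_summable[OF summable_mass_pairing[OF assms]] by (rule summable_on_subset_banach) auto

context scattered_lc
begin

lemma summable_mass_atom: "summable_mass (atom \<phi>)"
  for \<phi> :: "('k, 's::{real_normed_field, banach}) c0_dual"
  by (rule atom_abs_summable)

lemma mass_atom_le: "mass (atom \<phi>) A \<le> norm \<phi>"
  for \<phi> :: "('k, 's::{real_normed_field, banach}) c0_dual"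
  unfolding mass_def by (rule infsum_norm_atom_le)

text \<open>
  Rudin's theorem: on a scattered space every functional is the sum of its atoms. The difference \<open>\<psi>\<close> of \<open>\<phi>\<close> and
  this sum has no atoms. Consider the set \<open>N\<close> of points with a compact open neighbourhood on which \<open>\<psi>\<close> vanishes. Near
  an isolated point \<open>y\<close> of the complement of \<open>N\<close>, the functional \<open>\<psi>\<close> could only be concentrated at \<open>y\<close> and thus
  vanishes, so there is no such point, and \<open>N\<close> is the whole space.
\<close>

theorem has_sum_atom:
  fixes \<phi> :: "('k, 's::{real_normed_field, banach}) c0_dual"
  shows "((\<lambda>y. atom \<phi> y * c0_apply f y) has_sum c0_dual_apply \<phi> f) UNIV"
proof -
  define \<psi> where "\<psi> f = c0_dual_apply \<phi> f - (\<Sum>\<^sub>\<infinity>y. atom \<phi> y * c0_apply f y)" for f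
  have sm: "(\<lambda>y. atom \<phi> y * c0_apply f y) summable_on A" for f A
    by (rule summable_pairing[OF summable_mass_atom norm_c0_apply_le])
  have add: "\<psi> (f + g) = \<psi> f + \<psi> g" for f g
    using infsum_add[OF sm[of f UNIV] sm[of g UNIV]]
    by (simp add: \<psi>_def blinfun.add_right plus_c0.rep_eq distrib_left)
  have bound: "norm (\<psi> f) \<le> 2 * norm \<phi> * norm f" for f
  proof -
    have "norm (\<Sum>\<^sub>\<infinity>y. atom \<phi> y * c0_apply f y) \<le> norm f * mass (atom \<phi>) UNIV"
      by (rule norm_infsum_pairing_le[OF summable_mass_atom norm_c0_apply_le]) auto
    also have "\<dots> \<le> norm f * norm \<phi>" by (intro mult_left_mono mass_atom_le) auto
    finally show ?thesis
      using norm_c0_dual_apply_le[of \<phi> f]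
        norm_triangle_ineq4[of "c0_dual_apply \<phi> f" "\<Sum>\<^sub>\<infinity>y. atom \<phi> y * c0_apply f y"]
      by (simp add: \<psi>_def algebra_simps)
  qed
  have small: "\<exists>W. compact W \<and> open W \<and> y \<in> W \<and> (\<forall>f. c0_supported W f \<longrightarrow> norm (\<psi> f) \<le> e * norm f)"
    if e: "e > 0" for e y
  proof -
    obtain G where G: "finite G" "mass (atom \<phi>) (- G) \<le> e/2"
      using ex_finite_mass_compl_le[OF summable_mass_atom, of "e/2"] e by auto
    have e2: "e/2 > 0" using e by simp
    have op: "open (- (G - {y}))" using G(1) by (intro open_Compl finite_imp_closed) auto
    obtain W where W: "compact W" "open W" "y \<in> W" "W \<subseteq> - (G - {y})"
      "\<forall>f. c0_supported W f \<longrightarrow> norm (c0_dual_apply \<phi> f - atom \<phi> y * c0_apply f y) \<le> e/2 * norm f"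
      using has_atomE[OF has_atom_atom e2 op, of y \<phi>] by blast
    have "norm (\<psi> f) \<le> e * norm f" if f: "c0_supported W f" for f
    proof -
      have eq: "(\<Sum>\<^sub>\<infinity>z. atom \<phi> z * c0_apply f z) = atom \<phi> y * c0_apply f y + (\<Sum>\<^sub>\<infinity>z\<in>- {y}. atom \<phi> z * c0_apply f z)"
        using infsum_Un_disjoint[OF sm[of f "{y}"] sm[of f "- {y}"]] by simp
      have "norm (\<Sum>\<^sub>\<infinity>z\<in>- {y}. atom \<phi> z * c0_apply f z) \<le> norm f * mass (atom \<phi>) (- G)"
        by (rule norm_infsum_pairing_le[OF summable_mass_atom norm_c0_apply_le])
           (use f W(4) in \<open>auto simp: c0_supported_def\<close>)
      also have "\<dots> \<le> norm f * (e/2)" using G(2) by (intro mult_left_mono) auto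
      finally have 1: "norm (\<Sum>\<^sub>\<infinity>z\<in>- {y}. atom \<phi> z * c0_apply f z) \<le> e/2 * norm f" by (simp add: mult.commute)
      have 2: "norm (c0_dual_apply \<phi> f - atom \<phi> y * c0_apply f y) \<le> e/2 * norm f" using W(5) f by blast
      have "\<psi> f = (c0_dual_apply \<phi> f - atom \<phi> y * c0_apply f y) - (\<Sum>\<^sub>\<infinity>z\<in>- {y}. atom \<phi> z * c0_apply f z)"
        unfolding \<psi>_def eq by simp
      then show ?thesis
        using 1 2 norm_triangle_ineq4[of "c0_dual_apply \<phi> f - atom \<phi> y * c0_apply f y" "\<Sum>\<^sub>\<infinity>z\<in>- {y}. atom \<phi> z * c0_apply f z"]
        by simp
    qed
    then show ?thesis using W by blast
  qed
  define null where "null W \<longleftrightarrow> compact W \<and> open W \<and> (\<forall>f. c0_supported W f \<longrightarrow> \<psi> f = 0)" for W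
  have null_Un: "null (V \<union> W)" if "null V" "null W" for V W
    unfolding null_def
  proof (intro conjI allI impI)
    fix f :: "('k, 's) c0" assume f: "c0_supported (V \<union> W) f"
    have V: "open V" "closed V" "open (- V)" "closed (- V)"
      using that by (auto simp: null_def compact_imp_closed open_Compl closed_Compl)
    have "c0_supported W (c0_cut (- V) f)"
      using f V by (auto simp: c0_supported_def c0_cut_apply)
    then have "\<psi> (c0_cut V f) + \<psi> (c0_cut (- V) f) = 0"
      using that c0_supported_cut[OF V(1,2), of f] by (simp add: null_def)
    then show "\<psi> f = 0" using add[of "c0_cut V f" "c0_cut (- V) f"] c0_cut_split[OF V(1,2), of f] by simp
  qed (use that in \<open>auto simp: null_def\<close>)
  have null_empty: "null {}"
  proof -
    have "\<psi> f = 0" if "c0_supported {} f" for f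
    proof -
      have "f = 0" using that by (intro c0_eqI) (simp add: c0_supported_def zero_c0.rep_eq)
      then show ?thesis using bound[of 0] by simp
    qed
    then show ?thesis by (simp add: null_def)
  qed
  define N where "N = \<Union>(Collect null)"
  have null_sub: "null V" if V: "compact V" "open V" "V \<subseteq> N" for V
  proof -
    obtain \<V> where \<V>: "\<V> \<subseteq> Collect null" "finite \<V>" "V \<subseteq> \<Union>\<V>"
      using compactE[OF V(1), of "Collect null"] V(3) unfolding N_def null_def
      by (metis (mono_tags, lifting) mem_Collect_eq)
    have "null (\<Union>\<V>)"
      using \<V>(2,1) by (induction \<V> rule: finite_induct) (auto simp: null_empty null_Un)
    then have "\<psi> f = 0" if "c0_supported V f" for f
      using c0_supported_mono[OF that \<V>(3)] by (simp add: null_def)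
    then show ?thesis using V by (simp add: null_def)
  qed
  have "- N = {}"
  proof (rule ccontr)
    assume "- N \<noteq> {}"
    then obtain y U where U: "open U" "U \<inter> - N = {y}" by (rule ex_isolated)
    have "y \<in> U \<inter> - N" unfolding U(2) by simp
    then obtain V where V: "compact V" "open V" "y \<in> V" "V \<subseteq> U"
      using ex_compact_open[OF U(1), of y] by auto
    have "\<psi> f = 0" if f: "c0_supported V f" for f
    proof -
      have "norm (\<psi> f) \<le> 0 + e" if e: "e > 0" for e
      proof -
        obtain d where d: "d > 0" "norm f * d \<le> e" using ex_pos_mult_le[OF e] by blast
        obtain W where W: "compact W" "open W" "y \<in> W"
          "\<forall>f. c0_supported W f \<longrightarrow> norm (\<psi> f) \<le> d * norm f"
          using small[OF d(1)] by blast
        have cW: "closed W" "open (- W)" "closed (- W)" 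
          using W by (auto simp: compact_imp_closed open_Compl closed_Compl)
        have "null (V - W)"
        proof (rule null_sub)
          show "compact (V - W)" using V(1) W(2) by (rule compact_diff)
          show "open (V - W)" using V(2) cW(1) by (rule open_Diff)
          show "V - W \<subseteq> N" using V(4) U(2) W(3) by auto
        qed
        moreover have "c0_supported (V - W) (c0_cut (- W) f)"
          using f cW by (auto simp: c0_supported_def c0_cut_apply)
        ultimately have "\<psi> (c0_cut (- W) f) = 0" by (simp add: null_def)
        then have "\<psi> f = \<psi> (c0_cut W f)"
          using add[of "c0_cut W f" "c0_cut (- W) f"] c0_cut_split[OF W(2) cW(1), of f] by simp
        also have "norm \<dots> \<le> d * norm (c0_cut W f)"
          using W(4) c0_supported_cut[OF W(2) cW(1), of f] by blast
        also have "\<dots> \<le> d * norm f"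
          using norm_c0_cut_le[OF W(2) cW(1), of f] d(1) by (intro mult_left_mono) auto
        finally show ?thesis using d(2) by (simp add: mult.commute)
      qed
      then have "norm (\<psi> f) \<le> 0" by (rule field_le_epsilon)
      then show ?thesis by simp
    qed
    then have "null V" using V by (simp add: null_def)
    then show False using V(3) \<open>y \<in> U \<inter> - N\<close> by (auto simp: N_def)
  qed
  then have N: "N = UNIV" by blast
  have "norm (\<psi> f) \<le> 0 + e" if e: "e > 0" for e
  proof -
    obtain d where d: "d > 0" "(2 * norm \<phi>) * d \<le> e" using ex_pos_mult_le[OF e] by blast
    obtain C where C: "compact C" "\<forall>x. x \<notin> C \<longrightarrow> norm (c0_apply f x) < d"
      using vanishes_c0[of f] d(1) unfolding vanishes_at_infinity_def by blast
    obtain V where V: "compact V" "open V" "C \<subseteq> V"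
      using ex_compact_open_superset[OF C(1)] by blast
    have cV: "closed V" using V by (simp add: compact_imp_closed)
    have "\<psi> (c0_cut V f) = 0"
      using null_sub[OF V(1,2)] N c0_supported_cut[OF V(2) cV, of f] by (auto simp: null_def)
    then have "\<psi> f = \<psi> (f - c0_cut V f)"
      using add[of "c0_cut V f" "f - c0_cut V f"] by simp
    also have "norm \<dots> \<le> 2 * norm \<phi> * norm (f - c0_cut V f)" by (rule bound)
    also have "\<dots> \<le> 2 * norm \<phi> * d"
      using C(2) V(3) d(1)
      by (intro mult_left_mono norm_c0_diff_cut_le V(2) cV) (auto intro: less_imp_le)
    finally show ?thesis using d(2) by simp
  qed
  then have "norm (\<psi> f) \<le> 0" by (rule field_le_epsilon)
  then have "c0_dual_apply \<phi> f = (\<Sum>\<^sub>\<infinity>y. atom \<phi> y * c0_apply f y)" by (simp add: \<psi>_def)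
  then show ?thesis using sm[of f UNIV] by simp
qed

end

section \<open>An upper bound for the essential norm of an adjoint\<close>

lemma c0_dual_scale_add_left: "c0_dual_scale (c + d) \<phi> = c0_dual_scale c \<phi> + c0_dual_scale d \<phi>"
  by (rule c0_dual_eqI) (simp add: c0_dual_apply_scale plus_c0_dual.rep_eq blinfun.add_left algebra_simps)

lemma scaleR_c0_dual_eq_scale: "r *\<^sub>R \<phi> = c0_dual_scale (of_real r) \<phi>"
  by (rule c0_dual_eqI) (simp add: c0_dual_apply_scale scaleR_c0_dual.rep_eq scaleR_blinfun.rep_eq scaleR_conv_of_real)

lemma compact_dual_ops_sum:
  "(\<And>i. i \<in> I \<Longrightarrow> S i \<in> compact_dual_ops) \<Longrightarrow> (\<Sum>i\<in>I. S i) \<in> compact_dual_ops"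
proof (induction I rule: infinite_finite_induct)
  case (insert i I)
  then show ?case
    by (auto simp: compact_dual_ops_def compact_operator_add blinfun.add_left c0_dual_scale_add)
qed (auto simp: zero_compact_dual_ops)

lemma c0_dual_apply_sum: "c0_dual_apply (\<Sum>i\<in>I. \<phi> i) f = (\<Sum>i\<in>I. c0_dual_apply (\<phi> i) f)"
  by (induction I rule: infinite_finite_induct)
     (auto simp: zero_c0_dual.rep_eq plus_c0_dual.rep_eq blinfun.add_left)

context scattered_lc
begin

text \<open>
  The rank-one operator that maps a functional \<open>\<phi>\<close> to the part of \<open>T\<^sup>* \<phi>\<close> concentrated at \<open>y\<close>.
\<close>

definition atom_proj ::
    "('k, 's::{real_normed_field, banach}) c0_op \<Rightarrow> 'k \<Rightarrow> ('k, 's) c0_dual \<Rightarrow>\<^sub>L ('k, 's) c0_dual"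
  where "atom_proj T y = Blinfun (\<lambda>\<phi>. c0_dual_scale (atom (c0_adjoint T \<phi>) y) (c0_delta y))"

lemma norm_atom_adjoint_le: "norm (atom (c0_adjoint T \<phi>) y) \<le> norm \<phi> * norm (c0_adjoint T)"
  for T :: "('k, 's::{real_normed_field, banach}) c0_op"
  using norm_atom_le[of "c0_adjoint T \<phi>" y] norm_blinfun[of "c0_adjoint T" \<phi>]
  by (simp add: mult.commute)

lemma atom_proj_apply: "atom_proj T y \<phi> = c0_dual_scale (atom (c0_adjoint T \<phi>) y) (c0_delta y)"
  for T :: "('k, 's::{real_normed_field, banach}) c0_op"
  unfolding atom_proj_def
proof (subst bounded_linear_Blinfun_apply)
  show "bounded_linear (\<lambda>\<phi>. c0_dual_scale (atom (c0_adjoint T \<phi>) y) (c0_delta y))"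
  proof (rule bounded_linear_intro[where K = "norm (c0_adjoint T)"])
    fix \<phi> \<psi> :: "('k, 's) c0_dual" and r :: real
    show "c0_dual_scale (atom (c0_adjoint T (\<phi> + \<psi>)) y) (c0_delta y) =
      c0_dual_scale (atom (c0_adjoint T \<phi>) y) (c0_delta y) + c0_dual_scale (atom (c0_adjoint T \<psi>) y) (c0_delta y)"
      by (simp add: blinfun.add_right atom_add c0_dual_scale_add_left)
    show "c0_dual_scale (atom (c0_adjoint T (r *\<^sub>R \<phi>)) y) (c0_delta y) =
      r *\<^sub>R c0_dual_scale (atom (c0_adjoint T \<phi>) y) (c0_delta y)"
      by (simp add: scaleR_c0_dual_eq_scale c0_adjoint_scale atom_scale c0_dual_scale_scale)
    have "norm (c0_dual_scale (atom (c0_adjoint T \<phi>) y) (c0_delta y)) \<le>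
        norm (atom (c0_adjoint T \<phi>) y) * norm (c0_delta y :: ('k, 's) c0_dual)"
      by (rule norm_c0_dual_scale_le)
    also have "\<dots> \<le> (norm \<phi> * norm (c0_adjoint T)) * 1"
      by (intro mult_mono norm_atom_adjoint_le norm_c0_delta_le) auto
    finally show "norm (c0_dual_scale (atom (c0_adjoint T \<phi>) y) (c0_delta y)) \<le> norm \<phi> * norm (c0_adjoint T)"
      by simp
  qed
qed simp

lemma atom_proj_compact: "atom_proj T y \<in> compact_dual_ops"
  for T :: "('k, 's::{real_normed_field, banach, heine_borel}) c0_op"
  unfolding compact_dual_ops_def
proof (intro CollectI conjI allI)
  show "atom_proj T y (c0_dual_scale c \<phi>) = c0_dual_scale c (atom_proj T y \<phi>)" for c \<phi>
    by (simp add: atom_proj_apply c0_adjoint_scale atom_scale c0_dual_scale_scale)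
  define D where "D = norm (c0_adjoint T)"
  have "continuous_on (cball 0 D) (\<lambda>c. c0_dual_scale c (c0_delta y :: ('k, 's) c0_dual))"
  proof (rule linear_continuous_on, rule bounded_linear_intro[where K = 1])
    fix c d :: 's and r :: real
    show "c0_dual_scale (c + d) (c0_delta y :: ('k, 's) c0_dual) = c0_dual_scale c (c0_delta y) + c0_dual_scale d (c0_delta y)"
      by (rule c0_dual_scale_add_left)
    show "c0_dual_scale (r *\<^sub>R c) (c0_delta y :: ('k, 's) c0_dual) = r *\<^sub>R c0_dual_scale c (c0_delta y)"
      by (simp add: scaleR_c0_dual_eq_scale c0_dual_scale_scale scaleR_conv_of_real)
    show "norm (c0_dual_scale c (c0_delta y :: ('k, 's) c0_dual)) \<le> norm c * 1"
      by (rule order.trans[OF norm_c0_dual_scale_le]) (intro mult_left_mono norm_c0_delta_le norm_ge_zero)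
  qed
  then have "compact ((\<lambda>c. c0_dual_scale c (c0_delta y :: ('k, 's) c0_dual)) ` cball 0 D)"
    by (rule compact_continuous_image) simp
  moreover have "atom_proj T y \<phi> \<in> (\<lambda>c. c0_dual_scale c (c0_delta y)) ` cball 0 D" if "norm \<phi> \<le> 1" for \<phi>
  proof -
    have "norm (atom (c0_adjoint T \<phi>) y) \<le> D"
      using norm_atom_adjoint_le[of T \<phi> y] mult_right_mono[OF that, of D] by (simp add: D_def)
    then show ?thesis by (auto simp: atom_proj_apply)
  qed
  ultimately show "compact_operator (atom_proj T y)"
    unfolding compact_operator_iff by blast
qed

text \<open>
  Subtracting from \<open>T\<^sup>* \<phi>\<close> its atoms in \<open>F\<close> leaves a functional which, up to an arbitrarily small error, only sees
  the part of a function off a small neighbourhood of \<open>F\<close>.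
\<close>

theorem ess_adjoint_le_if_vanishing:
  fixes T :: "('k, 's::{real_normed_field, banach, heine_borel}) c0_op"
  assumes F: "finite F" and b: "0 \<le> b"
    and T: "\<And>f. (\<And>y. y \<in> F \<Longrightarrow> c0_apply f y = 0) \<Longrightarrow> norm (c0_op_apply T f) \<le> b * norm f"
  shows "ess (c0_adjoint T) \<le> b"
proof (rule ess_le)
  define S where "S = (\<Sum>y\<in>F. atom_proj T y)"
  show "S \<in> compact_dual_ops"
    unfolding S_def by (rule compact_dual_ops_sum) (rule atom_proj_compact)
  show "norm (c0_adjoint T - S) \<le> b"
  proof (rule norm_blinfun_bound[OF b], rule norm_c0_dual_leI)
    fix \<phi> :: "('k, 's) c0_dual" and f :: "('k, 's) c0"
    show "0 \<le> b * norm \<phi>" using b by simp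
    define \<psi> where "\<psi> = c0_adjoint T \<phi>"
    have eq: "c0_dual_apply (blinfun_apply (c0_adjoint T - S) \<phi>) f
        = c0_dual_apply \<psi> f - (\<Sum>y\<in>F. atom \<psi> y * c0_apply f y)"
      by (simp add: S_def \<psi>_def blinfun.diff_left minus_c0_dual.rep_eq blinfun.sum_left
          c0_dual_apply_sum atom_proj_apply c0_dual_apply_scale)
    show "norm (c0_dual_apply (blinfun_apply (c0_adjoint T - S) \<phi>) f) \<le> b * norm \<phi> * norm f"
    proof (rule field_le_epsilon)
      fix e :: real assume "e > 0"
      then obtain d where d: "d > 0" "(real (card F) * norm f) * d \<le> e" using ex_pos_mult_le by blast
      have "\<forall>y. \<exists>U. open U \<and> y \<in> U \<and> (\<forall>f. c0_supported U f \<longrightarrow>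
          norm (c0_dual_apply \<psi> f - atom \<psi> y * c0_apply f y) \<le> d * norm f)"
        using has_atom_atom[of \<psi>] d(1) unfolding has_atom_def by blast
      then obtain U where U: "\<And>y. open (U y) \<and> y \<in> U y"
        "\<And>y f. c0_supported (U y) f \<Longrightarrow> norm (c0_dual_apply \<psi> f - atom \<psi> y * c0_apply f y) \<le> d * norm f"
        by metis
      obtain W where W: "\<And>y. y \<in> F \<Longrightarrow> compact (W y) \<and> open (W y) \<and> y \<in> W y \<and> W y \<subseteq> U y"
        "\<And>y z. y \<in> F \<Longrightarrow> z \<in> F \<Longrightarrow> y \<noteq> z \<Longrightarrow> W y \<inter> W z = {}"
        using ex_disjoint_compact_open[OF F U(1)] by metis
      define V where "V = (\<Union>y\<in>F. W y)"
      have V: "open V" "closed V"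
        using W(1) F unfolding V_def by (auto intro!: compact_UN compact_imp_closed)
      have cW: "open (W y)" "closed (W y)" if "y \<in> F" for y
        using W(1)[OF that] by (auto intro: compact_imp_closed)
      have cV: "open (- V)" "closed (- V)" using V by auto
      have split: "f = c0_cut (- V) f + (\<Sum>y\<in>F. c0_cut (W y) f)"
      proof (rule c0_eqI)
        fix x
        have "(\<Sum>y\<in>F. c0_apply (c0_cut (W y) f) x) = (if x \<in> V then c0_apply f x else 0)"
        proof (cases "x \<in> V")
          case True
          then obtain y where y: "y \<in> F" "x \<in> W y" by (auto simp: V_def)
          have "(\<Sum>z\<in>F. c0_apply (c0_cut (W z) f) x) = (\<Sum>z\<in>F. if z = y then c0_apply f x else 0)"
            using y W(2)[OF y(1)] cW by (intro sum.cong) (auto simp: c0_cut_apply)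
          then show ?thesis using y F True by simp
        next
          case False
          then show ?thesis using cW by (auto simp: V_def c0_cut_apply intro!: sum.neutral)
        qed
        then show "c0_apply f x = c0_apply (c0_cut (- V) f + (\<Sum>y\<in>F. c0_cut (W y) f)) x"
          using cV by (simp add: plus_c0.rep_eq c0_apply_sum c0_cut_apply)
      qed
      have 1: "norm (c0_dual_apply \<psi> (c0_cut (- V) f)) \<le> b * norm \<phi> * norm f"
      proof -
        have "norm (c0_op_apply T (c0_cut (- V) f)) \<le> b * norm (c0_cut (- V) f)"
        proof (rule T)
          fix y assume "y \<in> F"
          then have "y \<in> V" using W(1) unfolding V_def by blast
          then show "c0_apply (c0_cut (- V) f) y = 0" by (simp add: c0_cut_apply[OF cV])
        qed
        also have "\<dots> \<le> b * norm f" using b by (intro mult_left_mono norm_c0_cut_le cV)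
        finally have "norm (c0_op_apply T (c0_cut (- V) f)) \<le> b * norm f" .
        from mult_left_mono[OF this, of "norm \<phi>"] show ?thesis
          using norm_c0_dual_apply_le[of \<phi> "c0_op_apply T (c0_cut (- V) f)"]
          by (simp add: \<psi>_def c0_adjoint_apply mult_ac)
      qed
      have 2: "norm (\<Sum>y\<in>F. c0_dual_apply \<psi> (c0_cut (W y) f) - atom \<psi> y * c0_apply f y) \<le> (\<Sum>y\<in>F. d * norm f)"
      proof (rule order.trans[OF norm_sum], rule sum_mono)
        fix y assume y: "y \<in> F"
        have "c0_apply (c0_cut (W y) f) y = c0_apply f y" using W(1)[OF y] cW[OF y] by (simp add: c0_cut_apply)
        moreover have "c0_supported (U y) (c0_cut (W y) f)"
          using c0_supported_mono[OF c0_supported_cut[OF cW[OF y]]] W(1)[OF y] by blast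
        ultimately have "norm (c0_dual_apply \<psi> (c0_cut (W y) f) - atom \<psi> y * c0_apply f y) \<le> d * norm (c0_cut (W y) f)"
          using U(2)[of y "c0_cut (W y) f"] by simp
        also have "\<dots> \<le> d * norm f" using d by (intro mult_left_mono norm_c0_cut_le cW y) auto
        finally show "norm (c0_dual_apply \<psi> (c0_cut (W y) f) - atom \<psi> y * c0_apply f y) \<le> d * norm f" .
      qed
      have "c0_dual_apply \<psi> f = c0_dual_apply \<psi> (c0_cut (- V) f) + (\<Sum>y\<in>F. c0_dual_apply \<psi> (c0_cut (W y) f))"
        by (subst (1) split) (simp add: blinfun.add_right blinfun.sum_right)
      then have split2: "c0_dual_apply \<psi> f - (\<Sum>y\<in>F. atom \<psi> y * c0_apply f y) = c0_dual_apply \<psi> (c0_cut (- V) f)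
          + (\<Sum>y\<in>F. c0_dual_apply \<psi> (c0_cut (W y) f) - atom \<psi> y * c0_apply f y)"
        by (simp add: sum_subtractf)
      have "(\<Sum>y\<in>F. d * norm f) \<le> e" using d(2) by (simp add: mult_ac)
      then show "norm (c0_dual_apply (blinfun_apply (c0_adjoint T - S) \<phi>) f) \<le> b * norm \<phi> * norm f + e"
        unfolding eq split2 using 1 2
        by (intro order.trans[OF norm_triangle_ineq] add_mono) auto
    qed
  qed
qed

end

section \<open>The gliding hump\<close>

lemma summable_mass_diff:
  assumes "summable_mass a" "summable_mass b"
  shows "summable_mass (\<lambda>y. a y - b y)"
  by (rule Infinite_Sum.abs_summable_on_comparison_test'[OF summable_on_add[OF assms]])
     (rule norm_triangle_ineq4)

lemma mass_diff_le:
  assumes "summable_mass a" "summable_mass b"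
  shows "mass (\<lambda>y. a y - b y) A \<le> mass a A + mass b A"
proof -
  have "mass (\<lambda>y. a y - b y) A \<le> (\<Sum>\<^sub>\<infinity>y\<in>A. norm (a y) + norm (b y))"
    unfolding mass_def
    by (rule infsum_mono[OF summable_mass_on[OF summable_mass_diff[OF assms]]
          summable_on_add[OF summable_mass_on[OF assms(1)] summable_mass_on[OF assms(2)]]])
       (rule norm_triangle_ineq4)
  also have "\<dots> = mass a A + mass b A"
    unfolding mass_def by (rule infsum_add[OF summable_mass_on[OF assms(1)] summable_mass_on[OF assms(2)]])
  finally show ?thesis .
qed

lemma mass_le_diff:
  assumes "summable_mass a" "summable_mass b"
  shows "mass a A \<le> mass (\<lambda>y. a y - b y) A + mass b A"
proof -
  have "mass b A = mass (\<lambda>y. - b y) A" by (simp add: mass_def)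
  moreover have "mass a A \<le> mass (\<lambda>y. a y - b y) A + mass (\<lambda>y. - b y) A"
    using mass_diff_le[OF summable_mass_diff[OF assms], of "\<lambda>y. - b y" A] assms(2) by simp
  ultimately show ?thesis by simp
qed

lemma sum_mass_disjoint:
  assumes "summable_mass a" "finite I" "\<And>i j. i \<in> I \<Longrightarrow> j \<in> I \<Longrightarrow> i \<noteq> j \<Longrightarrow> A i \<inter> A j = {}"
  shows "(\<Sum>i\<in>I. mass a (A i)) = mass a (\<Union>i\<in>I. A i)"
  unfolding mass_def by (rule sum_infsum[OF assms(2) summable_mass_on[OF assms(1)] assms(3)])

text \<open>
  The value at \<open>f\<close> of the functional with point masses \<open>a\<close>.
\<close>

definition pairing :: "('k \<Rightarrow> 's) \<Rightarrow> ('k::topological_space, 's::{real_normed_field, banach}) c0 \<Rightarrow> 's"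
  where "pairing a f = (\<Sum>\<^sub>\<infinity>y. a y * c0_apply f y)"

lemma pairing_scale: "pairing a (c0_scale c f) = c * pairing a f"
proof -
  have "pairing a (c0_scale c f) = (\<Sum>\<^sub>\<infinity>y. c * (a y * c0_apply f y))"
    unfolding pairing_def c0_apply_scale by (simp only: mult_ac)
  then show ?thesis unfolding pairing_def by (simp only: infsum_cmult_right')
qed

lemma norm_pairing_le:
  assumes "summable_mass a" "norm f \<le> 1" "c0_supported U f"
  shows "norm (pairing a f) \<le> mass a U"
proof -
  have "norm (pairing a f) \<le> 1 * mass a U"
    unfolding pairing_def
    by (rule norm_infsum_pairing_le)
       (use assms order.trans[OF norm_c0_apply_le] in \<open>auto simp: c0_supported_def\<close>)
  then show ?thesis by simp
qed

text \<open>
  Functions of norm at most \<open>1\<close>, at most one of which is nonzero at any given point.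
\<close>

definition disjoint_family_c0 :: "(nat \<Rightarrow> ('k::topological_space, 's::real_normed_field) c0) \<Rightarrow> bool"
  where "disjoint_family_c0 g \<longleftrightarrow> (\<forall>n. norm (g n) \<le> 1) \<and>
    (\<forall>m n w. m \<noteq> n \<longrightarrow> c0_apply (g m) w = 0 \<or> c0_apply (g n) w = 0)"

text \<open>
  Absolutely summable families \<open>a m\<close> that tend weak-* to \<open>b\<close>, each carried up to \<open>\<epsilon>\<close> by a finite set \<open>G m\<close>, and
  each with mass at least \<open>c\<close> off the sets \<open>G i\<close> of its predecessors. The limit \<open>b\<close> is carried up to \<open>\<epsilon>\<close> by \<open>H\<close>.
\<close>

locale gliding_hump = scattered_lc K
  for K :: "'k::t2_space itself" +
  fixes a :: "nat \<Rightarrow> 'k \<Rightarrow> 's::{real_normed_field, banach}" and b :: "'k \<Rightarrow> 's"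
    and G :: "nat \<Rightarrow> 'k set" and H :: "'k set" and D c \<epsilon> :: real
  assumes sa: "\<And>m. summable_mass (a m)" and sb: "summable_mass b"
    and D: "\<And>m. mass (a m) UNIV \<le> D"
    and lim: "\<And>f :: ('k, 's) c0. (\<lambda>m. pairing (\<lambda>y. a m y - b y) f) \<longlonglongrightarrow> 0"
    and fG: "\<And>m. finite (G m)" and fH: "finite H"
    and tail_a: "\<And>m. mass (a m) (- G m) \<le> \<epsilon>" and tail_b: "mass b (- H) \<le> \<epsilon>"
    and escape: "\<And>m. c \<le> mass (a m) (- (\<Union>i<m. G i))"
    and eps: "0 < \<epsilon>" "5 * \<epsilon> < c"
begin

text \<open>
  The weak-* null sequence of differences.
\<close>

definition \<nu> where "\<nu> m = (\<lambda>y. a m y - b y)"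

text \<open>
  The new part of \<open>G m\<close>, on which \<open>a m\<close> still has mass at least \<open>c - \<epsilon>\<close>. These sets are pairwise disjoint.
\<close>

definition F where "F m = G m - (\<Union>i<m. G i)"

text \<open>
  The finite set that a neighbourhood of points of \<open>F m\<close> has to avoid otherwise.
\<close>

definition J where "J m = H \<union> (\<Union>i\<le>m. G i)"

lemma summable_mass_\<nu>: "summable_mass (\<nu> m)"
  unfolding \<nu>_def by (rule summable_mass_diff[OF sa sb])

lemma finite_F: "finite (F m)" and finite_J: "finite (J m)"
  using fG fH by (auto simp: F_def J_def)

lemma F_disjoint: "m \<noteq> n \<Longrightarrow> F m \<inter> F n = {}"
  unfolding F_def by (cases m n rule: linorder_cases) auto

lemma mass_\<nu>_tail: "mass (\<nu> m) (- (G m \<union> H)) \<le> 2 * \<epsilon>"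
proof -
  have "mass (\<nu> m) (- (G m \<union> H)) \<le> mass (a m) (- (G m \<union> H)) + mass b (- (G m \<union> H))"
    unfolding \<nu>_def by (rule mass_diff_le[OF sa sb])
  also have "\<dots> \<le> mass (a m) (- G m) + mass b (- H)"
    by (intro add_mono mass_mono sa sb) auto
  finally show ?thesis using tail_a[of m] tail_b by simp
qed

lemma mass_a_F: "c - \<epsilon> \<le> mass (a m) (F m)"
proof -
  have "mass (a m) (- (\<Union>i<m. G i)) \<le> mass (a m) (F m \<union> - G m)"
    by (intro mass_mono sa) (auto simp: F_def)
  also have "\<dots> \<le> mass (a m) (F m) + mass (a m) (- G m)" by (rule mass_Un_le[OF sa])
  finally show ?thesis using escape[of m] tail_a[of m] by simp
qed

text \<open>
  Some \<open>F n\<close> has a neighbourhood that carries little of \<open>a m\<close> for infinitely many \<open>m\<close>. Otherwise choose disjoint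
  neighbourhoods of \<open>k\<close> of these sets: for almost all \<open>m\<close>, each of them carries mass greater than \<open>\<eta>\<close> of \<open>a m\<close>,
  which exceeds the total mass \<open>D\<close> if \<open>k\<close> is large. The compact set \<open>W\<close> stands for the supports chosen before.
\<close>

lemma ex_sparse_nhd:
  assumes N: "infinite N" and W: "compact W" and \<eta>: "0 < \<eta>"
  shows "\<exists>n\<in>N. \<exists>U. open U \<and> F n - W \<subseteq> U \<and> U \<inter> W = {} \<and> infinite {m \<in> N. mass (a m) U \<le> \<eta>}"
proof (rule ccontr)
  assume neg: "\<not> ?thesis"
  obtain k where k: "D < real k * \<eta>" using reals_Archimedean3[OF \<eta>] by blast
  obtain I where I: "finite I" "card I = k" "I \<subseteq> N"
    using infinite_arbitrarily_large[OF N] by blast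
  define S where "S = (\<Union>n\<in>I. F n - W)"
  have "finite S" using I finite_F by (auto simp: S_def)
  moreover have "open (- W) \<and> y \<in> - W" if "y \<in> S" for y
    using that W by (auto simp: S_def compact_imp_closed)
  ultimately obtain Q where Q: "\<And>y. y \<in> S \<Longrightarrow> compact (Q y) \<and> open (Q y) \<and> y \<in> Q y \<and> Q y \<subseteq> - W"
    "\<And>y z. y \<in> S \<Longrightarrow> z \<in> S \<Longrightarrow> y \<noteq> z \<Longrightarrow> Q y \<inter> Q z = {}"
    using ex_disjoint_compact_open[of S "\<lambda>_. - W"] by metis
  define U where "U n = (\<Union>y\<in>F n - W. Q y)" for n
  have FS: "F n - W \<subseteq> S" if "n \<in> I" for n using that by (auto simp: S_def)
  have U: "open (U n)" "F n - W \<subseteq> U n" "U n \<inter> W = {}" if "n \<in> I" for n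
    using Q(1) FS[OF that] unfolding U_def by (auto intro!: open_UN)
  have disj: "U m \<inter> U n = {}" if mn: "m \<in> I" "n \<in> I" "m \<noteq> n" for m n
  proof -
    have "Q y \<inter> Q z = {}" if "y \<in> F m - W" "z \<in> F n - W" for y z
      using Q(2)[of y z] FS[OF mn(1)] FS[OF mn(2)] F_disjoint[OF mn(3)] that by blast
    then show ?thesis unfolding U_def by blast
  qed
  have "finite {m \<in> N. mass (a m) (U n) \<le> \<eta>}" if "n \<in> I" for n
    using neg U[OF that] I(3) that by blast
  then have "finite (\<Union>n\<in>I. {m \<in> N. mass (a m) (U n) \<le> \<eta>})"
    using I(1) by simp
  then have "infinite (N - (\<Union>n\<in>I. {m \<in> N. mass (a m) (U n) \<le> \<eta>}))"
    using N by (rule Diff_infinite_finite)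
  then have "N - (\<Union>n\<in>I. {m \<in> N. mass (a m) (U n) \<le> \<eta>}) \<noteq> {}" by (rule infinite_imp_nonempty)
  then obtain m where "m \<in> N" "m \<notin> (\<Union>n\<in>I. {m \<in> N. mass (a m) (U n) \<le> \<eta>})" by blast
  then have m: "m \<in> N" "\<And>n. n \<in> I \<Longrightarrow> \<eta> < mass (a m) (U n)" by (auto simp: not_le)
  have "real k * \<eta> \<le> (\<Sum>n\<in>I. mass (a m) (U n))"
    using sum_mono[of I "\<lambda>_. \<eta>" "\<lambda>n. mass (a m) (U n)"] m(2) I(2) by (simp add: less_imp_le)
  also have "\<dots> = mass (a m) (\<Union>n\<in>I. U n)" by (rule sum_mass_disjoint[OF sa I(1) disj])
  also have "\<dots> \<le> D" using mass_mono[OF sa, of "\<Union>n\<in>I. U n" UNIV m] D[of m] by simp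
  finally show False using k by simp
qed

text \<open>
  A step function that has the phases of \<open>\<nu> n\<close> near the points of \<open>F n - W\<close>. Of the mass \<open>c\<close>, the error terms
  \<open>mass (a n) (- G n)\<close>, \<open>mass (a n) W\<close> and \<open>mass b (F n)\<close> cost \<open>\<epsilon>\<close> each, and the mass of \<open>\<nu> n\<close> off
  \<open>G n \<union> H\<close> costs \<open>2 * \<epsilon>\<close>. A scalar factor of norm at most \<open>1\<close> makes the pairing exactly \<open>c - 5 * \<epsilon>\<close>.
\<close>

lemma ex_bump:
  assumes W: "mass (a n) W \<le> \<epsilon>" and U: "open U" "F n - W \<subseteq> U" and FH: "F n \<inter> H = {}"
  shows "\<exists>V g. compact V \<and> open V \<and> V \<subseteq> U \<and> V \<inter> J n \<subseteq> F n \<and> c0_supported V g \<and> norm g \<le> 1 \<and>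
    pairing (\<nu> n) g = of_real (c - 5 * \<epsilon>)"
proof -
  define E where "E = F n - W"
  have fE: "finite E" using finite_F by (simp add: E_def)
  have "open (U - (J n - {y})) \<and> y \<in> U - (J n - {y})" if "y \<in> E" for y
    using that U finite_J by (auto simp: E_def intro!: open_Diff finite_imp_closed)
  then obtain Q where Q: "\<And>y. y \<in> E \<Longrightarrow> compact (Q y) \<and> open (Q y) \<and> y \<in> Q y \<and> Q y \<subseteq> U - (J n - {y})"
    "\<And>y z. y \<in> E \<Longrightarrow> z \<in> E \<Longrightarrow> y \<noteq> z \<Longrightarrow> Q y \<inter> Q z = {}"
    using ex_disjoint_compact_open[OF fE, of "\<lambda>y. U - (J n - {y})"] by metis
  define V where "V = (\<Union>y\<in>E. Q y)"
  have V: "compact V" "open V" "V \<subseteq> U" "V \<inter> J n \<subseteq> E"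
    using Q(1) fE unfolding V_def by (auto intro!: compact_UN open_UN)
  define g where "g = c0_step E Q (\<lambda>y. phase (\<nu> n y))"
  have Qco: "\<And>y. y \<in> E \<Longrightarrow> compact (Q y) \<and> open (Q y)" using Q(1) by blast
  have g1: "norm g \<le> 1"
    unfolding g_def by (rule norm_c0_step_le[OF fE Qco Q(2)]) (auto simp: norm_phase_le)
  have gV: "c0_supported V g"
    unfolding c0_supported_def g_def V_def by (auto intro!: c0_step_out[OF fE Qco Q(2)])
  have gE: "c0_apply g y = phase (\<nu> n y)" if "y \<in> E" for y
    unfolding g_def using that Q(1) by (intro c0_step_in[OF fE Qco Q(2)]) auto
  have sm: "(\<lambda>y. \<nu> n y * c0_apply g y) summable_on A" for A
    by (rule summable_pairing[OF summable_mass_\<nu> norm_c0_apply_le])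
  have "pairing (\<nu> n) g = (\<Sum>y\<in>E. \<nu> n y * c0_apply g y) + (\<Sum>\<^sub>\<infinity>y\<in>- E. \<nu> n y * c0_apply g y)"
    using infsum_Un_disjoint[OF sm[of E] sm[of "- E"]] fE by (simp add: pairing_def)
  also have "(\<Sum>y\<in>E. \<nu> n y * c0_apply g y) = of_real (mass (\<nu> n) E)"
    using gE fE by (simp add: mass_finite phase_mult mult.commute[of _ "phase _"])
  finally have eq: "pairing (\<nu> n) g = of_real (mass (\<nu> n) E) + (\<Sum>\<^sub>\<infinity>y\<in>- E. \<nu> n y * c0_apply g y)" .
  have "norm (\<Sum>\<^sub>\<infinity>y\<in>- E. \<nu> n y * c0_apply g y) \<le> 1 * mass (\<nu> n) (- (G n \<union> H))"
  proof (rule norm_infsum_pairing_le[OF summable_mass_\<nu>])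
    show "norm (c0_apply g z) \<le> 1" for z using norm_c0_apply_le[of g z] g1 by simp
    show "c0_apply g z = 0" if "z \<in> - E - - (G n \<union> H)" for z
      using that gV V(4) unfolding c0_supported_def J_def by blast
  qed
  then have rest: "norm (\<Sum>\<^sub>\<infinity>y\<in>- E. \<nu> n y * c0_apply g y) \<le> 2 * \<epsilon>" using mass_\<nu>_tail[of n] by simp
  have "mass (a n) (F n) \<le> mass (a n) (E \<union> W)" by (intro mass_mono sa) (auto simp: E_def)
  also have "\<dots> \<le> mass (a n) E + mass (a n) W" by (rule mass_Un_le[OF sa])
  finally have "c - 2 * \<epsilon> \<le> mass (a n) E" using mass_a_F[of n] W by simp
  moreover have "mass (a n) E \<le> mass (\<nu> n) E + mass b E" unfolding \<nu>_def by (rule mass_le_diff[OF sa sb])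
  moreover have "mass b E \<le> mass b (- H)" using FH by (intro mass_mono sb) (auto simp: E_def)
  ultimately have "c - 3 * \<epsilon> \<le> mass (\<nu> n) E" using tail_b by simp
  also have "mass (\<nu> n) E = norm (of_real (mass (\<nu> n) E) :: 's)" by (simp add: mass_nonneg)
  also have "\<dots> \<le> norm (pairing (\<nu> n) g) + 2 * \<epsilon>"
    using rest norm_triangle_ineq4[of "pairing (\<nu> n) g" "\<Sum>\<^sub>\<infinity>y\<in>- E. \<nu> n y * c0_apply g y"] by (simp add: eq)
  finally have big: "c - 5 * \<epsilon> \<le> norm (pairing (\<nu> n) g)" by simp
  then have nz: "pairing (\<nu> n) g \<noteq> 0" using eps by auto
  define u where "u = of_real (c - 5 * \<epsilon>) / pairing (\<nu> n) g"
  have u: "norm u \<le> 1"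
    using big nz eps unfolding u_def norm_divide norm_of_real by (simp add: divide_le_eq)
  have "norm (c0_scale u g) \<le> 1"
    by (rule order.trans[OF norm_c0_scale_le]) (use mult_mono[OF u g1] in simp)
  moreover have "pairing (\<nu> n) (c0_scale u g) = of_real (c - 5 * \<epsilon>)"
    using nz by (simp add: pairing_scale u_def)
  moreover have "c0_supported V (c0_scale u g)"
    using gV by (simp add: c0_supported_def c0_apply_scale)
  ultimately show ?thesis using V by (intro exI[of _ V] exI[of _ "c0_scale u g"]) (auto simp: E_def)
qed

text \<open>
  One step of the construction: \<open>N\<close> is the set of indices still available and \<open>W\<close> the union of the supports chosen
  so far. Among the later indices, infinitely many have small mass on the new support, and the pairings with the
  new function are small as \<open>\<nu>\<close> is weak-* null.
\<close>

lemma ex_next_hump: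
  assumes N: "infinite N" "\<And>m. m \<in> N \<Longrightarrow> F m \<inter> H = {}"
    and W: "compact W" "\<And>m. m \<in> N \<Longrightarrow> mass (a m) W \<le> \<epsilon>" and \<eta>: "0 < \<eta>"
  shows "\<exists>n\<in>N. \<exists>V g N'. compact V \<and> open V \<and> V \<inter> W = {} \<and> V \<inter> J n \<subseteq> F n \<and> c0_supported V g \<and>
    norm g \<le> 1 \<and> pairing (\<nu> n) g = of_real (c - 5 * \<epsilon>) \<and> N' \<subseteq> N \<and> infinite N' \<and>
    (\<forall>m\<in>N'. n < m \<and> mass (a m) V \<le> \<eta> \<and> norm (pairing (\<nu> m) g) \<le> \<eta>)"
proof -
  obtain n U where n: "n \<in> N" and U: "open U" "F n - W \<subseteq> U" "U \<inter> W = {}"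
    "infinite {m \<in> N. mass (a m) U \<le> \<eta>}"
    using ex_sparse_nhd[OF N(1) W(1) \<eta>] by blast
  obtain V g where V: "compact V" "open V" "V \<subseteq> U" "V \<inter> J n \<subseteq> F n" "c0_supported V g" "norm g \<le> 1"
    "pairing (\<nu> n) g = of_real (c - 5 * \<epsilon>)"
    using ex_bump[OF W(2)[OF n] U(1,2) N(2)[OF n]] by blast
  have "\<forall>\<^sub>F m in sequentially. norm (pairing (\<nu> m) g) < \<eta>"
    using tendstoD[OF lim[of g] \<eta>] by (simp add: \<nu>_def)
  then obtain M where M: "\<And>m. m \<ge> M \<Longrightarrow> norm (pairing (\<nu> m) g) < \<eta>"
    unfolding eventually_sequentially by blast
  define N' where "N' = {m \<in> N. mass (a m) U \<le> \<eta>} - {..max n M}"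
  have "infinite N'" unfolding N'_def using U(4) by (intro Diff_infinite_finite) auto
  moreover have "n < m \<and> mass (a m) V \<le> \<eta> \<and> norm (pairing (\<nu> m) g) \<le> \<eta>" if "m \<in> N'" for m
    using that M[of m] mass_mono[OF sa V(3), of m] by (auto simp: N'_def less_imp_le)
  moreover have "N' \<subseteq> N" by (auto simp: N'_def)
  ultimately show ?thesis using n V U(3) by (intro bexI[of _ n] exI[of _ V] exI[of _ g] exI[of _ N']) auto
qed

lemma ex_N0: "infinite {m. F m \<inter> H = {}}"
proof -
  have "{m. F m \<inter> H \<noteq> {}} \<subseteq> (\<Union>y\<in>H. {m. y \<in> F m})" by blast
  moreover have "finite (\<Union>y\<in>H. {m. y \<in> F m})"
  proof (rule finite_UN_I[OF fH])
    fix y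
    show "finite {m. y \<in> F m}"
    proof (cases "\<exists>m. y \<in> F m")
      case True
      then obtain m where "y \<in> F m" by blast
      then have "{n. y \<in> F n} \<subseteq> {m}" using F_disjoint by auto
      then show ?thesis by (rule finite_subset) simp
    qed simp
  qed
  ultimately have "finite {m. F m \<inter> H \<noteq> {}}" by (rule finite_subset)
  then have "infinite (UNIV - {m. F m \<inter> H \<noteq> {}})"
    by (rule Diff_infinite_finite) (rule infinite_UNIV_nat)
  also have "UNIV - {m. F m \<inter> H \<noteq> {}} = {m. F m \<inter> H = {}}" by blast
  finally show ?thesis .
qed

text \<open>
  In each row, the pairings with earlier functions sum up to at most \<open>\<epsilon>\<close> by the choice of the indices, and those
  with later functions to at most \<open>2 * \<epsilon>\<close>, because the later supports are disjoint and avoid \<open>G (r k) \<union> H\<close>.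
\<close>

theorem ex_gliding_hump:
  "\<exists>r g. strict_mono r \<and> disjoint_family_c0 g \<and>
    (\<forall>k. pairing (\<nu> (r k)) (g k) = of_real (c - 5 * \<epsilon>)) \<and>
    (\<forall>k N. (\<Sum>j\<in>{..<N} - {k}. norm (pairing (\<nu> (r k)) (g j))) \<le> 3 * \<epsilon>)"
proof -
  \<comment> \<open>A state consists of the available indices \<open>N\<close>, the union \<open>W\<close> of the supports so far, and the index \<open>n\<close>,
    support \<open>V\<close> and function \<open>g\<close> chosen last; the last three are meaningless in the initial state.\<close>
  define P where "P k s \<longleftrightarrow> (case s of (N, W, _) \<Rightarrow> infinite N \<and> (\<forall>m\<in>N. F m \<inter> H = {}) \<and> compact W \<and>
      (\<forall>m\<in>N. mass (a m) W \<le> \<epsilon> * (1 - (1/2)^k)))"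
    for k :: nat and s :: "nat set \<times> 'k set \<times> nat \<times> 'k set \<times> ('k, 's) c0"
  define Q where "Q k s s' \<longleftrightarrow> (case s of (N, W, _) \<Rightarrow> case s' of (N', W', n, V, g) \<Rightarrow>
      n \<in> N \<and> N' \<subseteq> N \<and> W' = W \<union> V \<and> V \<inter> W = {} \<and> V \<inter> J n \<subseteq> F n \<and> c0_supported V g \<and>
      norm g \<le> 1 \<and> pairing (\<nu> n) g = of_real (c - 5 * \<epsilon>) \<and> F n \<inter> H = {} \<and>
      (\<forall>m\<in>N'. n < m \<and> norm (pairing (\<nu> m) g) \<le> \<epsilon> * (1/2)^Suc k))"
    for k :: nat and s s' :: "nat set \<times> 'k set \<times> nat \<times> 'k set \<times> ('k, 's) c0"
  have "\<exists>s. \<forall>k. P k (s k) \<and> Q k (s k) (s (Suc k))"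
  proof (rule dependent_nat_choice)
    show "\<exists>s. P 0 s"
      by (rule exI[of _ "({m. F m \<inter> H = {}}, {}, undefined)"])
         (auto simp: P_def ex_N0 mass_def)
  next
    fix s k assume "P k s"
    obtain N W z where s: "s = (N, W, z)" by (metis surj_pair)
    have P: "infinite N" "\<And>m. m \<in> N \<Longrightarrow> F m \<inter> H = {}" "compact W"
      "\<And>m. m \<in> N \<Longrightarrow> mass (a m) W \<le> \<epsilon> * (1 - (1/2)^k)"
      using \<open>P k s\<close> by (auto simp: P_def s)
    have "\<epsilon> * (1 - (1/2)^k) \<le> \<epsilon> * 1" using eps by (intro mult_left_mono) auto
    then have W: "\<And>m. m \<in> N \<Longrightarrow> mass (a m) W \<le> \<epsilon>" using P(4) by fastforce
    have \<eta>: "0 < \<epsilon> * (1/2)^Suc k" using eps by simp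
    obtain n V g N' where n: "n \<in> N" "compact V" "open V" "V \<inter> W = {}" "V \<inter> J n \<subseteq> F n" "c0_supported V g"
      "norm g \<le> 1" "pairing (\<nu> n) g = of_real (c - 5 * \<epsilon>)" "N' \<subseteq> N" "infinite N'"
      "\<forall>m\<in>N'. n < m \<and> mass (a m) V \<le> \<epsilon> * (1/2)^Suc k \<and> norm (pairing (\<nu> m) g) \<le> \<epsilon> * (1/2)^Suc k"
      using ex_next_hump[OF P(1,2,3) W \<eta>] by blast
    have "mass (a m) (W \<union> V) \<le> \<epsilon> * (1 - (1/2)^Suc k)" if m: "m \<in> N'" for m
    proof -
      have "mass (a m) (W \<union> V) \<le> mass (a m) W + mass (a m) V" by (rule mass_Un_le[OF sa])
      also have "\<dots> \<le> \<epsilon> * (1 - (1/2)^k) + \<epsilon> * (1/2)^Suc k" using P(4) n m by (intro add_mono) auto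
      also have "\<dots> = \<epsilon> * (1 - (1/2)^Suc k)" by (simp add: algebra_simps)
      finally show ?thesis .
    qed
    moreover have "\<forall>m\<in>N'. F m \<inter> H = {}" using P(2) n(9) by blast
    ultimately have "P (Suc k) (N', W \<union> V, n, V, g)"
      unfolding P_def using n(2,10) P(3) by (simp add: compact_Un)
    moreover have "Q k s (N', W \<union> V, n, V, g)" using n P(2) by (auto simp: Q_def s)
    ultimately show "\<exists>s'. P (Suc k) s' \<and> Q k s s'" by blast
  qed
  then obtain s where s: "\<And>k. Q k (s k) (s (Suc k))" by blast
  define N where "N k = fst (s k)" for k
  define W where "W k = fst (snd (s k))" for k
  define r where "r k = fst (snd (snd (s (Suc k))))" for k
  define V where "V k = fst (snd (snd (snd (s (Suc k)))))" for k
  define g where "g k = snd (snd (snd (snd (s (Suc k)))))" for k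
  have Q: "r k \<in> N k" "N (Suc k) \<subseteq> N k" "W (Suc k) = W k \<union> V k" "V k \<inter> W k = {}" "V k \<inter> J (r k) \<subseteq> F (r k)"
      "c0_supported (V k) (g k)" "norm (g k) \<le> 1" "pairing (\<nu> (r k)) (g k) = of_real (c - 5 * \<epsilon>)"
      "F (r k) \<inter> H = {}"
      "\<And>m. m \<in> N (Suc k) \<Longrightarrow> r k < m \<and> norm (pairing (\<nu> m) (g k)) \<le> \<epsilon> * (1/2)^Suc k" for k
    using s[of k] by (auto simp: Q_def N_def W_def r_def V_def g_def split: prod.splits)
  have N_mono: "N k \<subseteq> N j" if "j \<le> k" for j k using Q(2) that by (rule lift_Suc_antimono_le)
  have "W k \<subseteq> W (Suc k)" for k unfolding Q(3) by (rule Un_upper1)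
  then have W_mono: "W j \<subseteq> W k" if "j \<le> k" for j k using that by (rule lift_Suc_mono_le)
  have later: "r j < r k \<and> norm (pairing (\<nu> (r k)) (g j)) \<le> \<epsilon> * (1/2)^Suc j" if "j < k" for j k
    using Q(10)[of "r k" j] Q(1)[of k] N_mono[of "Suc j" k] that by auto
  have r: "strict_mono r" using later by (auto simp: strict_mono_def)
  have V_disj: "V j \<inter> V k = {}" if "j < k" for j k
    using Q(4)[of k] W_mono[of "Suc j" k] that unfolding Q(3)[of j] by auto
  then have V_disj': "V j \<inter> V k = {}" if "j \<noteq> k" for j k
    using that by (metis Int_commute linorder_neqE_nat)
  have "disjoint_family_c0 g"
    unfolding disjoint_family_c0_def using Q(6,7) V_disj' unfolding c0_supported_def by blast
  moreover have "(\<Sum>j\<in>{..<n} - {k}. norm (pairing (\<nu> (r k)) (g j))) \<le> 3 * \<epsilon>" for k n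
  proof -
    let ?p = "\<lambda>j. norm (pairing (\<nu> (r k)) (g j))"
    have "(\<Sum>j<k. ?p j) \<le> (\<Sum>j<k. \<epsilon> * (1/2)^Suc j)" using later by (intro sum_mono) auto
    also have "\<dots> = \<epsilon> * (1 - (1/2)^k)"
      by (induction k) (auto simp: algebra_simps)
    also have "\<dots> \<le> \<epsilon> * 1" using eps by (intro mult_left_mono) auto
    finally have before: "(\<Sum>j<k. ?p j) \<le> \<epsilon>" by simp
    have "(\<Sum>j\<in>{k<..<n}. ?p j) \<le> (\<Sum>j\<in>{k<..<n}. mass (\<nu> (r k)) (V j))"
      by (intro sum_mono norm_pairing_le[OF summable_mass_\<nu> Q(7) Q(6)])
    also have "\<dots> = mass (\<nu> (r k)) (\<Union>j\<in>{k<..<n}. V j)"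
      by (rule sum_mass_disjoint[OF summable_mass_\<nu>]) (auto simp: V_disj')
    also have "\<dots> \<le> mass (\<nu> (r k)) (- (G (r k) \<union> H))"
    proof (rule mass_mono[OF summable_mass_\<nu>])
      show "(\<Union>j\<in>{k<..<n}. V j) \<subseteq> - (G (r k) \<union> H)"
      proof (rule UN_least)
        fix j assume j: "j \<in> {k<..<n}"
        have rj: "r k < r j" using later[of k j] j by simp
        then have "G (r k) \<union> H \<subseteq> J (r j)" by (auto simp: J_def intro: less_imp_le)
        moreover have "F (r j) \<inter> G (r k) = {}" using rj by (auto simp: F_def)
        ultimately show "V j \<subseteq> - (G (r k) \<union> H)" using Q(5)[of j] Q(9)[of j] by blast
      qed
    qed
    also have "\<dots> \<le> 2 * \<epsilon>" by (rule mass_\<nu>_tail)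
    finally have "(\<Sum>j\<in>{k<..<n}. ?p j) \<le> 2 * \<epsilon>" .
    moreover have "(\<Sum>j\<in>{..<n} - {k}. ?p j) \<le> (\<Sum>j\<in>{..<k} \<union> {k<..<n}. ?p j)"
      by (rule sum_mono2) auto
    moreover have "(\<Sum>j\<in>{..<k} \<union> {k<..<n}. ?p j) = (\<Sum>j<k. ?p j) + (\<Sum>j\<in>{k<..<n}. ?p j)"
      by (rule sum.union_disjoint) auto
    ultimately show ?thesis using before by simp
  qed
  ultimately show ?thesis using r Q(8) by blast
qed

end

section \<open>Operators built from a convergent sequence of points\<close>

lemma c0_scale_add_left: "c0_scale (c + d) f = c0_scale c f + c0_scale d f"
  by (rule c0_eqI) (simp add: c0_apply_scale plus_c0.rep_eq algebra_simps)

lemma norm_disjoint_sum_le: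
  assumes g: "disjoint_family_c0 g" and A: "finite A" "\<And>n. n \<in> A \<Longrightarrow> norm (t n) \<le> b" "0 \<le> b"
  shows "norm (\<Sum>n\<in>A. c0_scale (t n) (g n)) \<le> b"
proof (rule norm_c0_le)
  fix w
  show "norm (c0_apply (\<Sum>n\<in>A. c0_scale (t n) (g n)) w) \<le> b"
  proof (cases "\<exists>m\<in>A. c0_apply (g m) w \<noteq> 0")
    case True
    then obtain m where m: "m \<in> A" "c0_apply (g m) w \<noteq> 0" by blast
    have "(\<Sum>n\<in>A. t n * c0_apply (g n) w) = (\<Sum>n\<in>A. if n = m then t m * c0_apply (g m) w else 0)"
      using g m unfolding disjoint_family_c0_def by (intro sum.cong) auto
    then have "c0_apply (\<Sum>n\<in>A. c0_scale (t n) (g n)) w = t m * c0_apply (g m) w"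
      using m A(1) by (simp add: c0_apply_sum c0_apply_scale)
    moreover have "norm (t m * c0_apply (g m) w) \<le> b * 1"
      unfolding norm_mult
    proof (intro mult_mono)
      show "norm (c0_apply (g m) w) \<le> 1"
        using g norm_c0_apply_le[of "g m" w] order.trans unfolding disjoint_family_c0_def by blast
    qed (use A m in auto)
    ultimately show ?thesis by simp
  next
    case False
    then show ?thesis using A(3) by (simp add: c0_apply_sum c0_apply_scale)
  qed
qed

context
  fixes g :: "nat \<Rightarrow> ('k::topological_space, 's::{real_normed_field, banach}) c0"
  assumes g: "disjoint_family_c0 g"
begin

lemma summable_disjoint:
  assumes t: "t \<longlonglongrightarrow> (0::'s)"
  shows "summable (\<lambda>n. c0_scale (t n) (g n))"
  unfolding summable_Cauchy
proof (intro allI impI)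
  fix e :: real assume e: "e > 0"
  then have e2: "e/2 > 0" by simp
  obtain N where N: "\<And>n. n \<ge> N \<Longrightarrow> norm (t n) < e/2"
    using tendstoD[OF t e2] unfolding eventually_sequentially by auto
  have "norm (\<Sum>i\<in>{m..<n}. c0_scale (t i) (g i)) < e" if "m \<ge> N" for m n
  proof -
    have "norm (\<Sum>i\<in>{m..<n}. c0_scale (t i) (g i)) \<le> e/2"
      using e N that by (intro norm_disjoint_sum_le[OF g]) (auto intro: less_imp_le)
    then show ?thesis using e by simp
  qed
  then show "\<exists>N. \<forall>m\<ge>N. \<forall>n. norm (\<Sum>i\<in>{m..<n}. c0_scale (t i) (g i)) < e" by blast
qed

lemma norm_suminf_disjoint_le:
  assumes t: "t \<longlonglongrightarrow> (0::'s)" and b: "\<And>n. norm (t n) \<le> b"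
  shows "norm (\<Sum>n. c0_scale (t n) (g n)) \<le> b"
proof (rule LIMSEQ_le_const2)
  show "(\<lambda>N. norm (\<Sum>n<N. c0_scale (t n) (g n))) \<longlonglongrightarrow> norm (\<Sum>n. c0_scale (t n) (g n))"
    by (intro tendsto_norm summable_LIMSEQ summable_disjoint t)
  have "0 \<le> b" using b norm_ge_zero order.trans by blast
  then show "\<exists>N. \<forall>n\<ge>N. norm (\<Sum>n<n. c0_scale (t n) (g n)) \<le> b"
    using b by (auto intro!: norm_disjoint_sum_le[OF g])
qed

lemma suminf_disjoint_apply:
  assumes t: "t \<longlonglongrightarrow> (0::'s)" and m: "\<And>n. n \<noteq> m \<Longrightarrow> c0_apply (g n) w = 0"
  shows "c0_apply (\<Sum>n. c0_scale (t n) (g n)) w = t m * c0_apply (g m) w"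
proof -
  have "(\<lambda>n. c0_dual_apply (c0_delta w) (c0_scale (t n) (g n))) sums
      c0_dual_apply (c0_delta w) (\<Sum>n. c0_scale (t n) (g n))"
    by (intro bounded_linear.sums[OF blinfun.bounded_linear_right] summable_sums summable_disjoint t)
  moreover have "(\<lambda>n. c0_dual_apply (c0_delta w) (c0_scale (t n) (g n))) sums (t m * c0_apply (g m) w)"
    using sums_finite[of "{m}" "\<lambda>n. t n * c0_apply (g n) w"] m by (simp add: c0_apply_scale)
  ultimately show ?thesis by (simp add: sums_unique2)
qed

end

text \<open>
  The sequence \<open>x\<close> converges in the one-point compactification, as tested by functions in \<open>C\<^sub>0(K)\<close>: either to the
  point \<open>l\<close>, with \<open>\<theta> = 1\<close>, or to infinity, with \<open>\<theta> = 0\<close> and \<open>l\<close> irrelevant.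
\<close>

definition c0_converges ::
    "(nat \<Rightarrow> 'k::topological_space) \<Rightarrow> 's::real_normed_field \<Rightarrow> 'k \<Rightarrow> bool"
  where "c0_converges x \<theta> l \<longleftrightarrow> (\<theta> = 0 \<or> \<theta> = 1) \<and>
    (\<forall>h :: ('k, 's) c0. (\<lambda>n. c0_apply h (x n)) \<longlonglongrightarrow> \<theta> * c0_apply h l)"

text \<open>
  The value of \<open>h\<close> at the \<open>n\<close>-th point minus its limit along the sequence.
\<close>

definition jump :: "(nat \<Rightarrow> 'k::topological_space) \<Rightarrow> 's::real_normed_field \<Rightarrow> 'k \<Rightarrow> ('k, 's) c0 \<Rightarrow> nat \<Rightarrow> 's"
  where "jump x \<theta> l h n = c0_apply h (x n) - \<theta> * c0_apply h l"

lemma jump_tendsto: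
  fixes \<theta> :: "'s::real_normed_field"
  assumes "c0_converges x \<theta> l"
  shows "jump x \<theta> l h \<longlonglongrightarrow> 0"
proof -
  have "(\<lambda>n. c0_apply h (x n)) \<longlonglongrightarrow> \<theta> * c0_apply h l"
    using assms by (simp add: c0_converges_def)
  from tendsto_diff[OF this tendsto_const[of "\<theta> * c0_apply h l"]]
  show ?thesis by (simp add: jump_def[abs_def])
qed

lemma norm_jump_le:
  fixes \<theta> :: "'s::real_normed_field"
  assumes "c0_converges x \<theta> l"
  shows "norm (jump x \<theta> l h n) \<le> 2 * norm h"
proof -
  have "norm (\<theta> * c0_apply h l) \<le> norm h"
    using assms norm_c0_apply_le[of h l] by (auto simp: c0_converges_def)
  then show ?thesis
    using norm_triangle_ineq4[of "c0_apply h (x n)" "\<theta> * c0_apply h l"] norm_c0_apply_le[of h "x n"]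
    by (simp add: jump_def)
qed

text \<open>
  The operator \<open>h \<mapsto> (\<Sum>n. (h (x n) - \<theta> * h l) * g n)\<close> for a disjoint family \<open>g\<close>. The series converges in norm since
  the coefficients tend to \<open>0\<close>.
\<close>

definition jump_op ::
    "(nat \<Rightarrow> ('k::topological_space, 's::{real_normed_field, banach}) c0) \<Rightarrow> (nat \<Rightarrow> 'k) \<Rightarrow> 's \<Rightarrow> 'k \<Rightarrow> ('k, 's) c0_op"
  where "jump_op g x \<theta> l = Abs_c0_op (Blinfun (\<lambda>h. \<Sum>n. c0_scale (jump x \<theta> l h n) (g n)))"

context
  fixes g :: "nat \<Rightarrow> ('k::topological_space, 's::{real_normed_field, banach}) c0"
    and x :: "nat \<Rightarrow> 'k" and \<theta> :: 's and l :: 'k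
  assumes g: "disjoint_family_c0 g" and x: "c0_converges x \<theta> l"
begin

lemma jump_op_apply: "c0_op_apply (jump_op g x \<theta> l) h = (\<Sum>n. c0_scale (jump x \<theta> l h n) (g n))"
proof -
  let ?B = "\<lambda>h. \<Sum>n. c0_scale (jump x \<theta> l h n) (g n)"
  note s = summable_disjoint[OF g jump_tendsto[OF x]]
  have "bounded_linear ?B"
  proof (rule bounded_linear_intro[where K = 2])
    fix h k :: "('k, 's) c0" and r :: real
    have "jump x \<theta> l (h + k) n = jump x \<theta> l h n + jump x \<theta> l k n" for n
      by (simp add: jump_def plus_c0.rep_eq algebra_simps)
    then show "?B (h + k) = ?B h + ?B k"
      using suminf_add[OF s[of h] s[of k]] by (simp add: c0_scale_add_left)
    have "c0_scale (jump x \<theta> l (r *\<^sub>R h) n) (g n) = r *\<^sub>R c0_scale (jump x \<theta> l h n) (g n)" for n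
      by (rule c0_eqI) (simp add: jump_def scaleR_c0.rep_eq c0_apply_scale algebra_simps)
    then show "?B (r *\<^sub>R h) = r *\<^sub>R ?B h"
      using suminf_scaleR_right[OF s[of h], of r] by simp
    show "norm (?B h) \<le> norm h * 2"
      using norm_suminf_disjoint_le[OF g jump_tendsto[OF x] norm_jump_le[OF x]] by (simp add: mult.commute)
  qed
  then have B: "blinfun_apply (Blinfun ?B) = ?B" by (rule bounded_linear_Blinfun_apply)
  have "?B (c0_scale c h) = c0_scale c (?B h)" for c h
  proof -
    have "c0_scale (jump x \<theta> l (c0_scale c h) n) (g n) = c0_scale c (c0_scale (jump x \<theta> l h n) (g n))" for n
      by (rule c0_eqI) (simp add: jump_def c0_apply_scale algebra_simps)
    then show ?thesis
      using bounded_linear.suminf[OF bounded_linear_c0_scale s[of h], of c] by simp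
  qed
  then show ?thesis unfolding jump_op_def by (subst Abs_c0_op_inverse) (auto simp: B)
qed

lemma jump_op_sums: "(\<lambda>n. c0_scale (jump x \<theta> l h n) (g n)) sums c0_op_apply (jump_op g x \<theta> l) h"
  unfolding jump_op_apply by (rule summable_sums[OF summable_disjoint[OF g jump_tendsto[OF x]]])

lemma jump_op_at:
  "(\<And>n. n \<noteq> m \<Longrightarrow> c0_apply (g n) w = 0) \<Longrightarrow>
    c0_apply (c0_op_apply (jump_op g x \<theta> l) h) w = jump x \<theta> l h m * c0_apply (g m) w"
  unfolding jump_op_apply by (rule suminf_disjoint_apply[OF g jump_tendsto[OF x]])

end

lemma c0_op_eqI: "(\<And>f. c0_op_apply S f = c0_op_apply T f) \<Longrightarrow> S = T"
  by (metis blinfun_eqI blinfun_of_c0_op_inject)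

lemma c0_scale_minus_one: "c0_scale (- 1) f = - f"
  by (rule c0_eqI) (simp add: c0_apply_scale uminus_c0.rep_eq)

lemma norm_c0_op_leI:
  assumes "b \<ge> 0" "\<And>f. norm (c0_op_apply T f) \<le> b * norm f" shows "norm T \<le> b"
  unfolding norm_c0_op.rep_eq by (rule norm_blinfun_bound) (use assms in auto)

context scattered_lc
begin

text \<open>
  The norm of the operator may be \<open>2\<close>, but on functions that vanish at \<open>l\<close> it is at most \<open>1\<close>.
\<close>

theorem ess_jump_op_le:
  fixes g :: "nat \<Rightarrow> ('k, 's::{real_normed_field, banach, heine_borel}) c0" and \<theta> :: 's
  assumes g: "disjoint_family_c0 g" and x: "c0_converges x \<theta> l"
  shows "ess (c0_adjoint (jump_op g x \<theta> l)) \<le> 1"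
proof (rule ess_adjoint_le_if_vanishing[of "{l}"])
  fix h :: "('k, 's) c0" assume h: "\<And>y. y \<in> {l} \<Longrightarrow> c0_apply h y = 0"
  show "norm (c0_op_apply (jump_op g x \<theta> l) h) \<le> 1 * norm h"
    unfolding jump_op_apply[OF g x]
  proof (rule order.trans[OF norm_suminf_disjoint_le[OF g jump_tendsto[OF x]]])
    show "norm (jump x \<theta> l h n) \<le> norm h" for n using h by (simp add: jump_def norm_c0_apply_le)
  qed simp
qed auto

lemma ex_convergent_subsequence:
  fixes x :: "nat \<Rightarrow> 'k"
  obtains r :: "nat \<Rightarrow> nat" and \<theta> :: "'s::real_normed_field" and l
  where "strict_mono r" "c0_converges (x \<circ> r) \<theta> l"
proof (rule subsequence_dichotomy[of x])
  fix r :: "nat \<Rightarrow> nat" and l assume r: "strict_mono r" "(x \<circ> r) \<longlonglongrightarrow> l"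
  have "(\<lambda>n. c0_apply h ((x \<circ> r) n)) \<longlonglongrightarrow> c0_apply h l" for h :: "('k, 's) c0"
  proof -
    have "isCont (c0_apply h) l"
      using continuous_c0[of UNIV h] continuous_on_eq_continuous_at[OF open_UNIV] by blast
    from isCont_tendsto_compose[OF this r(2)] show ?thesis .
  qed
  then have "c0_converges (x \<circ> r) (1 :: 's) l" by (simp add: c0_converges_def)
  then show ?thesis using that r(1) by blast
next
  assume fin: "\<And>C. compact C \<Longrightarrow> finite {n. x n \<in> C}"
  have "(\<lambda>n. c0_apply h (x n)) \<longlonglongrightarrow> 0" for h :: "('k, 's) c0"
  proof (rule tendstoI)
    fix e :: real assume "e > 0"
    then obtain C where C: "compact C" "\<forall>x. x \<notin> C \<longrightarrow> norm (c0_apply h x) < e"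
      using vanishes_c0[of h] unfolding vanishes_at_infinity_def by blast
    have "\<forall>\<^sub>F n in sequentially. x n \<notin> C"
      using fin[OF C(1)] by (simp add: eventually_cofinite cofinite_eq_sequentially[symmetric])
    then show "\<forall>\<^sub>F n in sequentially. dist (c0_apply h (x n)) 0 < e"
      by (rule eventually_mono) (use C(2) in simp)
  qed
  then have "c0_converges (x \<circ> id) (0 :: 's) undefined" by (simp add: c0_converges_def)
  then show ?thesis using that[of id 0 undefined] by (simp add: strict_mono_def)
qed

lemma c0_converges_subseq:
  fixes \<theta> :: "'s::real_normed_field" and x :: "nat \<Rightarrow> 'k"
  assumes "c0_converges x \<theta> l" "strict_mono r"
  shows "c0_converges (x \<circ> r) \<theta> l"
  using assms LIMSEQ_subseq_LIMSEQ[OF _ assms(2)] unfolding c0_converges_def by (fastforce simp: comp_def)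

end

text \<open>
  A sequence of distinct isolated points that converges in the one-point compactification. It gives rise to a
  non-compact projection onto a copy of \<open>c\<^sub>0\<close>.
\<close>

locale isolated_sequence =
  fixes z :: "nat \<Rightarrow> 'k::t2_space" and \<theta> :: "'s::{real_normed_field, banach}" and l :: 'k
  assumes inj: "inj z" and iso: "\<And>n. open {z n}" and z: "c0_converges z \<theta> l"
begin

text \<open>
  The unit vectors of this copy of \<open>c\<^sub>0\<close>.
\<close>

definition e :: "nat \<Rightarrow> ('k, 's) c0" where "e n = c0_ind {z n}"

lemma e_apply: "c0_apply (e n) w = (if w = z n then 1 else 0)"
  unfolding e_def using iso by (subst c0_ind_apply) auto

lemma disjoint_e: "disjoint_family_c0 e"
  unfolding disjoint_family_c0_def
  using inj by (auto simp: e_apply inj_eq intro!: norm_c0_le)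

lemma jump_op_e_at:
  assumes "c0_converges x \<theta>' l'"
  shows "c0_apply (c0_op_apply (jump_op e x \<theta>' l') h) (z m) = jump x \<theta>' l' h m"
  using jump_op_at[OF disjoint_e assms, of m "z m" h] inj by (simp add: e_apply inj_eq)

lemma jump_op_e_outside:
  assumes "c0_converges x \<theta>' l'" "w \<notin> range z"
  shows "c0_apply (c0_op_apply (jump_op e x \<theta>' l') h) w = 0"
proof -
  have "w \<noteq> z n" for n using assms(2) by blast
  then show ?thesis
  using jump_op_at[OF disjoint_e assms(1), of 0 w h] by (simp add: e_apply)
qed

text \<open>
  The projection.
\<close>

definition P :: "('k, 's) c0_op" where "P = jump_op e z \<theta> l"

lemma P_idem: "P * P = P"
proof -
  have "c0_op_apply P (c0_op_apply P h) = c0_op_apply P h" for h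
  proof -
    define h' where "h' = c0_op_apply P h"
    have "(\<lambda>n. c0_apply h' (z n)) \<longlonglongrightarrow> \<theta> * c0_apply h' l" using z by (simp add: c0_converges_def)
    moreover have "(\<lambda>n. c0_apply h' (z n)) \<longlonglongrightarrow> 0"
      using jump_tendsto[OF z, of h] by (simp add: h'_def P_def jump_op_e_at[OF z])
    ultimately have 0: "\<theta> * c0_apply h' l = 0" using LIMSEQ_unique by blast
    have "c0_apply (c0_op_apply P h') w = c0_apply h' w" for w
    proof (cases "w \<in> range z")
      case True
      then obtain m where "w = z m" by blast
      then show ?thesis by (simp add: P_def jump_op_e_at[OF z] jump_def 0)
    next
      case False
      then show ?thesis by (simp add: P_def h'_def jump_op_e_outside[OF z])
    qed
    then show ?thesis unfolding h'_def by (rule c0_eqI)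
  qed
  then show ?thesis by (intro c0_op_eqI) (simp add: times_c0_op.rep_eq)
qed

lemma P_e: "c0_op_apply P (e m) = e m"
proof (rule c0_eqI)
  fix w
  have "(\<lambda>n. c0_apply (e m) (z n)) \<longlonglongrightarrow> 0"
  proof (rule tendsto_eventually)
    show "\<forall>\<^sub>F n in sequentially. c0_apply (e m) (z n) = 0"
      using eventually_gt_at_top[of m] by (rule eventually_mono) (use inj in \<open>auto simp: e_apply inj_eq\<close>)
  qed
  moreover have "(\<lambda>n. c0_apply (e m) (z n)) \<longlonglongrightarrow> \<theta> * c0_apply (e m) l"
    using z by (simp add: c0_converges_def)
  ultimately have 0: "\<theta> * c0_apply (e m) l = 0" using LIMSEQ_unique by blast
  show "c0_apply (c0_op_apply P (e m)) w = c0_apply (e m) w"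
  proof (cases "w \<in> range z")
    case True
    then obtain k where "w = z k" by blast
    then show ?thesis by (simp add: P_def jump_op_e_at[OF z] jump_def 0)
  next
    case False
    then show ?thesis by (auto simp: P_def jump_op_e_outside[OF z] e_apply)
  qed
qed

lemma P_not_compact: "\<not> c0_op_compact P"
proof
  assume "c0_op_compact P"
  then have "compact (closure (c0_op_apply P ` cball 0 1))"
    by (simp add: c0_op_compact.rep_eq compact_operator_def)
  moreover have "e n \<in> closure (c0_op_apply P ` cball 0 1)" for n
  proof -
    have "e n \<in> cball 0 1" using disjoint_e by (simp add: disjoint_family_c0_def)
    then have "c0_op_apply P (e n) \<in> c0_op_apply P ` cball 0 1" by (rule imageI)
    then show ?thesis unfolding P_e by (rule subsetD[OF closure_subset])
  qed
  ultimately obtain r q where r: "strict_mono r" "(e \<circ> r) \<longlonglongrightarrow> q"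
    unfolding compact_eq_seq_compact_metric seq_compact_def by blast
  have "Cauchy (e \<circ> r)" using r(2) by (rule LIMSEQ_imp_Cauchy)
  then obtain M where M: "\<And>m n. m \<ge> M \<Longrightarrow> n \<ge> M \<Longrightarrow> dist (e (r m)) (e (r n)) < 1"
    unfolding Cauchy_def comp_def by (metis zero_less_one)
  have "r M \<noteq> r (Suc M)" using r(1) by (metis n_not_Suc_n strict_mono_eq)
  then have "norm (c0_apply (e (r M) - e (r (Suc M))) (z (r M))) = 1"
    using inj by (simp add: minus_c0.rep_eq e_apply inj_eq)
  then have "1 \<le> dist (e (r M)) (e (r (Suc M)))"
    using norm_c0_apply_le[of "e (r M) - e (r (Suc M))" "z (r M)"] by (simp add: dist_norm)
  then show False using M[of M "Suc M"] by simp
qed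

end

text \<open>
  With \<open>A = jump_op e x \<theta>' l'\<close> and \<open>B = jump_op g z \<theta> l\<close>, the product \<open>A T B\<close> is \<open>c P\<close> up to an operator \<open>R\<close> that comes
  from the off-diagonal entries. The coefficients of \<open>B h\<close> are bounded by \<open>2 * norm h\<close>, hence the factor \<open>2\<close>.
\<close>

lemma (in scattered_lc) lower_bound_from_biorthogonal:
  fixes T :: "('k, 's::{real_normed_field, banach, heine_borel}) c0_op" and M
  assumes inf: "infinite (UNIV :: 'k set)"
    and M: "algebra_norm calkin_scale M" "\<And>a :: ('k, 's) calkin. M a \<le> dual_essential_norm a"
    and x: "c0_converges x \<theta>' l'" and g: "disjoint_family_c0 g"
    and diag: "\<And>m. jump x \<theta>' l' (c0_op_apply T (g m)) m = of_real c"
    and off: "\<And>m N. (\<Sum>n\<in>{..<N} - {m}. norm (jump x \<theta>' l' (c0_op_apply T (g n)) m)) \<le> \<delta>"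
    and c: "0 \<le> c"
  shows "c - 2 * \<delta> \<le> M (calkin_of T)"
proof -
  obtain z0 :: "nat \<Rightarrow> 'k" where z0: "inj z0" "range z0 \<subseteq> {z. open {z}}"
    using infinite_countable_subset[OF infinite_isolated_points[OF inf]] by blast
  obtain r and \<theta> :: 's and l where r: "strict_mono r" "c0_converges (z0 \<circ> r) \<theta> l"
    by (rule ex_convergent_subsequence)
  define z where "z = z0 \<circ> r"
  interpret isolated_sequence z \<theta> l
  proof
    show "inj z" unfolding z_def using z0(1) r(1) by (intro inj_compose strict_mono_imp_inj_on)
    show "open {z n}" for n using z0(2) by (auto simp: z_def)
    show "c0_converges z \<theta> l" using r(2) by (simp add: z_def)
  qed
  define A where "A = jump_op e x \<theta>' l'"
  define B where "B = jump_op g z \<theta> l"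
  define R where "R = A * T * B - c0_op_scale (of_real c) P"
  have \<delta>: "0 \<le> \<delta>" using off[of 0 0] by simp
  have R: "norm R \<le> 2 * \<delta>"
  proof (rule norm_c0_op_leI)
    show "0 \<le> 2 * \<delta>" using \<delta> by simp
    fix h :: "('k, 's) c0"
    define t where "t = jump z \<theta> l h"
    define p where "p m n = jump x \<theta>' l' (c0_op_apply T (g n)) m" for m n
    have at: "norm (c0_apply (c0_op_apply R h) (z m)) \<le> 2 * norm h * \<delta>" for m
    proof -
      have bl: "bounded_linear (\<lambda>f. jump x \<theta>' l' (c0_op_apply T f) m)"
      proof -
        have "bounded_linear (\<lambda>f. c0_dual_apply (c0_delta (x m)) (c0_op_apply T f) - \<theta>' * c0_dual_apply (c0_delta l') (c0_op_apply T f))"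
          by (intro bounded_linear_sub bounded_linear_const_mult bounded_linear_compose[OF blinfun.bounded_linear_right blinfun.bounded_linear_right])
        then show ?thesis by (simp add: jump_def)
      qed
      have "(\<lambda>n. jump x \<theta>' l' (c0_op_apply T (c0_scale (t n) (g n))) m) sums
          jump x \<theta>' l' (c0_op_apply T (c0_op_apply B h)) m"
        using jump_op_sums[OF g z, of h] unfolding B_def t_def by (rule bounded_linear.sums[OF bl])
      moreover have "jump x \<theta>' l' (c0_op_apply T (c0_scale (t n) (g n))) m = t n * p m n" for n
        by (simp add: jump_def p_def c0_op_apply_c0_scale c0_apply_scale algebra_simps)
      ultimately have s: "(\<lambda>n. t n * p m n) sums jump x \<theta>' l' (c0_op_apply T (c0_op_apply B h)) m" by simp
      have eq: "c0_apply (c0_op_apply R h) (z m) = jump x \<theta>' l' (c0_op_apply T (c0_op_apply B h)) m - of_real c * t m"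
        by (simp add: R_def A_def P_def minus_c0_op.rep_eq times_c0_op.rep_eq blinfun.diff_left minus_c0.rep_eq
            c0_op_apply_scale c0_apply_scale jump_op_e_at[OF x] jump_op_e_at[OF z] t_def)
      have lim: "(\<lambda>N. norm ((\<Sum>n<N. t n * p m n) - of_real c * t m)) \<longlonglongrightarrow> norm (c0_apply (c0_op_apply R h) (z m))"
        unfolding eq using s unfolding sums_def by (intro tendsto_intros)
      show ?thesis
      proof (rule LIMSEQ_le_const2[OF lim], intro exI allI impI)
        fix N assume N: "Suc m \<le> N"
        have "(\<Sum>n<N. t n * p m n) = t m * p m m + (\<Sum>n\<in>{..<N} - {m}. t n * p m n)"
          using N by (intro sum.remove) auto
        then have "(\<Sum>n<N. t n * p m n) - of_real c * t m = (\<Sum>n\<in>{..<N} - {m}. t n * p m n)"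
          using diag[of m] by (simp add: p_def)
        also have "norm \<dots> \<le> (\<Sum>n\<in>{..<N} - {m}. 2 * norm h * norm (p m n))"
          unfolding t_def
          by (rule order.trans[OF norm_sum])
             (intro sum_mono, simp add: norm_mult mult_right_mono norm_jump_le[OF z])
        also have "\<dots> = 2 * norm h * (\<Sum>n\<in>{..<N} - {m}. norm (p m n))" by (simp add: sum_distrib_left)
        also have "\<dots> \<le> 2 * norm h * \<delta>" unfolding p_def by (intro mult_left_mono off) auto
        finally show "norm ((\<Sum>n<N. t n * p m n) - of_real c * t m) \<le> 2 * norm h * \<delta>" .
      qed
    qed
    show "norm (c0_op_apply R h) \<le> 2 * \<delta> * norm h"
    proof (rule norm_c0_le)
      fix w
      show "norm (c0_apply (c0_op_apply R h) w) \<le> 2 * \<delta> * norm h"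
      proof (cases "w \<in> range z")
        case True
        then show ?thesis using at by (auto simp: mult_ac)
      next
        case False
        then have "c0_apply (c0_op_apply R h) w = 0"
          by (simp add: R_def A_def P_def minus_c0_op.rep_eq times_c0_op.rep_eq blinfun.diff_left minus_c0.rep_eq
            c0_op_apply_scale c0_apply_scale jump_op_e_outside[OF x] jump_op_e_outside[OF z])
        then show ?thesis using \<delta> by simp
      qed
    qed
  qed
  have M_pos: "\<And>a. 0 \<le> M a" and M_0: "\<And>a. M a = 0 \<longleftrightarrow> a = 0"
    and M_scale: "\<And>c a. M (calkin_scale c a) = norm c * M a"
    and M_add: "\<And>a b. M (a + b) \<le> M a + M b" and M_mult: "\<And>a b. M (a * b) \<le> M a * M b"
    using M(1) unfolding algebra_norm_def by blast+
  have M_ess: "M (calkin_of S) \<le> ess (c0_adjoint S)" for S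
    using M(2)[of "calkin_of S"] by (simp add: dual_essential_norm_calkin_of)
  have "M (calkin_of R) \<le> 2 * \<delta>"
    using M_ess[of R] ess_le_norm[of "c0_adjoint R"] norm_c0_adjoint_le[of R] R by simp
  moreover have "M (calkin_of (A * T * B)) \<le> M (calkin_of T)"
  proof -
    have A1: "M (calkin_of A) \<le> 1" using M_ess[of A] ess_jump_op_le[OF disjoint_e x] by (simp add: A_def)
    have B1: "M (calkin_of B) \<le> 1" using M_ess[of B] ess_jump_op_le[OF g z] by (simp add: B_def)
    have "M (calkin_of (A * T * B)) \<le> M (calkin_of A * calkin_of T) * M (calkin_of B)"
      using M_mult by (simp flip: times_calkin.abs_eq)
    also have "\<dots> \<le> M (calkin_of A * calkin_of T)" using B1 M_pos by (simp add: mult_left_le)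
    also have "\<dots> \<le> M (calkin_of A) * M (calkin_of T)" by (rule M_mult)
    also have "\<dots> \<le> M (calkin_of T)" using A1 M_pos by (simp add: mult_left_le_one_le)
    finally show ?thesis .
  qed
  moreover have "c * M (calkin_of P) \<le> M (calkin_of (A * T * B)) + M (calkin_of R)"
  proof -
    have "calkin_scale (of_real c) (calkin_of P) = calkin_of (A * T * B) + calkin_scale (- 1) (calkin_of R)"
    proof -
      have "c0_op_scale (- 1) R = - R"
        by (rule c0_op_eqI) (simp add: c0_op_apply_scale uminus_c0_op.rep_eq blinfun.minus_left c0_scale_minus_one)
      then show ?thesis by (simp add: calkin_scale.abs_eq plus_calkin.abs_eq R_def)
    qed
    then have "M (calkin_scale (of_real c) (calkin_of P)) \<le> M (calkin_of (A * T * B)) + M (calkin_scale (- 1) (calkin_of R))"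
      using M_add by simp
    then have "norm (of_real c :: 's) * M (calkin_of P) \<le> M (calkin_of (A * T * B)) + norm (- 1 :: 's) * M (calkin_of R)"
      unfolding M_scale .
    then show ?thesis using c by simp
  qed
  moreover have "1 \<le> M (calkin_of P)"
  proof -
    have "calkin_of P \<noteq> 0"
      using P_not_compact unfolding zero_calkin_def calkin_of_eq_iff by simp
    then have "0 < M (calkin_of P)" using M_0 M_pos by (metis less_eq_real_def)
    moreover have "M (calkin_of P) \<le> M (calkin_of P) * M (calkin_of P)"
      using M_mult[of "calkin_of P" "calkin_of P"] by (simp add: times_calkin.abs_eq P_idem)
    ultimately show ?thesis by (simp add: mult_le_cancel_left1)
  qed
  then have "c \<le> c * M (calkin_of P)" using c by (simp add: mult_le_cancel_left1)
  ultimately show ?thesis by simp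
qed

section \<open>Minimality\<close>

lemma pairing_diff:
  assumes "summable_mass a" "summable_mass b"
  shows "pairing (\<lambda>y. a y - b y) f = pairing a f - pairing b f"
proof -
  have s: "(\<lambda>y. c y * c0_apply f y) summable_on UNIV" if "summable_mass c" for c
    by (rule summable_pairing[OF that norm_c0_apply_le])
  have "((\<lambda>y. a y * c0_apply f y + - (b y * c0_apply f y)) has_sum (pairing a f + - pairing b f)) UNIV"
    unfolding pairing_def using s[OF assms(1)] s[OF assms(2)]
    by (intro has_sum_add) (simp_all add: has_sum_uminus)
  then show ?thesis
    unfolding pairing_def[of "\<lambda>y. a y - b y"] by (intro infsumI) (simp add: left_diff_distrib)
qed

context scattered_lc
begin

text \<open>
  The row of the matrix of \<open>T\<close> at \<open>x\<close>: the atoms of the functional \<open>f \<mapsto> T f x\<close>.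
\<close>

definition row :: "('k, 's::{real_normed_field, banach}) c0_op \<Rightarrow> 'k \<Rightarrow> 'k \<Rightarrow> 's"
  where "row T x = atom (c0_adjoint T (c0_delta x))"

lemma summable_mass_row: "summable_mass (row T x)"
  unfolding row_def by (rule summable_mass_atom)

lemma mass_row_le:
  fixes T :: "('k, 's::{real_normed_field, banach}) c0_op"
  shows "mass (row T x) A \<le> norm (c0_adjoint T)"
proof -
  have "mass (row T x) A \<le> norm (c0_adjoint T (c0_delta x))" unfolding row_def by (rule mass_atom_le)
  also have "\<dots> \<le> norm (c0_adjoint T) * norm (c0_delta x :: ('k, 's) c0_dual)"
    by (rule norm_blinfun)
  also have "\<dots> \<le> norm (c0_adjoint T) * 1" by (intro mult_left_mono norm_c0_delta_le norm_ge_zero)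
  finally show ?thesis by simp
qed

lemma pairing_row: "pairing (row T x) f = c0_apply (c0_op_apply T f) x"
  using infsumI[OF has_sum_atom[of "c0_adjoint T (c0_delta x)" f]]
  by (simp add: pairing_def row_def c0_adjoint_apply)

lemma ex_row_mass_gt:
  fixes T :: "('k, 's::{real_normed_field, banach, heine_borel}) c0_op"
  assumes c: "0 \<le> c" "c < ess (c0_adjoint T)" and F: "finite F"
  shows "\<exists>x. c < mass (row T x) (- F)"
proof (rule ccontr)
  assume neg: "\<not> ?thesis"
  have "ess (c0_adjoint T) \<le> c"
  proof (rule ess_adjoint_le_if_vanishing[OF F c(1)], rule norm_c0_le)
    fix f :: "('k, 's) c0" and x assume f: "\<And>y. y \<in> F \<Longrightarrow> c0_apply f y = 0"
    have "norm (pairing (row T x) f) \<le> norm f * mass (row T x) (- F)"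
      unfolding pairing_def
      by (rule norm_infsum_pairing_le[OF summable_mass_row norm_c0_apply_le]) (use f in auto)
    also have "\<dots> \<le> norm f * c" using neg by (intro mult_left_mono) (auto simp: not_less)
    finally show "norm (c0_apply (c0_op_apply T f) x) \<le> c * norm f"
      by (simp add: pairing_row mult.commute)
  qed
  then show False using c by simp
qed

text \<open>
  The points are chosen recursively so that the row at each of them has mass greater than \<open>c\<close> off the finite sets
  \<open>G\<close> that carry most of the previous rows; this persists for subsequences.
\<close>

lemma ex_biorthogonal:
  fixes T :: "('k, 's::{real_normed_field, banach, heine_borel}) c0_op"
  assumes eps: "0 < \<epsilon>" "5 * \<epsilon> < c" and c: "c < ess (c0_adjoint T)"
  shows "\<exists>x \<theta> l g. c0_converges x \<theta> l \<and> disjoint_family_c0 g \<and>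
    (\<forall>m. jump x \<theta> l (c0_op_apply T (g m)) m = of_real (c - 5 * \<epsilon>)) \<and>
    (\<forall>m N. (\<Sum>n\<in>{..<N} - {m}. norm (jump x \<theta> l (c0_op_apply T (g n)) m)) \<le> 3 * \<epsilon>)"
proof -
  have c0: "0 \<le> c" using eps by simp
  have "\<forall>x. \<exists>G. finite G \<and> mass (row T x) (- G) \<le> \<epsilon>"
    using ex_finite_mass_compl_le[OF summable_mass_row eps(1)] by blast
  then obtain G where G: "\<And>x. finite (G x)" "\<And>x. mass (row T x) (- G x) \<le> \<epsilon>" by metis
  \<comment> \<open>The first component of the state accumulates the sets \<open>G\<close> of the points chosen before the second.\<close>
  have "\<exists>s. \<forall>m. (finite (fst (s m)) \<and> c < mass (row T (snd (s m))) (- fst (s m))) \<and>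
      fst (s (Suc m)) = fst (s m) \<union> G (snd (s m))"
  proof (rule dependent_nat_choice)
    obtain x where "c < mass (row T x) (- {})" using ex_row_mass_gt[OF c0 c, of "{}"] by blast
    then show "\<exists>s. finite (fst s) \<and> c < mass (row T (snd s)) (- fst s)"
      by (intro exI[of _ "({}, x)"]) simp
  next
    fix s :: "'k set \<times> 'k" and m :: nat assume s: "finite (fst s) \<and> c < mass (row T (snd s)) (- fst s)"
    have fin: "finite (fst s \<union> G (snd s))" using s G(1) by simp
    then obtain x where "c < mass (row T x) (- (fst s \<union> G (snd s)))"
      using ex_row_mass_gt[OF c0 c] by blast
    then show "\<exists>s'. (finite (fst s') \<and> c < mass (row T (snd s')) (- fst s')) \<and> fst s' = fst s \<union> G (snd s)"
      using fin by (intro exI[of _ "(fst s \<union> G (snd s), x)"]) simp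
  qed
  then obtain s where s: "\<And>m. c < mass (row T (snd (s m))) (- fst (s m))"
    "\<And>m. fst (s (Suc m)) = fst (s m) \<union> G (snd (s m))" by blast
  define y where "y m = snd (s m)" for m
  have "(\<Union>i<m. G (y i)) \<subseteq> fst (s m)" for m
    by (induction m) (auto simp: s(2) y_def lessThan_Suc)
  then have y: "c \<le> mass (row T (y m)) (- (\<Union>i<m. G (y i)))" for m
    using s(1)[of m] mass_mono[OF summable_mass_row, of "- fst (s m)" "- (\<Union>i<m. G (y i))" T "y m"]
    by (force simp: y_def)
  obtain r and \<theta> :: 's and l where r: "strict_mono r" "c0_converges (y \<circ> r) \<theta> l"
    by (rule ex_convergent_subsequence)
  define x where "x = y \<circ> r"
  have x: "c0_converges x \<theta> l" using r(2) by (simp add: x_def)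
  have escape: "c \<le> mass (row T (x m)) (- (\<Union>i<m. G (x i)))" for m
  proof -
    have "(\<Union>i<m. G (x i)) \<subseteq> (\<Union>i<r m. G (y i))"
    proof (rule UN_least)
      show "G (x i) \<subseteq> (\<Union>i<r m. G (y i))" if "i \<in> {..<m}" for i
        using that strict_monoD[OF r(1), of i m] by (auto simp: x_def)
    qed
    then have "mass (row T (x m)) (- (\<Union>i<r m. G (y i))) \<le> mass (row T (x m)) (- (\<Union>i<m. G (x i)))"
      by (intro mass_mono[OF summable_mass_row] iffD2[OF Compl_subset_Compl_iff])
    then show ?thesis using y[of "r m"] by (simp add: x_def)
  qed
  define b where "b = (\<lambda>z. \<theta> * row T l z)"
  have sb: "summable_mass b"
    using summable_mass_row[of T l] unfolding b_def norm_mult by (rule summable_on_cmult_right)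
  obtain H where H: "finite H" "mass b (- H) \<le> \<epsilon>"
    using ex_finite_mass_compl_le[OF sb eps(1)] by blast
  have pair: "pairing (\<lambda>z. row T (x m) z - b z) f = jump x \<theta> l (c0_op_apply T f) m" for m f
  proof -
    have "pairing b f = \<theta> * pairing (row T l) f"
      unfolding pairing_def b_def mult.assoc by (rule infsum_cmult_right')
    then show ?thesis by (simp add: pairing_diff[OF summable_mass_row sb] pairing_row jump_def)
  qed
  interpret gliding_hump K "\<lambda>m. row T (x m)" b "\<lambda>m. G (x m)" H "norm (c0_adjoint T)" c \<epsilon>
  proof
    show "(\<lambda>m. pairing (\<lambda>z. row T (x m) z - b z) f) \<longlonglongrightarrow> 0" for f
      unfolding pair using jump_tendsto[OF x] by simp
  qed (use summable_mass_row sb mass_row_le G H escape eps in auto)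
  obtain q g where q: "strict_mono q" "disjoint_family_c0 g"
    "\<And>k. pairing (\<nu> (q k)) (g k) = of_real (c - 5 * \<epsilon>)"
    "\<And>k N. (\<Sum>j\<in>{..<N} - {k}. norm (pairing (\<nu> (q k)) (g j))) \<le> 3 * \<epsilon>"
    using ex_gliding_hump by blast
  have \<nu>: "pairing (\<nu> (q k)) f = jump (x \<circ> q) \<theta> l (c0_op_apply T f) k" for k f
    unfolding \<nu>_def pair by (simp add: jump_def)
  show ?thesis
    using q(2-4) c0_converges_subseq[OF x q(1)] unfolding \<nu> by blast
qed

theorem dual_essential_norm_minimal:
  fixes a :: "('k, 's::{real_normed_field, banach, heine_borel}) calkin"
  assumes M: "algebra_norm calkin_scale M" "\<And>a :: ('k, 's) calkin. M a \<le> dual_essential_norm a"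
  shows "dual_essential_norm a \<le> M a"
proof (rule ccontr)
  assume neg: "\<not> ?thesis"
  obtain T where a: "a = calkin_of T" by (rule calkin_cases)
  define d where "d = ess (c0_adjoint T) - M a"
  define c where "c = M a + d / 2"
  \<comment> \<open>With \<open>\<epsilon> = d / 44\<close> the total loss \<open>5 * \<epsilon> + 2 * (3 * \<epsilon>)\<close> is \<open>d / 4\<close>.\<close>
  have M0: "0 \<le> M a" using M(1) by (simp add: algebra_norm_def)
  have d: "0 < d" using neg by (simp add: d_def a dual_essential_norm_calkin_of)
  have "ess (c0_adjoint T) = M a + d" by (simp add: d_def)
  then have c: "c < ess (c0_adjoint T)" "5 * (d / 44) < c" unfolding c_def using d M0 by linarith+
  have inf: "infinite (UNIV :: 'k set)"
  proof
    assume fin: "finite (UNIV :: 'k set)"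
    obtain x where "c < mass (row T x) (- UNIV)"
      using ex_row_mass_gt[OF _ c(1) fin] c(2) d by fastforce
    then show False using c(2) d by (simp add: mass_def)
  qed
  obtain x \<theta> l g where "c0_converges x \<theta> l" "disjoint_family_c0 g"
    "\<And>m. jump x \<theta> l (c0_op_apply T (g m)) m = of_real (c - 5 * (d / 44))"
    "\<And>m N. (\<Sum>n\<in>{..<N} - {m}. norm (jump x \<theta> l (c0_op_apply T (g n)) m)) \<le> 3 * (d / 44)"
    using ex_biorthogonal[of "d / 44" c T] c d by auto
  from lower_bound_from_biorthogonal[OF inf M this]
  have "c - 5 * (d / 44) - 2 * (3 * (d / 44)) \<le> M a" using c(2) by (simp add: a)
  then show False using d by (simp add: c_def)
qed

theorem bonsall_minimal_dual_essential_norm: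
  "bonsall_minimal calkin_scale
    (dual_essential_norm :: ('k, 's::{real_normed_field, banach, heine_borel}) calkin \<Rightarrow> real)"
  unfolding bonsall_minimal_def
  using dual_essential_norm_algebra_norm dual_essential_norm_minimal by (blast intro: order.antisym)

end

theorem theorem1p5:
  assumes "locally_compact_space (euclidean :: 'k::t2_space topology)"
    and "scattered (UNIV :: 'k set)"
  shows "bonsall_minimal calkin_scale (dual_essential_norm :: ('k, real) calkin \<Rightarrow> real) \<and>
         bonsall_minimal calkin_scale (dual_essential_norm :: ('k, complex) calkin \<Rightarrow> real)"
proof -
  interpret scattered_lc "TYPE('k)" by unfold_locales (fact assms)+
  show ?thesis by (intro conjI bonsall_minimal_dual_essential_norm)
qed

end
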